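(* Consider Problem (SLQ) described in the context, with data satisfying the listed integrability assumptions, and let $t\in[0,T)$. If the open-loop optimal controls of Problem (SLQ) on $[t,T]$ admit a closed-loop representation, then every open-loop optimal control must be an outcome of a closed-loop optimal strategy; that is, for every $x\in\mathbb{R}^n$ and every open-loop optimal control $\bar u(\cdot)$ for $(t,x)$ there is a closed-loop optimal strategy $(\bar\Theta(\cdot),\bar v(\cdot))$ on $[t,T]$ such that $\bar u=\bar\Theta\bar X+\bar v$ on $[t,T]$, where $\bar X=X(\cdot;t,x,\bar\Theta,\bar v)$.
   Context: Let $T>0$ and let $(\Omega,\mathcal{F},\mathbb{F},\mathbb{P})$ be a complete filtered probability space carrying a standard one-dimensional Brownian motion $W$, with $\mathbb{F}=\{\mathcal{F}_t\}_{t\ge0}$ the natural filtration of $W$ augmented by all $\mathbb{P}$-null sets. $\mathbb{S}^k$ is the set of symmetric $k\times k$ real matrices. For a Euclidean space $\mathbb{H}$: $L^p(t,T;\mathbb{H})$ is the usual space of deterministic functions; $L^2_{\mathcal{F}_T}(\Omega;\mathbb{H})$ is the space of square-integrable $\mathcal{F}_T$-measurable random variables; $L^2_{\mathbb{F}}(t,T;\mathbb{H})$ is the space of $\mathbb{F}$-progressively measurable $\varphi$ with $\mathbb{E}\int_t^T|\varphi|^2ds<\infty$; $L^2_{\mathbb{F}}(\Omega;L^1(t,T;\mathbb{H}))$ is the space of progressively measurable $\varphi$ with $\mathbb{E}(\int_t^T|\varphi|ds)^2<\infty$. The time variable is suppressed; equality of processes is for a.e. $s$, a.s. Problem (SLQ).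 Integrability assumptions: $A\in L^1(0,T;\mathbb{R}^{n\times n})$, $B\in L^2(0,T;\mathbb{R}^{n\times m})$, $b\in L^2_{\mathbb{F}}(\Omega;L^1(0,T;\mathbb{R}^n))$, $C\in L^2(0,T;\mathbb{R}^{n\times n})$, $D\in L^\infty(0,T;\mathbb{R}^{n\times m})$, $\sigma\in L^2_{\mathbb{F}}(0,T;\mathbb{R}^n)$, $Q\in L^1(0,T;\mathbb{S}^n)$, $S\in L^2(0,T;\mathbb{R}^{m\times n})$, $R\in L^\infty(0,T;\mathbb{S}^m)$, $q\in L^2_{\mathbb{F}}(\Omega;L^1(0,T;\mathbb{R}^n))$, $\rho\in L^2_{\mathbb{F}}(0,T;\mathbb{R}^m)$, $g\in L^2_{\mathcal{F}_T}(\Omega;\mathbb{R}^n)$, $G\in\mathbb{S}^n$. Controls: $\mathcal{U}[t,T]=L^2_{\mathbb{F}}(t,T;\mathbb{R}^m)$. The state solves $dX=(AX+Bu+b)ds+(CX+Du+\sigma)dW$ on $[t,T]$, $X(t)=x$, and the cost is $$J(t,x;u)=\mathbb{E}\Big\{\langle GX(T),X(T)\rangle+2\langle g,X(T)\rangle+\int_t^T\big[\langle QX,X\rangle+2\langle SX,u\rangle+\langle Ru,u\rangle+2\langle q,X\rangle+2\langle\rho,u\rangle\big]ds\Big\}.$$ $\bar u\in\mathcal{U}[t,T]$ is an open-loop optimal control for $(t,x)$ if $J(t,x;\bar u)=\inf_{u\in\mathcal{U}[t,T]}J(t,x;u)$. For $\Theta\in\mathcal{Q}[t,T]=L^2(t,T;\mathbb{R}^{m\times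 n})$ and $v\in\mathcal{U}[t,T]$ let $X(\cdot;t,x,\Theta,v)$ solve $$dX=\{(A+B\Theta)X+Bv+b\}ds+\{(C+D\Theta)X+Dv+\sigma\}dW,\quad s\in[t,T],\qquad X(t)=x.$$ The process $\Theta X+v$ is the outcome of $(\Theta,v)$ for $x$. A pair $(\bar\Theta,\bar v)\in\mathcal{Q}[t,T]\times\mathcal{U}[t,T]$ is a closed-loop optimal strategy on $[t,T]$ if $J(t,x;\bar\Theta\bar X+\bar v)\le J(t,x;\Theta X+v)$ for all $x\in\mathbb{R}^n$ and all $(\Theta,v)\in\mathcal{Q}[t,T]\times\mathcal{U}[t,T]$, where $\bar X=X(\cdot;t,x,\bar\Theta,\bar v)$ and $X=X(\cdot;t,x,\Theta,v)$. The open-loop optimal controls on $[t,T]$ admit a closed-loop representation if there exists $(\Theta,v)\in\mathcal{Q}[t,T]\times\mathcal{U}[t,T]$ such that for every $x\in\mathbb{R}^n$ the process $\Theta X+v$, with $X=X(\cdot;t,x,\Theta,v)$, is an open-loop optimal control for $(t,x)$. *)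

theory Defs
  imports "HOL-Probability.Probability"
begin

section \<open>Brownian motion and its filtrations\<close>

definition natural_filtration :: "'a measure \<Rightarrow> (real \<Rightarrow> 'a \<Rightarrow> real) \<Rightarrow> real \<Rightarrow> 'a measure" where
  "natural_filtration M W s =
     sigma (space M) {W r -` E \<inter> space M | r E. 0 \<le> r \<and> r \<le> s \<and> E \<in> sets borel}"

definition augmented_filtration :: "'a measure \<Rightarrow> (real \<Rightarrow> 'a \<Rightarrow> real) \<Rightarrow> real \<Rightarrow> 'a measure" where
  "augmented_filtration M W s =
     sigma (space M) (sets (natural_filtration M W s) \<union> null_sets M)"

text \<open>Only the values of \<open>W\<close> at times \<open>s \<ge> 0\<close> matter.\<close>

definition brownian_motion :: "'a measure \<Rightarrow> (real \<Rightarrow> 'a \<Rightarrow> real) \<Rightarrow> bool" where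
  "brownian_motion M W \<longleftrightarrow>
     (\<forall>s\<ge>0. W s \<in> borel_measurable M) \<and>
     (AE \<omega> in M. W 0 \<omega> = 0) \<and>
     (AE \<omega> in M. continuous_on {0..} (\<lambda>s. W s \<omega>)) \<and>
     (\<forall>s r. 0 \<le> s \<and> s < r \<longrightarrow>
        distributed M lborel (\<lambda>\<omega>. W r \<omega> - W s \<omega>) (normal_density 0 (sqrt (r - s))) \<and>
        prob_space.indep_set M (sets (natural_filtration M W s))
          {(\<lambda>\<omega>. W r \<omega> - W s \<omega>) -` E \<inter> space M | E. E \<in> sets borel})"

section \<open>Function spaces\<close>

text \<open>
  Elements of the \<open>L\<^sup>p\<close> spaces are represented by functions on the whole time axis of which only
  the restriction to the interval is constrained. Representatives are Borel, so that products
  with progressively measurable processes are again progressively measurable; every Lebesgue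
  class has such a representative.
\<close>

definition L_fun :: "nat \<Rightarrow> real \<Rightarrow> real \<Rightarrow> (real \<Rightarrow> 'b::euclidean_space) set" where
  "L_fun p t T = {f. set_borel_measurable borel {t..T} f \<and>
     set_integrable lborel {t..T} (\<lambda>s. norm (f s) ^ p)}"

definition Linf_fun :: "real \<Rightarrow> real \<Rightarrow> (real \<Rightarrow> 'b::euclidean_space) set" where
  "Linf_fun t T = {f. set_borel_measurable borel {t..T} f \<and>
     (\<exists>K. AE s in lborel. s \<in> {t..T} \<longrightarrow> norm (f s) \<le> K)}"

definition prog_measurable ::
    "(real \<Rightarrow> 'a measure) \<Rightarrow> real \<Rightarrow> real \<Rightarrow> (real \<Rightarrow> 'a \<Rightarrow> 'b::euclidean_space) \<Rightarrow> bool" where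
  "prog_measurable F t T \<phi> \<longleftrightarrow>
     (\<forall>s\<in>{t..T}. (\<lambda>(r, \<omega>). \<phi> r \<omega>) \<in>
        borel_measurable (restrict_space borel {t..s} \<Otimes>\<^sub>M F s))"

definition L2_prog :: "'a measure \<Rightarrow> (real \<Rightarrow> 'a measure) \<Rightarrow> real \<Rightarrow> real \<Rightarrow>
    (real \<Rightarrow> 'a \<Rightarrow> 'b::euclidean_space) set" where
  "L2_prog M F t T = {\<phi>. prog_measurable F t T \<phi> \<and>
     (\<integral>\<^sup>+\<omega>. (\<integral>\<^sup>+s\<in>{t..T}. ennreal ((norm (\<phi> s \<omega>))\<^sup>2) \<partial>lborel) \<partial>M) < \<infinity>}"

text \<open>The space \<open>L\<^sup>2(\<Omega>; L\<^sup>1(t,T))\<close> of progressively measurable processes.\<close>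

definition L2L1_prog :: "'a measure \<Rightarrow> (real \<Rightarrow> 'a measure) \<Rightarrow> real \<Rightarrow> real \<Rightarrow>
    (real \<Rightarrow> 'a \<Rightarrow> 'b::euclidean_space) set" where
  "L2L1_prog M F t T = {\<phi>. prog_measurable F t T \<phi> \<and>
     (\<integral>\<^sup>+\<omega>. (\<integral>\<^sup>+s\<in>{t..T}. ennreal (norm (\<phi> s \<omega>)) \<partial>lborel)\<^sup>2 \<partial>M) < \<infinity>}"

text \<open>The space \<open>L\<^sup>2(\<Omega>; C([t,T]))\<close> of progressively measurable processes, in which linear stochastic
  differential equations are uniquely solvable.\<close>

definition L2C_prog :: "'a measure \<Rightarrow> (real \<Rightarrow> 'a measure) \<Rightarrow> real \<Rightarrow> real \<Rightarrow>
    (real \<Rightarrow> 'a \<Rightarrow> 'b::euclidean_space) set" where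
  "L2C_prog M F t T = {\<phi>. prog_measurable F t T \<phi> \<and>
     (AE \<omega> in M. continuous_on {t..T} (\<lambda>s. \<phi> s \<omega>)) \<and>
     (\<integral>\<^sup>+\<omega>. (SUP s\<in>{t..T}. ennreal ((norm (\<phi> s \<omega>))\<^sup>2)) \<partial>M) < \<infinity>}"

section \<open>The Ito integral of square integrable integrands\<close>

text \<open>A list of triples \<open>(a, b, \<xi>)\<close> encodes the simple integrand \<open>\<Sum> 1\<^bsub>(a,b]\<^esub> \<xi>\<close>, where each \<open>\<xi>\<close> is
  bounded and known at time \<open>a\<close>. The intervals may overlap; a common refinement
  of the end points yields the usual form over a partition.\<close>

type_synonym ('a, 'b) simple_integrand = "(real \<times> real \<times> ('a \<Rightarrow> 'b)) list"

definition is_simple_integrand :: "'a measure \<Rightarrow> (real \<Rightarrow> 'a measure) \<Rightarrow> real \<Rightarrow> real \<Rightarrow>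
    ('a, 'b::euclidean_space) simple_integrand \<Rightarrow> bool" where
  "is_simple_integrand M F t s P \<longleftrightarrow>
     (\<forall>(a, b, \<xi>)\<in>set P. t \<le> a \<and> a \<le> b \<and> b \<le> s \<and> \<xi> \<in> borel_measurable (F a) \<and>
        (\<exists>K. \<forall>\<omega>\<in>space M. norm (\<xi> \<omega>) \<le> K))"

definition simple_process ::
    "('a, 'b::euclidean_space) simple_integrand \<Rightarrow> real \<Rightarrow> 'a \<Rightarrow> 'b" where
  "simple_process P r \<omega> = (\<Sum>(a, b, \<xi>)\<leftarrow>P. indicator {a<..b} r *\<^sub>R \<xi> \<omega>)"

definition simple_integral ::
    "(real \<Rightarrow> 'a \<Rightarrow> real) \<Rightarrow> ('a, 'b::euclidean_space) simple_integrand \<Rightarrow> 'a \<Rightarrow> 'b" where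
  "simple_integral W P \<omega> = (\<Sum>(a, b, \<xi>)\<leftarrow>P. (W b \<omega> - W a \<omega>) *\<^sub>R \<xi> \<omega>)"

text \<open>The random variable \<open>I\<close> is (a version of) the integral of \<open>\<phi>\<close> with respect to \<open>W\<close> over \<open>[t, s]\<close>.\<close>

definition has_ito_integral :: "'a measure \<Rightarrow> (real \<Rightarrow> 'a \<Rightarrow> real) \<Rightarrow> real \<Rightarrow> real \<Rightarrow>
    (real \<Rightarrow> 'a \<Rightarrow> 'b::euclidean_space) \<Rightarrow> ('a \<Rightarrow> 'b) \<Rightarrow> bool" where
  "has_ito_integral M W t s \<phi> I \<longleftrightarrow>
     \<phi> \<in> L2_prog M (augmented_filtration M W) t s \<and> I \<in> borel_measurable M \<and>
     (\<exists>P. (\<forall>k. is_simple_integrand M (augmented_filtration M W) t s (P k)) \<and>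
       (\<lambda>k::nat. \<integral>\<^sup>+\<omega>. (\<integral>\<^sup>+r\<in>{t..s}.
          ennreal ((norm (\<phi> r \<omega> - simple_process (P k) r \<omega>))\<^sup>2) \<partial>lborel) \<partial>M) \<longlonglongrightarrow> 0 \<and>
       (\<lambda>k. \<integral>\<^sup>+\<omega>. ennreal ((norm (I \<omega> - simple_integral W (P k) \<omega>))\<^sup>2) \<partial>M) \<longlonglongrightarrow> 0)"

text \<open>The process \<open>X\<close> satisfies \<open>dX = \<beta> ds + \<gamma> dW\<close> on \<open>[t, T]\<close> with \<open>X(t) = x\<close>, where \<open>\<beta>\<close> and \<open>\<gamma>\<close> are the
  coefficients already evaluated along \<open>X\<close>. The initial condition is the case \<open>s = t\<close>.\<close>

definition sde_solution :: "'a measure \<Rightarrow> (real \<Rightarrow> 'a \<Rightarrow> real) \<Rightarrow> real \<Rightarrow> real \<Rightarrow> 'b \<Rightarrow>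
    (real \<Rightarrow> 'a \<Rightarrow> 'b) \<Rightarrow> (real \<Rightarrow> 'a \<Rightarrow> 'b) \<Rightarrow> (real \<Rightarrow> 'a \<Rightarrow> 'b::euclidean_space) \<Rightarrow> bool" where
  "sde_solution M W t T x \<beta> \<gamma> X \<longleftrightarrow>
     X \<in> L2C_prog M (augmented_filtration M W) t T \<and>
     (\<forall>s\<in>{t..T}. \<exists>I. has_ito_integral M W t s \<gamma> I \<and>
        (AE \<omega> in M. X s \<omega> = x + (LINT r:{t..s}|lborel. \<beta> r \<omega>) + I \<omega>))"

section \<open>The stochastic linear-quadratic problem\<close>

locale slq = prob_space M
  for M :: "'a measure" +
  fixes W :: "real \<Rightarrow> 'a \<Rightarrow> real"
    and T :: real
    and A :: "real \<Rightarrow> real^'n^'n"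
    and B :: "real \<Rightarrow> real^'m^'n"
    and b :: "real \<Rightarrow> 'a \<Rightarrow> real^'n"
    and C :: "real \<Rightarrow> real^'n^'n"
    and D :: "real \<Rightarrow> real^'m^'n"
    and \<sigma> :: "real \<Rightarrow> 'a \<Rightarrow> real^'n"
    and Q :: "real \<Rightarrow> real^'n^'n"
    and S :: "real \<Rightarrow> real^'n^'m"
    and R :: "real \<Rightarrow> real^'m^'m"
    and q :: "real \<Rightarrow> 'a \<Rightarrow> real^'n"
    and \<rho> :: "real \<Rightarrow> 'a \<Rightarrow> real^'m"
    and g :: "'a \<Rightarrow> real^'n"
    and G :: "real^'n^'n"
  assumes complete: "complete_measure M"
    and brownian: "brownian_motion M W"
    and T_pos: "0 < T"
    and A: "A \<in> L_fun 1 0 T"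
    and B: "B \<in> L_fun 2 0 T"
    and b: "b \<in> L2L1_prog M (augmented_filtration M W) 0 T"
    and C: "C \<in> L_fun 2 0 T"
    and D: "D \<in> Linf_fun 0 T"
    and \<sigma>: "\<sigma> \<in> L2_prog M (augmented_filtration M W) 0 T"
    and Q: "Q \<in> L_fun 1 0 T" "AE s in lborel. s \<in> {0..T} \<longrightarrow> transpose (Q s) = Q s"
    and S: "S \<in> L_fun 2 0 T"
    and R: "R \<in> Linf_fun 0 T" "AE s in lborel. s \<in> {0..T} \<longrightarrow> transpose (R s) = R s"
    and q: "q \<in> L2L1_prog M (augmented_filtration M W) 0 T"
    and \<rho>: "\<rho> \<in> L2_prog M (augmented_filtration M W) 0 T"
    and g: "g \<in> borel_measurable (augmented_filtration M W T)"
      "integrable M (\<lambda>\<omega>. (norm (g \<omega>))\<^sup>2)"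
    and G: "transpose G = G"
begin

definition controls :: "real \<Rightarrow> (real \<Rightarrow> 'a \<Rightarrow> real^'m) set" where
  "controls t = L2_prog M (augmented_filtration M W) t T"

definition feedback_gains :: "real \<Rightarrow> (real \<Rightarrow> real^'n^'m) set" where
  "feedback_gains t = L_fun 2 t T"

definition state :: "real \<Rightarrow> real^'n \<Rightarrow> (real \<Rightarrow> 'a \<Rightarrow> real^'m) \<Rightarrow>
    (real \<Rightarrow> 'a \<Rightarrow> real^'n) \<Rightarrow> bool" where
  "state t x u X \<longleftrightarrow> sde_solution M W t T x
     (\<lambda>s \<omega>. A s *v X s \<omega> + B s *v u s \<omega> + b s \<omega>)
     (\<lambda>s \<omega>. C s *v X s \<omega> + D s *v u s \<omega> + \<sigma> s \<omega>) X"

definition cost :: "real \<Rightarrow> (real \<Rightarrow> 'a \<Rightarrow> real^'n) \<Rightarrow> (real \<Rightarrow> 'a \<Rightarrow> real^'m) \<Rightarrow> real" where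
  "cost t X u = expectation (\<lambda>\<omega>.
     (G *v X T \<omega>) \<bullet> X T \<omega> + 2 * (g \<omega> \<bullet> X T \<omega>) +
     (LINT s:{t..T}|lborel.
        (Q s *v X s \<omega>) \<bullet> X s \<omega> + 2 * ((S s *v X s \<omega>) \<bullet> u s \<omega>) + (R s *v u s \<omega>) \<bullet> u s \<omega> +
        2 * (q s \<omega> \<bullet> X s \<omega>) + 2 * (\<rho> s \<omega> \<bullet> u s \<omega>)))"

text \<open>The state equation has a solution for every control, unique up to indistinguishability, so the
  choice of \<open>X\<close> is immaterial and the second branch only makes the function total.\<close>

definition J :: "real \<Rightarrow> real^'n \<Rightarrow> (real \<Rightarrow> 'a \<Rightarrow> real^'m) \<Rightarrow> ereal" where
  "J t x u = (if \<exists>X. state t x u X then ereal (cost t (SOME X. state t x u X) u) else \<infinity>)"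

definition open_loop_optimal :: "real \<Rightarrow> real^'n \<Rightarrow> (real \<Rightarrow> 'a \<Rightarrow> real^'m) \<Rightarrow> bool" where
  "open_loop_optimal t x u \<longleftrightarrow> u \<in> controls t \<and> J t x u = (INF u'\<in>controls t. J t x u')"

text \<open>The process \<open>X\<close> is (a version of) \<open>X(\<cdot>; t, x, \<Theta>, v)\<close>. Such an \<open>X\<close> exists and is unique up to
  indistinguishability, so quantifying over it existentially or universally makes no difference.\<close>

definition closed_loop_state :: "real \<Rightarrow> real^'n \<Rightarrow> (real \<Rightarrow> real^'n^'m) \<Rightarrow>
    (real \<Rightarrow> 'a \<Rightarrow> real^'m) \<Rightarrow> (real \<Rightarrow> 'a \<Rightarrow> real^'n) \<Rightarrow> bool" where
  "closed_loop_state t x \<Theta> v X \<longleftrightarrow> sde_solution M W t T x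
     (\<lambda>s \<omega>. (A s + B s ** \<Theta> s) *v X s \<omega> + B s *v v s \<omega> + b s \<omega>)
     (\<lambda>s \<omega>. (C s + D s ** \<Theta> s) *v X s \<omega> + D s *v v s \<omega> + \<sigma> s \<omega>) X"

definition outcome :: "(real \<Rightarrow> real^'n^'m) \<Rightarrow> (real \<Rightarrow> 'a \<Rightarrow> real^'m) \<Rightarrow>
    (real \<Rightarrow> 'a \<Rightarrow> real^'n) \<Rightarrow> real \<Rightarrow> 'a \<Rightarrow> real^'m" where
  "outcome \<Theta> v X = (\<lambda>s \<omega>. \<Theta> s *v X s \<omega> + v s \<omega>)"

definition closed_loop_optimal :: "real \<Rightarrow> (real \<Rightarrow> real^'n^'m) \<Rightarrow>
    (real \<Rightarrow> 'a \<Rightarrow> real^'m) \<Rightarrow> bool" where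
  "closed_loop_optimal t \<Theta>' v' \<longleftrightarrow> \<Theta>' \<in> feedback_gains t \<and> v' \<in> controls t \<and>
     (\<forall>x. \<exists>X'. closed_loop_state t x \<Theta>' v' X' \<and>
        (\<forall>\<Theta>\<in>feedback_gains t. \<forall>v\<in>controls t. \<forall>X. closed_loop_state t x \<Theta> v X \<longrightarrow>
           J t x (outcome \<Theta>' v' X') \<le> J t x (outcome \<Theta> v X)))"

definition closed_loop_representation :: "real \<Rightarrow> bool" where
  "closed_loop_representation t \<longleftrightarrow>
     (\<exists>\<Theta>\<in>feedback_gains t. \<exists>v\<in>controls t. \<forall>x. \<exists>X.
        closed_loop_state t x \<Theta> v X \<and> open_loop_optimal t x (outcome \<Theta> v X))"

end

end

theory Submission
  imports Defs
begin

text \<open>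
  Let \<open>\<Theta>\<close> be the feedback gain of the representation, and for each initial value \<open>x\<close> let \<open>u\<^sub>x\<close> be the
  optimal control that the representing pair produces. Given any optimal control \<open>u\<close> for \<open>x\<close> with
  state \<open>X\<close>, put \<open>v = u - \<Theta> X\<close>. Then \<open>u\<close> is the outcome of \<open>(\<Theta>, v)\<close> from \<open>x\<close> by construction, and the whole
  question is whether the outcome of \<open>(\<Theta>, v)\<close> from every other initial value \<open>y\<close> is optimal too.

  The closed-loop equations are affine, so this outcome is \<open>u\<^sub>y + h\<close> with \<open>h = u - u\<^sub>x\<close>, and its state is
  a superposition of states that are already at hand (\<open>state_translate\<close>). The cost is a quadratic
  functional on the pairs (state, control), hence its second difference in the direction \<open>h\<close> is the
  same at all base points (\<open>cost_second_difference\<close>). The direction \<open>h\<close> joins the two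
  minimisers \<open>u\<^sub>x\<close> and \<open>u\<close> for \<open>x\<close>; comparing them with their midpoint shows that this second
  difference is at most zero. At \<open>y\<close> this says that the costs of \<open>u\<^sub>y + h\<close> and \<open>u\<^sub>y - h\<close> add up to at most
  twice the cost of the minimiser \<open>u\<^sub>y\<close>, so both are equal to it (\<open>open_loop_optimal_translate\<close>).

  Two analytic facts make this rigorous. The cost must be a function of the control alone, which is
  the uniqueness of solutions of linear stochastic differential equations (\<open>linear_sde_zero\<close>): the
  mean square of the difference of two solutions satisfies an integral inequality with an integrable
  kernel, by the mean square bound for the Ito integral (\<open>ito_integral_bound\<close>) and the Cauchy-Schwarz inequality for the
  drift, and Gronwall's argument applies. And the running cost must be integrable on the product of \<open>\<Omega>\<close>
  and the time interval (\<open>running_integrable\<close>), so that pointwise identities between quadratic forms can be integrated.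
\<close>

section \<open>Inequalities for norms, integrals and quadratic forms\<close>

lemma norm_matrix_vector_mult_le: "norm (A *v x) \<le> norm A * norm (x :: real^'n)" for A :: "real^'n^'m"
proof -
  have "norm (A *v x) = L2_set (\<lambda>i. norm ((A *v x) $ i)) UNIV" by (simp add: norm_vec_def)
  also have "\<dots> \<le> L2_set (\<lambda>i. norm x * norm (A $ i)) UNIV"
  proof (rule L2_set_mono)
    fix i
    have "(A *v x) $ i = A $ i \<bullet> x"
      by (simp add: matrix_vector_mult_def inner_vec_def)
    then show "norm ((A *v x) $ i) \<le> norm x * norm (A $ i)"
      using Cauchy_Schwarz_ineq2[of "A $ i" x] by (simp add: mult.commute)
  qed simp
  also have "\<dots> = norm x * L2_set (\<lambda>i. norm (A $ i)) UNIV"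
    by (rule L2_set_right_distrib[symmetric]) simp
  finally show ?thesis by (simp add: norm_vec_def mult.commute)
qed

lemma L_fun_subset: "f \<in> L_fun p t' T \<Longrightarrow> t' \<le> t \<Longrightarrow> f \<in> L_fun p t T"
  unfolding L_fun_def
  by (auto intro: set_borel_measurable_subset set_integrable_subset)

lemma ennreal_mult_le_sum_squares: "x * y \<le> x\<^sup>2 + (y\<^sup>2 :: ennreal)"
proof (cases "x \<le> y")
  case True
  then have "x * y \<le> y\<^sup>2" by (simp add: power2_eq_square mult_right_mono)
  also have "\<dots> \<le> x\<^sup>2 + y\<^sup>2" by simp
  finally show ?thesis .
next
  case False
  then have "x * y \<le> x\<^sup>2" by (simp add: power2_eq_square mult_left_mono)
  also have "\<dots> \<le> x\<^sup>2 + y\<^sup>2" by simp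
  finally show ?thesis .
qed

text \<open>
  The parallelogram bound in the form that serves both random variables and processes.
\<close>

lemma nn_integral_norm_square_lincomb_le:
  fixes f g :: "'c \<Rightarrow> 'b::euclidean_space"
  assumes [measurable]: "f \<in> borel_measurable N" "g \<in> borel_measurable N"
  shows "(\<integral>\<^sup>+x. ennreal ((norm (a *\<^sub>R f x + c *\<^sub>R g x))\<^sup>2) \<partial>N) \<le>
    ennreal (2 * a\<^sup>2) * (\<integral>\<^sup>+x. ennreal ((norm (f x))\<^sup>2) \<partial>N) +
    ennreal (2 * c\<^sup>2) * (\<integral>\<^sup>+x. ennreal ((norm (g x))\<^sup>2) \<partial>N)"
proof -
  have "(norm (a *\<^sub>R f x + c *\<^sub>R g x))\<^sup>2 \<le> 2 * a\<^sup>2 * (norm (f x))\<^sup>2 + 2 * c\<^sup>2 * (norm (g x))\<^sup>2" for x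
  proof -
    have "(norm (a *\<^sub>R f x + c *\<^sub>R g x))\<^sup>2 \<le> (norm (a *\<^sub>R f x) + norm (c *\<^sub>R g x))\<^sup>2"
      by (intro power_mono norm_triangle_ineq) auto
    also have "\<dots> \<le> 2 * (norm (a *\<^sub>R f x))\<^sup>2 + 2 * (norm (c *\<^sub>R g x))\<^sup>2"
      using sum_squares_bound[of "norm (a *\<^sub>R f x)" "norm (c *\<^sub>R g x)"] by (simp add: power2_sum)
    finally show ?thesis by (simp add: power_mult_distrib)
  qed
  then have "(\<integral>\<^sup>+x. ennreal ((norm (a *\<^sub>R f x + c *\<^sub>R g x))\<^sup>2) \<partial>N) \<le>
      (\<integral>\<^sup>+x. ennreal (2 * a\<^sup>2) * ennreal ((norm (f x))\<^sup>2) + ennreal (2 * c\<^sup>2) * ennreal ((norm (g x))\<^sup>2) \<partial>N)"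
    by (intro nn_integral_mono) (simp flip: ennreal_mult ennreal_plus)
  also have "\<dots> = ennreal (2 * a\<^sup>2) * (\<integral>\<^sup>+x. ennreal ((norm (f x))\<^sup>2) \<partial>N) +
    ennreal (2 * c\<^sup>2) * (\<integral>\<^sup>+x. ennreal ((norm (g x))\<^sup>2) \<partial>N)"
    by (simp add: nn_integral_add nn_integral_cmult)
  finally show ?thesis .
qed

lemma tendsto_zero_ennreal_lincomb:
  fixes f g h :: "nat \<Rightarrow> ennreal"
  assumes "f \<longlonglongrightarrow> 0" "g \<longlonglongrightarrow> 0" "\<And>k. h k \<le> ennreal a * f k + ennreal c * g k"
  shows "h \<longlonglongrightarrow> 0"
proof (rule tendsto_sandwich[OF _ _ tendsto_const])
  have "(\<lambda>k. ennreal a * f k + ennreal c * g k) \<longlonglongrightarrow> ennreal a * 0 + ennreal c * 0"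
    by (intro tendsto_add tendsto_mult_ennreal tendsto_const assms) auto
  then show "(\<lambda>k. ennreal a * f k + ennreal c * g k) \<longlonglongrightarrow> 0" by simp
qed (use assms(3) in auto)

lemma closure_rationals_Ioo: "t < T \<Longrightarrow> closure ({t<..<T} \<inter> \<rat>) = {t..T::real}"
  using closure_open_Int_superset[of "{t<..<T}" "\<rat>"] by (simp add: Rats_closure_real)

context bounded_bilinear begin

text \<open>
  Both sides are twice the value of the form at \<open>(x1 - x0, y1 - y0)\<close>: the factor 4 is there
  because the step on the left is half as long as the one on the right.
\<close>

lemma second_difference_invariant:
  "4 *\<^sub>R (prod x1 y1 + prod x0 y0 - 2 *\<^sub>R prod ((1/2) *\<^sub>R x0 + (1/2) *\<^sub>R x1) ((1/2) *\<^sub>R y0 + (1/2) *\<^sub>R y1)) =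
   prod (p + x1 - x0) (r + y1 - y0) + prod (p + x0 - x1) (r + y0 - y1) - 2 *\<^sub>R prod p r"
proof -
  have "2 *\<^sub>R z = z + z" "4 *\<^sub>R z = z + z + (z + z)" for z :: 'c
    using scaleR_left_distrib[of 2 2 z] by (simp_all add: scaleR_2)
  then show ?thesis
    by (simp add: add_left add_right diff_left diff_right scaleR_left scaleR_right algebra_simps)
qed

end

section \<open>A Gronwall lemma\<close>

lemma ennreal_half: "ennreal (1/2) = 1/2"
  by (simp add: ennreal_divide_numeral flip: ennreal_1)

text \<open>
  The indefinite integral of an integrable kernel is continuous on a compact interval, hence
  uniformly continuous.
\<close>

lemma small_integral_partition:
  fixes k :: "real \<Rightarrow> real"
  assumes k: "set_integrable lborel {t..T} k" "\<And>r. 0 \<le> k r"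
  shows "\<exists>d>0. \<forall>s\<in>{t..T}. \<forall>r\<in>{t..T}. s \<le> r \<and> r < s + d \<longrightarrow>
    (\<integral>\<^sup>+u\<in>{s..r}. ennreal (k u) \<partial>lborel) \<le> 1/2"
proof -
  have int: "k integrable_on {t..T}" by (rule set_borel_integral_eq_integral(1)[OF k(1)])
  define \<phi> where "\<phi> s = integral {t..s} k" for s
  have "continuous_on {t..T} \<phi>"
    unfolding \<phi>_def by (rule indefinite_integral_continuous_1[OF int])
  then have "uniformly_continuous_on {t..T} \<phi>" by (rule compact_uniformly_continuous) simp
  then obtain d where d: "0 < d" "\<And>s r. s \<in> {t..T} \<Longrightarrow> r \<in> {t..T} \<Longrightarrow> dist r s < d \<Longrightarrow> dist (\<phi> r) (\<phi> s) < 1/2"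
    unfolding uniformly_continuous_on_def by (metis half_gt_zero_iff zero_less_one)
  have "(\<integral>\<^sup>+u\<in>{s..r}. ennreal (k u) \<partial>lborel) \<le> 1/2" if s: "s \<in> {t..T}" "r \<in> {t..T}" "s \<le> r" "r < s + d" for s r
  proof -
    have sub: "set_integrable lborel {s..r} k"
      by (rule set_integrable_subset[OF k(1)]) (use s in auto)
    have "(\<integral>\<^sup>+u\<in>{s..r}. ennreal (k u) \<partial>lborel) = (\<integral>\<^sup>+u. ennreal (indicator {s..r} u *\<^sub>R k u) \<partial>lborel)"
      by (intro nn_integral_cong) (auto simp: indicator_def)
    also have "\<dots> = ennreal (LINT u:{s..r}|lborel. k u)"
      unfolding set_lebesgue_integral_def
      by (rule nn_integral_eq_integral) (use sub k(2) in \<open>auto simp: set_integrable_def\<close>)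
    also have "(LINT u:{s..r}|lborel. k u) = integral {s..r} k"
      by (rule set_borel_integral_eq_integral(2)[OF sub])
    also have "integral {s..r} k = \<phi> r - \<phi> s"
      unfolding \<phi>_def
      using Henstock_Kurzweil_Integration.integral_combine[of t s r k] s integrable_on_subinterval[OF int, of t r] by auto
    also have "ennreal (\<phi> r - \<phi> s) \<le> ennreal (1/2)"
      using d(2)[OF s(1,2)] s by (intro ennreal_leI) (auto simp: dist_real_def abs_if split: if_splits)
    also have "ennreal (1/2) = 1/2" by (rule ennreal_half)
    finally show ?thesis .
  qed
  with d(1) show ?thesis by blast
qed

text \<open>
  The kernel is only integrable, so instead of an exponential weight the proof advances in steps of
  a fixed length \<open>d\<close> on which the kernel has mass at most one half. If \<open>f\<close> vanishes before \<open>s\<close>,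
  its supremum over a step starting at \<open>s\<close> is at most half of itself, and it is finite.
\<close>

lemma gronwall_zero:
  fixes f :: "real \<Rightarrow> ennreal" and k :: "real \<Rightarrow> real"
  assumes k: "set_integrable lborel {t..T} k" "\<And>r. 0 \<le> k r"
    and bound: "\<And>s. s \<in> {t..T} \<Longrightarrow> f s \<le> K" "K < \<infinity>"
    and le: "\<And>s. s \<in> {t..T} \<Longrightarrow> f s \<le> (\<integral>\<^sup>+r\<in>{t..s}. ennreal (k r) * f r \<partial>lborel)"
    and s: "s \<in> {t..T}"
  shows "f s = 0"
proof -
  obtain d where d: "0 < d" "\<And>s r. s \<in> {t..T} \<Longrightarrow> r \<in> {t..T} \<Longrightarrow> s \<le> r \<Longrightarrow> r < s + d \<Longrightarrow>
      (\<integral>\<^sup>+u\<in>{s..r}. ennreal (k u) \<partial>lborel) \<le> 1/2"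
    using small_integral_partition[OF k] by blast
  have step: "f r = 0" if zero: "\<And>r. r \<in> {t..<s} \<Longrightarrow> f r = 0" and s: "s \<in> {t..T}"
    and r: "r \<in> {t..T}" "r < s + d" for s r
  proof (cases "r < s")
    case False
    define c where "c = (SUP r\<in>{s..r}. f r)"
    have c_le: "f u \<le> c" if "u \<in> {s..r}" for u
      unfolding c_def by (rule SUP_upper[OF that])
    have cK: "c \<le> K" unfolding c_def by (rule SUP_least) (use bound(1) s r in auto)
    have "f u \<le> c * (1/2)" if u: "u \<in> {s..r}" for u
    proof -
      have uT: "u \<in> {t..T}" using u s r by auto
      have "f u \<le> (\<integral>\<^sup>+v\<in>{t..u}. ennreal (k v) * f v \<partial>lborel)" by (rule le[OF uT])
      also have "\<dots> \<le> (\<integral>\<^sup>+v. c * (ennreal (k v) * indicator {s..u} v) \<partial>lborel)"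
      proof (rule nn_integral_mono)
        fix v
        show "ennreal (k v) * f v * indicator {t..u} v \<le> c * (ennreal (k v) * indicator {s..u} v)"
          using zero[of v] c_le[of v] u
          by (cases "v \<in> {t..u}"; cases "v < s") (auto simp: mult.commute intro!: mult_right_mono)
      qed
      also have "\<dots> = c * (\<integral>\<^sup>+v\<in>{s..u}. ennreal (k v) \<partial>lborel)"
      proof (rule nn_integral_cmult)
        have "(\<lambda>v. ennreal (indicator {s..u} v *\<^sub>R k v)) \<in> borel_measurable lborel"
          using set_integrable_subset[OF k(1), of "{s..u}"] s uT unfolding set_integrable_def by auto
        also have "(\<lambda>v. ennreal (indicator {s..u} v *\<^sub>R k v)) = (\<lambda>v. ennreal (k v) * indicator {s..u} v)"
          by (auto simp: fun_eq_iff indicator_def)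
        finally show "(\<lambda>v. ennreal (k v) * indicator {s..u} v) \<in> borel_measurable lborel" .
      qed
      also have "\<dots> \<le> c * (1/2)"
        using d(2)[OF s uT] u r by (intro mult_left_mono) auto
      finally show ?thesis .
    qed
    then have c2: "c \<le> c * (1/2)" unfolding c_def by (intro SUP_least) auto
    obtain c' where c': "c = ennreal c'" "0 \<le> c'"
      using cK bound(2) by (cases c) auto
    have "ennreal c' \<le> ennreal (c' * (1/2))"
      using c2 c' by (simp only: ennreal_mult ennreal_half)
    then have "c' = 0" using c'(2) by simp
    then show ?thesis using c_le[of r] c' False by simp
  qed (use zero r in auto)
  have all: "\<forall>r\<in>{t..T}. r < t + real n * (d/2) \<longrightarrow> f r = 0" for n
  proof (induction n)
    case (Suc n)
    show ?case
    proof (intro ballI impI)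
      fix r assume r: "r \<in> {t..T}" "r < t + real (Suc n) * (d/2)"
      show "f r = 0"
      proof (cases "t + real n * (d/2) \<le> T")
        case True
        show ?thesis
          by (rule step[of "t + real n * (d/2)"]) (use Suc True r d(1) in \<open>auto simp: field_simps\<close>)
      next
        case False
        then show ?thesis using Suc r by auto
      qed
    qed
  qed auto
  obtain n where "(s - t) / (d/2) < real n" using reals_Archimedean2 by blast
  then have "s < t + real n * (d/2)" using d(1) by (simp add: field_simps)
  then show ?thesis using all[of n] s by blast
qed

section \<open>Brownian filtration and progressively measurable processes\<close>

locale brownian_space = prob_space M
  for M :: "'a measure" +
  fixes W :: "real \<Rightarrow> 'a \<Rightarrow> real"
  assumes brownian_W: "brownian_motion M W"
begin

abbreviation F :: "real \<Rightarrow> 'a measure" where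
  "F \<equiv> augmented_filtration M W"

lemma W_measurable [measurable]: "0 \<le> s \<Longrightarrow> W s \<in> borel_measurable M"
  using brownian_W unfolding brownian_motion_def by auto

lemma space_natural [simp]: "space (natural_filtration M W s) = space M"
  unfolding natural_filtration_def by (rule space_measure_of) auto

lemma sets_natural:
  "sets (natural_filtration M W s) =
     sigma_sets (space M) {W r -` E \<inter> space M | r E. 0 \<le> r \<and> r \<le> s \<and> E \<in> sets borel}"
  unfolding natural_filtration_def by (rule sets_measure_of) auto

lemma sets_natural_le: "sets (natural_filtration M W s) \<subseteq> sets M"
  unfolding sets_natural by (rule sets.sigma_sets_subset) (auto intro: measurable_sets)

lemma sets_natural_space: "sets (natural_filtration M W s) \<subseteq> Pow (space M)"
  using sets_natural_le sets.sets_into_space by blast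

lemma augmentation_generator: "sets (natural_filtration M W s) \<union> null_sets M \<subseteq> Pow (space M)"
proof -
  have "null_sets M \<subseteq> Pow (space M)"
    using sets.sets_into_space by (auto dest!: null_setsD2)
  with sets_natural_space[of s] show ?thesis by simp
qed

lemma space_F [simp]: "space (F s) = space M"
  unfolding augmented_filtration_def by (rule space_measure_of[OF augmentation_generator])

lemma sets_F:
  "sets (F s) = sigma_sets (space M) (sets (natural_filtration M W s) \<union> null_sets M)"
  unfolding augmented_filtration_def by (rule sets_measure_of[OF augmentation_generator])

lemma sets_F_le: "sets (F s) \<subseteq> sets M"
  unfolding sets_F
proof (rule sets.sigma_sets_subset)
  have "null_sets M \<subseteq> sets M" by auto
  with sets_natural_le[of s] show "sets (natural_filtration M W s) \<union> null_sets M \<subseteq> sets M" by simp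
qed

lemma sets_natural_le_F: "sets (natural_filtration M W s) \<subseteq> sets (F s)"
  unfolding sets_F by (auto intro: sigma_sets.Basic)

lemma sets_F_mono: "s \<le> s' \<Longrightarrow> sets (F s) \<subseteq> sets (F s')"
proof -
  assume "s \<le> s'"
  then have "sets (natural_filtration M W s) \<subseteq> sets (natural_filtration M W s')"
    unfolding sets_natural by (intro sigma_sets_mono') force
  then show ?thesis
    unfolding sets_F by (intro sigma_sets_mono') auto
qed

lemma measurable_F_imp: "f \<in> borel_measurable (F s) \<Longrightarrow> f \<in> borel_measurable M"
  using measurable_mono[of borel borel "F s" M] sets_F_le by auto

lemma measurable_F_mono: "f \<in> borel_measurable (F s) \<Longrightarrow> s \<le> s' \<Longrightarrow> f \<in> borel_measurable (F s')"
  using measurable_mono[of borel borel "F s" "F s'"] sets_F_mono[of s s'] by auto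

lemma W_measurable_F: "0 \<le> r \<Longrightarrow> r \<le> s \<Longrightarrow> W r \<in> borel_measurable (F s)"
proof (rule measurableI)
  fix E :: "real set" assume "0 \<le> r" "r \<le> s" "E \<in> sets borel"
  then have "W r -` E \<inter> space M \<in> sets (natural_filtration M W s)"
    unfolding sets_natural by (intro sigma_sets.Basic) auto
  then show "W r -` E \<inter> space (F s) \<in> sets (F s)"
    using sets_natural_le_F[of s] by auto
qed auto

text \<open>
  The restriction of a process to \<open>[t, T]\<close>, extended by zero. The sample point comes first, so that
  Fubini's theorem integrates over time inside and over \<open>\<Omega>\<close> outside, the order used in the
  definitions of the spaces and of the cost.
\<close>

definition windowed :: "real \<Rightarrow> real \<Rightarrow> (real \<Rightarrow> 'a \<Rightarrow> 'b::euclidean_space) \<Rightarrow> 'a \<times> real \<Rightarrow> 'b" where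
  "windowed t T \<phi> = (\<lambda>(\<omega>, s). indicator {t..T} s *\<^sub>R \<phi> s \<omega>)"

lemma windowed_apply: "windowed t T \<phi> (\<omega>, s) = indicator {t..T} s *\<^sub>R \<phi> s \<omega>"
  by (simp add: windowed_def)

text \<open>
  Progressive measurability at the final time gives joint measurability on \<open>[t, T]\<close> only; clamping the
  time argument to this interval turns it into joint measurability on the whole product.
\<close>

lemma prog_measurable_windowed:
  assumes "prog_measurable F t T \<phi>"
  shows "windowed t T \<phi> \<in> borel_measurable (M \<Otimes>\<^sub>M lborel)"
proof (cases "t \<le> T")
  case True
  have f: "(\<lambda>(r, \<omega>). \<phi> r \<omega>) \<in> borel_measurable (restrict_space borel {t..T} \<Otimes>\<^sub>M F T)"
    using assms True by (auto simp: prog_measurable_def)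
  have c: "(\<lambda>s. max t (min T s)) \<in> measurable lborel (restrict_space borel {t..T})"
    using True by (intro measurable_restrict_space2) auto
  have i: "(\<lambda>\<omega>. \<omega>) \<in> measurable M (F T)"
  proof (rule measurableI)
    fix E assume E: "E \<in> sets (F T)"
    with sets_F_le have "E \<in> sets M" by blast
    then show "(\<lambda>\<omega>. \<omega>) -` E \<inter> space M \<in> sets M" by simp
  qed simp
  have p1: "(\<lambda>x. max t (min T (snd x))) \<in> measurable (M \<Otimes>\<^sub>M lborel) (restrict_space borel {t..T})"
    using measurable_compose[where f = snd and N = lborel and M = "M \<Otimes>\<^sub>M lborel", OF measurable_snd c] .
  have p2: "fst \<in> measurable (M \<Otimes>\<^sub>M lborel) (F T)"
    using measurable_compose[where f = fst and N = M and M = "M \<Otimes>\<^sub>M lborel", OF measurable_fst i] .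
  have p: "(\<lambda>x. (max t (min T (snd x)), fst x)) \<in>
      measurable (M \<Otimes>\<^sub>M lborel) (restrict_space borel {t..T} \<Otimes>\<^sub>M F T)"
    using p1 p2 by (rule measurable_Pair)
  have [measurable]: "(\<lambda>x. \<phi> (max t (min T (snd x))) (fst x)) \<in> borel_measurable (M \<Otimes>\<^sub>M lborel)"
    using measurable_compose[OF p f] by simp
  have "(\<lambda>(\<omega>, s). indicator {t..T} s *\<^sub>R \<phi> (max t (min T s)) \<omega>) \<in> borel_measurable (M \<Otimes>\<^sub>M lborel)"
    unfolding split_beta by measurable
  also have "(\<lambda>(\<omega>, s). indicator {t..T} s *\<^sub>R \<phi> (max t (min T s)) \<omega>) = windowed t T \<phi>"
    by (auto simp: windowed_def fun_eq_iff indicator_def min_absorb2 max_absorb2)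
  finally show ?thesis .
next
  case False
  then have "windowed t T \<phi> = (\<lambda>_. 0)" by (auto simp: windowed_def fun_eq_iff)
  then show ?thesis by simp
qed

lemma prog_measurable_section:
  assumes "prog_measurable F t T \<phi>" "s \<in> {t..T}"
  shows "\<phi> s \<in> borel_measurable (F s)"
proof -
  have f: "(\<lambda>(r, \<omega>). \<phi> r \<omega>) \<in> borel_measurable (restrict_space borel {t..s} \<Otimes>\<^sub>M F s)"
    using assms by (auto simp: prog_measurable_def)
  have "(\<lambda>\<omega>. (s, \<omega>)) \<in> measurable (F s) (restrict_space borel {t..s} \<Otimes>\<^sub>M F s)"
    using assms by (intro measurable_Pair measurable_const) (auto simp: space_restrict_space)
  from measurable_compose[OF this f] show ?thesis by simp
qed

lemma prog_measurable_compose2: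
  fixes h :: "'b::euclidean_space \<Rightarrow> 'c::euclidean_space \<Rightarrow> 'd::euclidean_space"
  assumes "prog_measurable F t T \<phi>" "prog_measurable F t T \<psi>"
    and "continuous_on UNIV (\<lambda>p. h (fst p) (snd p))"
  shows "prog_measurable F t T (\<lambda>s \<omega>. h (\<phi> s \<omega>) (\<psi> s \<omega>))"
  unfolding prog_measurable_def
proof
  fix s assume s: "s \<in> {t..T}"
  let ?N = "restrict_space borel {t..s} \<Otimes>\<^sub>M F s"
  have "(\<lambda>p. \<phi> (fst p) (snd p)) \<in> borel_measurable ?N" "(\<lambda>p. \<psi> (fst p) (snd p)) \<in> borel_measurable ?N"
    using assms(1,2) s by (simp_all add: prog_measurable_def case_prod_beta')
  then have "(\<lambda>p. h (\<phi> (fst p) (snd p)) (\<psi> (fst p) (snd p))) \<in> borel_measurable ?N"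
    using assms(3) by (rule borel_measurable_continuous_Pair)
  then show "(\<lambda>(r, \<omega>). h (\<phi> r \<omega>) (\<psi> r \<omega>)) \<in> borel_measurable ?N"
    by (simp add: case_prod_beta')
qed

lemma prog_measurable_lincomb:
  assumes "prog_measurable F t T \<phi>" "prog_measurable F t T \<psi>"
  shows "prog_measurable F t T (\<lambda>s \<omega>. a *\<^sub>R \<phi> s \<omega> + c *\<^sub>R \<psi> s \<omega>)"
  by (rule prog_measurable_compose2[OF assms]) (intro continuous_intros)

lemma prog_measurable_deterministic:
  assumes "set_borel_measurable borel {t..T} f"
  shows "prog_measurable F t T (\<lambda>s \<omega>. f s)"
  unfolding prog_measurable_def
proof
  fix s assume s: "s \<in> {t..T}"
  have "set_borel_measurable borel {t..s} f"
    by (rule set_borel_measurable_subset[OF assms]) (use s in auto)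
  then have "f \<in> borel_measurable (restrict_space borel {t..s})"
    by (simp add: set_borel_measurable_def borel_measurable_restrict_space_iff)
  from measurable_compose[OF measurable_fst this]
  show "(\<lambda>(r, \<omega>). f r) \<in> borel_measurable (restrict_space borel {t..s} \<Otimes>\<^sub>M F s)"
    by (simp add: case_prod_beta')
qed

lemma prog_measurable_matrix_vector:
  fixes \<Theta> :: "real \<Rightarrow> real^'n^'m" and X :: "real \<Rightarrow> 'a \<Rightarrow> real^'n"
  assumes "set_borel_measurable borel {t..T} \<Theta>" "prog_measurable F t T X"
  shows "prog_measurable F t T (\<lambda>s \<omega>. \<Theta> s *v X s \<omega>)"
  by (rule prog_measurable_compose2[OF prog_measurable_deterministic[OF assms(1)] assms(2)])
    (simp add: matrix_vector_mult_def, intro continuous_intros)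

section \<open>Increments of Brownian motion\<close>

text \<open>
  Augmentation changes events by null sets only; this is how independence of the increments is carried
  over from the natural filtration.
\<close>

lemma sets_F_AE_natural:
  assumes "A \<in> sets (F s)"
  shows "\<exists>A'\<in>sets (natural_filtration M W s). AE \<omega> in M. \<omega> \<in> A \<longleftrightarrow> \<omega> \<in> A'"
  using assms unfolding sets_F
proof (induction rule: sigma_sets.induct)
  case (Basic A)
  then show ?case
  proof
    assume "A \<in> null_sets M"
    then have "AE \<omega> in M. \<omega> \<in> A \<longleftrightarrow> \<omega> \<in> {}"
      using AE_not_in by auto
    then show ?thesis by blast
  qed auto
next
  case Empty
  show ?case by (rule bexI[of _ "{}"]) auto
next
  case (Compl A)
  then obtain A' where A': "A' \<in> sets (natural_filtration M W s)" "AE \<omega> in M. \<omega> \<in> A \<longleftrightarrow> \<omega> \<in> A'"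
    by blast
  have "AE \<omega> in M. \<omega> \<in> space M - A \<longleftrightarrow> \<omega> \<in> space M - A'"
    using A'(2) by eventually_elim auto
  moreover have "space M - A' \<in> sets (natural_filtration M W s)"
    using sets.compl_sets[OF A'(1)] by simp
  ultimately show ?case by blast
next
  case (Union A)
  then obtain A' where A': "\<And>i. A' i \<in> sets (natural_filtration M W s)"
    "\<And>i. AE \<omega> in M. \<omega> \<in> A i \<longleftrightarrow> \<omega> \<in> A' i"
    by metis
  have "AE \<omega> in M. \<forall>i. \<omega> \<in> A i \<longleftrightarrow> \<omega> \<in> A' i"
    using A'(2) by (simp add: AE_all_countable)
  then have "AE \<omega> in M. \<omega> \<in> (\<Union>i. A i) \<longleftrightarrow> \<omega> \<in> (\<Union>i. A' i)"
    by eventually_elim auto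
  moreover have "(\<Union>i. A' i) \<in> sets (natural_filtration M W s)"
    using A'(1) by auto
  ultimately show ?case by blast
qed

lemma increment_distributed:
  "0 \<le> s \<Longrightarrow> s < r \<Longrightarrow>
    distributed M lborel (\<lambda>\<omega>. W r \<omega> - W s \<omega>) (normal_density 0 (sqrt (r - s)))"
  using brownian_W by (auto simp: brownian_motion_def)

lemma increment_indep_var:
  fixes \<zeta> :: "'a \<Rightarrow> real"
  assumes s: "0 \<le> s" "s < r" and \<zeta>: "\<zeta> \<in> borel_measurable (F s)"
  shows "indep_var borel \<zeta> borel (\<lambda>\<omega>. W r \<omega> - W s \<omega>)"
proof -
  let ?D = "\<lambda>\<omega>. W r \<omega> - W s \<omega>"
  let ?V = "{?D -` E \<inter> space M | E. E \<in> sets borel}"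
  have [measurable]: "?D \<in> borel_measurable M"
    using s by (intro borel_measurable_diff W_measurable) auto
  have ind: "indep_set (sets (natural_filtration M W s)) ?V"
    using brownian_W s by (auto simp: brownian_motion_def)
  have ind': "indep_set (sets (F s)) ?V"
  proof (rule indep_setI)
    show "sets (F s) \<subseteq> events" by (rule sets_F_le)
    show "?V \<subseteq> events" by (auto intro: measurable_sets)
    fix A B assume A: "A \<in> sets (F s)" and B: "B \<in> ?V"
    from sets_F_AE_natural[OF A] obtain A' where
      A': "A' \<in> sets (natural_filtration M W s)" "AE \<omega> in M. \<omega> \<in> A \<longleftrightarrow> \<omega> \<in> A'" by blast
    have AM: "A \<in> sets M" "A' \<in> sets M" "B \<in> sets M"
      using A A' sets_F_le sets_natural_le B by (auto intro: measurable_sets)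
    have "prob (A \<inter> B) = prob (A' \<inter> B)"
      using A'(2) AM by (intro finite_measure_eq_AE) auto
    also have "\<dots> = prob A' * prob B" by (rule indep_setD[OF ind A'(1) B])
    also have "prob A' = prob A"
      using A'(2) AM by (intro finite_measure_eq_AE) auto
    finally show "prob (A \<inter> B) = prob A * prob B" .
  qed
  have "Int_stable ?V"
  proof (rule Int_stableI)
    fix a c assume "a \<in> ?V" "c \<in> ?V"
    then obtain E E' where E: "a = ?D -` E \<inter> space M" "c = ?D -` E' \<inter> space M"
      "E \<in> sets borel" "E' \<in> sets borel" by blast
    then have "a \<inter> c = ?D -` (E \<inter> E') \<inter> space M" "E \<inter> E' \<in> sets borel" by auto
    then show "a \<inter> c \<in> ?V" by blast
  qed
  then have ind'': "indep_set (sigma_sets (space M) (sets (F s))) (sigma_sets (space M) ?V)"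
    by (intro indep_set_sigma_sets ind' sets.Int_stable)
  have sub: "sigma_sets (space M) {\<zeta> -` E \<inter> space M | E. E \<in> sets borel} \<subseteq> sigma_sets (space M) (sets (F s))"
    using measurable_sets[OF \<zeta>] by (intro sigma_sets_mono') auto
  have "indep_set (sigma_sets (space M) {\<zeta> -` E \<inter> space M | E. E \<in> sets borel}) (sigma_sets (space M) ?V)"
    using ind'' sub unfolding indep_sets2_eq by blast
  then show ?thesis
    using measurable_F_imp[OF \<zeta>] unfolding indep_var_eq by simp
qed

lemma
  assumes s: "0 \<le> s" "s \<le> r"
  shows increment_integrable: "integrable M (\<lambda>\<omega>. W r \<omega> - W s \<omega>)"
    and increment_expectation: "expectation (\<lambda>\<omega>. W r \<omega> - W s \<omega>) = 0"
    and increment_square_integrable: "integrable M (\<lambda>\<omega>. (W r \<omega> - W s \<omega>)\<^sup>2)"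
    and increment_variance: "expectation (\<lambda>\<omega>. (W r \<omega> - W s \<omega>)\<^sup>2) = r - s"
proof -
  consider "s = r" | "s < r" using s by linarith
  then have "integrable M (\<lambda>\<omega>. W r \<omega> - W s \<omega>) \<and> expectation (\<lambda>\<omega>. W r \<omega> - W s \<omega>) = 0 \<and>
     integrable M (\<lambda>\<omega>. (W r \<omega> - W s \<omega>)\<^sup>2) \<and> expectation (\<lambda>\<omega>. (W r \<omega> - W s \<omega>)\<^sup>2) = r - s"
  proof cases
    case 2
    let ?D = "\<lambda>\<omega>. W r \<omega> - W s \<omega>"
    have d: "distributed M lborel ?D (\<lambda>x. ennreal (normal_density 0 (sqrt (r - s)) x))"
      using increment_distributed[OF s(1) 2] .
    have pos: "0 < sqrt (r - s)" using 2 by simp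
    have i1: "integrable M ?D"
      by (rule distributed_integrable_var[OF d]) (use integrable_normal_moment_nz_1[OF pos] in auto)
    have e1: "expectation ?D = 0"
      by (rule normal_distributed_expectation[OF pos d])
    have i2: "integrable M (\<lambda>\<omega>. (?D \<omega>)\<^sup>2)"
      using distributed_integrable[OF d, of "\<lambda>x. x\<^sup>2"] integrable_normal_moment[OF pos, of 0 2] by simp
    have "variance ?D = (sqrt (r - s))\<^sup>2"
      by (rule normal_distributed_variance[OF pos d])
    with i1 e1 i2 show ?thesis using 2 by simp
  qed auto
  then show "integrable M (\<lambda>\<omega>. W r \<omega> - W s \<omega>)" "expectation (\<lambda>\<omega>. W r \<omega> - W s \<omega>) = 0"
     "integrable M (\<lambda>\<omega>. (W r \<omega> - W s \<omega>)\<^sup>2)" "expectation (\<lambda>\<omega>. (W r \<omega> - W s \<omega>)\<^sup>2) = r - s"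
    by auto
qed

lemma
  fixes \<zeta> :: "'a \<Rightarrow> real"
  assumes s: "0 \<le> s" "s \<le> r" and \<zeta>: "\<zeta> \<in> borel_measurable (F s)" "integrable M \<zeta>"
  shows mult_increment_integrable: "integrable M (\<lambda>\<omega>. \<zeta> \<omega> * (W r \<omega> - W s \<omega>))"
    and mult_increment_expectation: "expectation (\<lambda>\<omega>. \<zeta> \<omega> * (W r \<omega> - W s \<omega>)) = 0"
    and mult_square_increment_integrable: "integrable M (\<lambda>\<omega>. \<zeta> \<omega> * (W r \<omega> - W s \<omega>)\<^sup>2)"
    and mult_square_increment_expectation:
      "expectation (\<lambda>\<omega>. \<zeta> \<omega> * (W r \<omega> - W s \<omega>)\<^sup>2) = (r - s) * expectation \<zeta>"
proof -
  consider "s = r" | "s < r" using s by linarith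
  then have "integrable M (\<lambda>\<omega>. \<zeta> \<omega> * (W r \<omega> - W s \<omega>)) \<and>
    expectation (\<lambda>\<omega>. \<zeta> \<omega> * (W r \<omega> - W s \<omega>)) = 0 \<and>
    integrable M (\<lambda>\<omega>. \<zeta> \<omega> * (W r \<omega> - W s \<omega>)\<^sup>2) \<and>
    expectation (\<lambda>\<omega>. \<zeta> \<omega> * (W r \<omega> - W s \<omega>)\<^sup>2) = (r - s) * expectation \<zeta>"
  proof cases
    case 2
    note iv = increment_indep_var[OF s(1) 2 \<zeta>(1)]
    have iv2: "indep_var borel \<zeta> borel (\<lambda>\<omega>. (W r \<omega> - W s \<omega>)\<^sup>2)"
      using indep_var_compose[OF iv, of "\<lambda>x. x" borel "\<lambda>x. x\<^sup>2" borel] by (simp add: comp_def)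
    show ?thesis
      using indep_var_integrable[OF iv \<zeta>(2) increment_integrable[OF s]]
        indep_var_lebesgue_integral[OF iv \<zeta>(2) increment_integrable[OF s]]
        indep_var_integrable[OF iv2 \<zeta>(2) increment_square_integrable[OF s]]
        indep_var_lebesgue_integral[OF iv2 \<zeta>(2) increment_square_integrable[OF s]]
        increment_expectation[OF s] increment_variance[OF s] by simp
  qed auto
  then show "integrable M (\<lambda>\<omega>. \<zeta> \<omega> * (W r \<omega> - W s \<omega>))"
    "expectation (\<lambda>\<omega>. \<zeta> \<omega> * (W r \<omega> - W s \<omega>)) = 0"
    "integrable M (\<lambda>\<omega>. \<zeta> \<omega> * (W r \<omega> - W s \<omega>)\<^sup>2)"
    "expectation (\<lambda>\<omega>. \<zeta> \<omega> * (W r \<omega> - W s \<omega>)\<^sup>2) = (r - s) * expectation \<zeta>"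
    by auto
qed

lemma bounded_mult_two_increments_integrable:
  fixes \<eta> :: "'a \<Rightarrow> real"
  assumes "0 \<le> a" "a \<le> b" "0 \<le> a'" "a' \<le> b'"
    and [measurable]: "\<eta> \<in> borel_measurable M" and K: "\<And>\<omega>. \<omega> \<in> space M \<Longrightarrow> \<bar>\<eta> \<omega>\<bar> \<le> K"
  shows "integrable M (\<lambda>\<omega>. \<eta> \<omega> * (W b \<omega> - W a \<omega>) * (W b' \<omega> - W a' \<omega>))"
proof (rule Bochner_Integration.integrable_bound)
  show "integrable M (\<lambda>\<omega>. K * ((W b \<omega> - W a \<omega>)\<^sup>2 + (W b' \<omega> - W a' \<omega>)\<^sup>2))"
    using increment_square_integrable assms by simp
  have [measurable]: "W a \<in> borel_measurable M" "W b \<in> borel_measurable M"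
      "W a' \<in> borel_measurable M" "W b' \<in> borel_measurable M"
    using assms by auto
  show "(\<lambda>\<omega>. \<eta> \<omega> * (W b \<omega> - W a \<omega>) * (W b' \<omega> - W a' \<omega>)) \<in> borel_measurable M"
    by measurable
  show "AE \<omega> in M. norm (\<eta> \<omega> * (W b \<omega> - W a \<omega>) * (W b' \<omega> - W a' \<omega>))
      \<le> norm (K * ((W b \<omega> - W a \<omega>)\<^sup>2 + (W b' \<omega> - W a' \<omega>)\<^sup>2))"
  proof (rule AE_I2)
    fix \<omega> assume "\<omega> \<in> space M"
    define x y where "x = W b \<omega> - W a \<omega>" and "y = W b' \<omega> - W a' \<omega>"
    have k: "\<bar>\<eta> \<omega>\<bar> \<le> K" by (rule K) fact
    then have "0 \<le> K" by linarith
    have "2 * (\<bar>x\<bar> * \<bar>y\<bar>) \<le> x\<^sup>2 + y\<^sup>2"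
      using sum_squares_bound[of "\<bar>x\<bar>" "\<bar>y\<bar>"] by simp
    then have "\<bar>x\<bar> * \<bar>y\<bar> \<le> x\<^sup>2 + y\<^sup>2" using mult_nonneg_nonneg[of "\<bar>x\<bar>" "\<bar>y\<bar>"] by linarith
    then have "\<bar>\<eta> \<omega>\<bar> * (\<bar>x\<bar> * \<bar>y\<bar>) \<le> K * (x\<^sup>2 + y\<^sup>2)"
      using k \<open>0 \<le> K\<close> by (intro mult_mono) auto
    then show "norm (\<eta> \<omega> * (W b \<omega> - W a \<omega>) * (W b' \<omega> - W a' \<omega>))
      \<le> norm (K * ((W b \<omega> - W a \<omega>)\<^sup>2 + (W b' \<omega> - W a' \<omega>)\<^sup>2))"
      using \<open>0 \<le> K\<close> unfolding x_def y_def by (simp add: abs_mult mult.assoc)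
  qed
qed

text \<open>
  The longer increment is the shorter one plus a later increment, which is centred given the past.
\<close>

lemma nested_increments_expectation:
  fixes \<eta> :: "'a \<Rightarrow> real"
  assumes a: "0 \<le> a" "a \<le> b" "b \<le> b'"
    and \<eta>: "\<eta> \<in> borel_measurable (F a)" and K: "\<And>\<omega>. \<omega> \<in> space M \<Longrightarrow> \<bar>\<eta> \<omega>\<bar> \<le> K"
  shows "expectation (\<lambda>\<omega>. \<eta> \<omega> * (W b \<omega> - W a \<omega>) * (W b' \<omega> - W a \<omega>)) = (b - a) * expectation \<eta>"
proof -
  have \<eta>M: "\<eta> \<in> borel_measurable M" by (rule measurable_F_imp[OF \<eta>])
  have i: "integrable M \<eta>" by (rule integrable_const_bound[of _ K]) (use \<eta>M K in auto)
  let ?z = "\<lambda>\<omega>. \<eta> \<omega> * (W b \<omega> - W a \<omega>)"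
  have [measurable]: "\<eta> \<in> borel_measurable (F b)" "W a \<in> borel_measurable (F b)" "W b \<in> borel_measurable (F b)"
    using measurable_F_mono[OF \<eta>, of b] W_measurable_F a by auto
  have z: "?z \<in> borel_measurable (F b)" by measurable
  have iz: "integrable M ?z" by (rule mult_increment_integrable[OF a(1,2) \<eta> i])
  have "(\<lambda>\<omega>. \<eta> \<omega> * (W b \<omega> - W a \<omega>) * (W b' \<omega> - W a \<omega>)) =
      (\<lambda>\<omega>. \<eta> \<omega> * (W b \<omega> - W a \<omega>)\<^sup>2 + ?z \<omega> * (W b' \<omega> - W b \<omega>))"
    by (simp add: fun_eq_iff power2_eq_square algebra_simps)
  then show ?thesis
    using mult_square_increment_integrable[OF a(1,2) \<eta> i] mult_square_increment_expectation[OF a(1,2) \<eta> i]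
      mult_increment_integrable[OF _ a(3) z iz] mult_increment_expectation[OF _ a(3) z iz] a
    by simp
qed

text \<open>
  Cut both intervals at the later left end point \<open>a'\<close>. The part of the first interval before \<open>a'\<close> is
  past for the second increment and does not contribute; the rest is a pair of nested increments.
\<close>

lemma ordered_increments_expectation:
  fixes \<eta> :: "'a \<Rightarrow> real"
  assumes a: "0 \<le> a" "a \<le> b" "a' \<le> b'" "a \<le> a'"
    and \<eta>: "\<eta> \<in> borel_measurable (F a')" and K: "\<And>\<omega>. \<omega> \<in> space M \<Longrightarrow> \<bar>\<eta> \<omega>\<bar> \<le> K"
  shows "expectation (\<lambda>\<omega>. \<eta> \<omega> * (W b \<omega> - W a \<omega>) * (W b' \<omega> - W a' \<omega>)) =
    measure lborel ({a<..b} \<inter> {a'<..b'}) * expectation \<eta>"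
proof -
  have past: "expectation (\<lambda>\<omega>. \<eta> \<omega> * (W c \<omega> - W a \<omega>) * (W b' \<omega> - W a' \<omega>)) = 0"
    if c: "a \<le> c" "c \<le> a'" for c
  proof (rule mult_increment_expectation)
    have [measurable]: "\<eta> \<in> borel_measurable (F a')" "W a \<in> borel_measurable (F a')" "W c \<in> borel_measurable (F a')"
      using \<eta> W_measurable_F a c by auto
    show "(\<lambda>\<omega>. \<eta> \<omega> * (W c \<omega> - W a \<omega>)) \<in> borel_measurable (F a')" by measurable
    show "integrable M (\<lambda>\<omega>. \<eta> \<omega> * (W c \<omega> - W a \<omega>))"
      by (rule Bochner_Integration.integrable_bound[of _ "\<lambda>\<omega>. K * (W c \<omega> - W a \<omega>)"])
        (use increment_integrable[of a c] a c K measurable_F_imp[OF \<eta>] in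
          \<open>auto simp: abs_mult intro!: mult_right_mono order_trans[OF K abs_ge_self]\<close>)
  qed (use a c in auto)
  show ?thesis
  proof (cases "b \<le> a'")
    case True
    then have "{a<..b} \<inter> {a'<..b'} = {}" by auto
    then show ?thesis using past[of b] a True by simp
  next
    case False
    have [simp]: "{a<..b} \<inter> {a'<..b'} = {a'<..min b b'}" using a by auto
    have \<eta>M: "\<eta> \<in> borel_measurable M" by (rule measurable_F_imp[OF \<eta>])
    have "expectation (\<lambda>\<omega>. \<eta> \<omega> * (W b \<omega> - W a \<omega>) * (W b' \<omega> - W a' \<omega>)) =
       expectation (\<lambda>\<omega>. \<eta> \<omega> * (W a' \<omega> - W a \<omega>) * (W b' \<omega> - W a' \<omega>) +
          \<eta> \<omega> * (W b \<omega> - W a' \<omega>) * (W b' \<omega> - W a' \<omega>))"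
      by (simp add: algebra_simps)
    also have "\<dots> = expectation (\<lambda>\<omega>. \<eta> \<omega> * (W a' \<omega> - W a \<omega>) * (W b' \<omega> - W a' \<omega>)) +
          expectation (\<lambda>\<omega>. \<eta> \<omega> * (W b \<omega> - W a' \<omega>) * (W b' \<omega> - W a' \<omega>))"
      by (intro Bochner_Integration.integral_add bounded_mult_two_increments_integrable[OF _ _ _ _ \<eta>M K])
         (use a False in auto)
    also have "expectation (\<lambda>\<omega>. \<eta> \<omega> * (W b \<omega> - W a' \<omega>) * (W b' \<omega> - W a' \<omega>)) =
       (min b b' - a') * expectation \<eta>"
    proof (cases "b \<le> b'")
      case True
      then show ?thesis
        using nested_increments_expectation[OF _ _ True \<eta> K] a False by simp
    next
      case False
      then show ?thesis
        using nested_increments_expectation[OF _ a(3) _ \<eta> K, of b] a by (simp add: ac_simps)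
    qed
    finally show ?thesis using past[of a'] a False by simp
  qed
qed

lemma increments_expectation:
  fixes \<xi> \<xi>' :: "'a \<Rightarrow> 'b::euclidean_space"
  assumes a: "0 \<le> a" "a \<le> b" "0 \<le> a'" "a' \<le> b'"
    and \<xi>: "\<xi> \<in> borel_measurable (F a)" "\<And>\<omega>. \<omega> \<in> space M \<Longrightarrow> norm (\<xi> \<omega>) \<le> K"
    and \<xi>': "\<xi>' \<in> borel_measurable (F a')" "\<And>\<omega>. \<omega> \<in> space M \<Longrightarrow> norm (\<xi>' \<omega>) \<le> K'"
  shows "integrable M (\<lambda>\<omega>. (\<xi> \<omega> \<bullet> \<xi>' \<omega>) * (W b \<omega> - W a \<omega>) * (W b' \<omega> - W a' \<omega>))"
    and "expectation (\<lambda>\<omega>. (\<xi> \<omega> \<bullet> \<xi>' \<omega>) * (W b \<omega> - W a \<omega>) * (W b' \<omega> - W a' \<omega>)) =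
      measure lborel ({a<..b} \<inter> {a'<..b'}) * expectation (\<lambda>\<omega>. \<xi> \<omega> \<bullet> \<xi>' \<omega>)"
    and "integrable M (\<lambda>\<omega>. \<xi> \<omega> \<bullet> \<xi>' \<omega>)"
proof -
  have [measurable]: "\<xi> \<in> borel_measurable M" "\<xi>' \<in> borel_measurable M"
    using measurable_F_imp \<xi>(1) \<xi>'(1) by auto
  have K: "\<bar>\<xi> \<omega> \<bullet> \<xi>' \<omega>\<bar> \<le> K * K'" if "\<omega> \<in> space M" for \<omega>
    using Cauchy_Schwarz_ineq2[of "\<xi> \<omega>" "\<xi>' \<omega>"] mult_mono[OF \<xi>(2)[OF that] \<xi>'(2)[OF that]]
      order_trans[OF norm_ge_zero \<xi>(2)[OF that]] by simp
  show "integrable M (\<lambda>\<omega>. (\<xi> \<omega> \<bullet> \<xi>' \<omega>) * (W b \<omega> - W a \<omega>) * (W b' \<omega> - W a' \<omega>))"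
    by (rule bounded_mult_two_increments_integrable[OF a _ K]) measurable
  show "integrable M (\<lambda>\<omega>. \<xi> \<omega> \<bullet> \<xi>' \<omega>)"
    by (rule integrable_const_bound[of _ "K * K'"]) (use K in auto)
  let ?\<eta> = "\<lambda>\<omega>. \<xi> \<omega> \<bullet> \<xi>' \<omega>"
  show "expectation (\<lambda>\<omega>. (\<xi> \<omega> \<bullet> \<xi>' \<omega>) * (W b \<omega> - W a \<omega>) * (W b' \<omega> - W a' \<omega>)) =
      measure lborel ({a<..b} \<inter> {a'<..b'}) * expectation (\<lambda>\<omega>. \<xi> \<omega> \<bullet> \<xi>' \<omega>)"
  proof (cases "a \<le> a'")
    case True
    have "?\<eta> \<in> borel_measurable (F a')"
      using measurable_F_mono[OF \<xi>(1) True] \<xi>'(1) by measurable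
    from ordered_increments_expectation[OF a(1,2,4) True this K] show ?thesis .
  next
    case False
    then have le: "a' \<le> a" by simp
    have "?\<eta> \<in> borel_measurable (F a)"
      using measurable_F_mono[OF \<xi>'(1) le] \<xi>(1) by measurable
    from ordered_increments_expectation[OF a(3,4,2) le this K] show ?thesis
      by (simp add: ac_simps Int_commute)
  qed
qed

section \<open>The Ito isometry\<close>

text \<open>
  The intervals of a simple integrand may overlap, so the square of the sum is expanded into all pairs;
  each pair contributes on both sides the length of its overlap times the mean inner product.
\<close>

lemma simple_isometry:
  fixes P :: "('a, 'b::euclidean_space) simple_integrand"
  assumes "0 \<le> t" and P: "is_simple_integrand M F t s P"
  shows "(\<integral>\<^sup>+\<omega>. ennreal ((norm (simple_integral W P \<omega>))\<^sup>2) \<partial>M) =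
    (\<integral>\<^sup>+\<omega>. (\<integral>\<^sup>+r\<in>{t..s}. ennreal ((norm (simple_process P r \<omega>))\<^sup>2) \<partial>lborel) \<partial>M)"
proof -
  define n where "n = length P"
  define a where "a i = fst (P ! i)" for i
  define b where "b i = fst (snd (P ! i))" for i
  define \<xi> where "\<xi> i = snd (snd (P ! i))" for i
  define c where "c i j = measure lborel ({a i<..b i} \<inter> {a j<..b j})" for i j
  have "\<exists>K. \<forall>\<omega>\<in>space M. norm (\<xi> i \<omega>) \<le> K" if "i < n" for i
    using P that nth_mem[of i P] by (force simp: is_simple_integrand_def n_def \<xi>_def split_beta)
  then obtain K where K: "\<And>i \<omega>. i < n \<Longrightarrow> \<omega> \<in> space M \<Longrightarrow> norm (\<xi> i \<omega>) \<le> K i"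
    by metis
  have ab: "t \<le> a i \<and> a i \<le> b i \<and> b i \<le> s \<and> \<xi> i \<in> borel_measurable (F (a i))" if "i < n" for i
    using P that nth_mem[of i P]
    by (force simp: is_simple_integrand_def n_def \<xi>_def a_def b_def split_beta)
  have a0: "0 \<le> a i" "a i \<le> b i" if "i < n" for i using ab[OF that] assms by auto
  have int: "simple_integral W P \<omega> = (\<Sum>i<n. (W (b i) \<omega> - W (a i) \<omega>) *\<^sub>R \<xi> i \<omega>)" for \<omega>
    by (simp add: simple_integral_def sum_list_sum_nth n_def a_def b_def \<xi>_def split_beta lessThan_atLeast0)
  have proc: "simple_process P r \<omega> = (\<Sum>i<n. indicator {a i<..b i} r *\<^sub>R \<xi> i \<omega>)" for r \<omega>
    by (simp add: simple_process_def sum_list_sum_nth n_def a_def b_def \<xi>_def split_beta lessThan_atLeast0)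
  note E = increments_expectation[OF a0 a0 conjunct2[OF conjunct2[OF conjunct2[OF ab]]] K
     conjunct2[OF conjunct2[OF conjunct2[OF ab]]] K]
  have E2: "expectation (\<lambda>\<omega>. (\<xi> i \<omega> \<bullet> \<xi> j \<omega>) * (W (b i) \<omega> - W (a i) \<omega>) * (W (b j) \<omega> - W (a j) \<omega>)) =
      c i j * expectation (\<lambda>\<omega>. \<xi> i \<omega> \<bullet> \<xi> j \<omega>)" if "i < n" "j < n" for i j
    unfolding c_def by (rule E(2)) (use that in auto)
  let ?S = "\<lambda>\<omega>. \<Sum>i<n. \<Sum>j<n. c i j * (\<xi> i \<omega> \<bullet> \<xi> j \<omega>)"
  have sq_int: "(norm (simple_integral W P \<omega>))\<^sup>2 =
      (\<Sum>i<n. \<Sum>j<n. (\<xi> i \<omega> \<bullet> \<xi> j \<omega>) * (W (b i) \<omega> - W (a i) \<omega>) * (W (b j) \<omega> - W (a j) \<omega>))" for \<omega>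
    unfolding int power2_norm_eq_inner inner_sum_left inner_sum_right
    by (auto intro!: sum.cong simp: inner_commute)
  have i1: "integrable M (\<lambda>\<omega>. (norm (simple_integral W P \<omega>))\<^sup>2)"
    unfolding sq_int by (intro Bochner_Integration.integrable_sum E(1)) auto
  have e1: "expectation (\<lambda>\<omega>. (norm (simple_integral W P \<omega>))\<^sup>2) =
      (\<Sum>i<n. \<Sum>j<n. c i j * expectation (\<lambda>\<omega>. \<xi> i \<omega> \<bullet> \<xi> j \<omega>))"
    unfolding sq_int
    by (subst Bochner_Integration.integral_sum, (intro Bochner_Integration.integrable_sum E(1); simp),
        rule sum.cong, simp, subst Bochner_Integration.integral_sum)
       (auto intro!: E(1) sum.cong E2)
  have i2: "integrable M ?S"
    by (intro Bochner_Integration.integrable_sum integrable_mult_right E(3)) auto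
  have e2: "expectation ?S = (\<Sum>i<n. \<Sum>j<n. c i j * expectation (\<lambda>\<omega>. \<xi> i \<omega> \<bullet> \<xi> j \<omega>))"
    by (subst Bochner_Integration.integral_sum, (intro Bochner_Integration.integrable_sum integrable_mult_right E(3); simp),
        rule sum.cong, simp, subst Bochner_Integration.integral_sum)
       (auto intro!: E(3) integrable_mult_right)
  have inner: "(\<integral>\<^sup>+r\<in>{t..s}. ennreal ((norm (simple_process P r \<omega>))\<^sup>2) \<partial>lborel) = ennreal (?S \<omega>) \<and> 0 \<le> ?S \<omega>" for \<omega>
  proof -
    have sq: "(norm (simple_process P r \<omega>))\<^sup>2 =
        (\<Sum>i<n. \<Sum>j<n. (\<xi> i \<omega> \<bullet> \<xi> j \<omega>) * indicator ({a i<..b i} \<inter> {a j<..b j}) r)" for r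
      unfolding proc power2_norm_eq_inner inner_sum_left inner_sum_right
      by (auto intro!: sum.cong simp: inner_commute indicator_inter_arith)
    have fin: "emeasure lborel ({a i<..b i} \<inter> {a j<..b j}) < \<infinity>" for i j
      by (rule order.strict_trans1[OF emeasure_mono[of _ "{a i<..b i}"]]) (auto, cases "a i \<le> b i", auto)
    have ii: "integrable lborel (\<lambda>r. (\<xi> i \<omega> \<bullet> \<xi> j \<omega>) * indicator ({a i<..b i} \<inter> {a j<..b j}) r)" for i j
      using fin by (intro integrable_mult_right integrable_real_indicator) auto
    have i3: "integrable lborel (\<lambda>r. (norm (simple_process P r \<omega>))\<^sup>2)"
      unfolding sq by (intro Bochner_Integration.integrable_sum ii)
    have e3: "(LINT r|lborel. (norm (simple_process P r \<omega>))\<^sup>2) = ?S \<omega>"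
    proof -
      have "(LINT r|lborel. (norm (simple_process P r \<omega>))\<^sup>2) = (\<Sum>i<n. \<Sum>j<n.
          LINT r|lborel. (\<xi> i \<omega> \<bullet> \<xi> j \<omega>) * indicator ({a i<..b i} \<inter> {a j<..b j}) r)"
        unfolding sq using ii by (simp only: Bochner_Integration.integral_sum Bochner_Integration.integrable_sum)
      also have "\<dots> = ?S \<omega>"
        by (intro sum.cong refl) (simp only: integral_mult_right_zero integral_indicator c_def, simp add: mult.commute)
      finally show ?thesis .
    qed
    have out: "simple_process P r \<omega> = 0" if "r \<notin> {t..s}" for r
      unfolding proc by (rule sum.neutral) (use ab that in \<open>force simp: indicator_def\<close>)
    have "(\<integral>\<^sup>+r\<in>{t..s}. ennreal ((norm (simple_process P r \<omega>))\<^sup>2) \<partial>lborel) =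
        (\<integral>\<^sup>+r. ennreal ((norm (simple_process P r \<omega>))\<^sup>2) \<partial>lborel)"
      by (rule nn_integral_cong) (use out in \<open>auto simp: indicator_def\<close>)
    also have "\<dots> = ennreal (?S \<omega>)"
      using nn_integral_eq_integral[OF i3] e3 by simp
    finally show ?thesis using e3 Bochner_Integration.integral_nonneg[of lborel "\<lambda>r. (norm (simple_process P r \<omega>))\<^sup>2"]
      by simp
  qed
  have "(\<integral>\<^sup>+\<omega>. ennreal ((norm (simple_integral W P \<omega>))\<^sup>2) \<partial>M) = ennreal (expectation ?S)"
    using nn_integral_eq_integral[OF i1] e1 e2 by simp
  also have "\<dots> = (\<integral>\<^sup>+\<omega>. ennreal (?S \<omega>) \<partial>M)"
    using nn_integral_eq_integral[OF i2] inner by simp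
  also have "\<dots> = (\<integral>\<^sup>+\<omega>. (\<integral>\<^sup>+r\<in>{t..s}. ennreal ((norm (simple_process P r \<omega>))\<^sup>2) \<partial>lborel) \<partial>M)"
    using inner by simp
  finally show ?thesis .
qed

section \<open>Square integrable processes\<close>

sublocale product: pair_sigma_finite M lborel ..

text \<open>
  The squared norm of \<open>L\<^sup>2(\<Omega> \<times> [t, s])\<close>.
\<close>

definition energy :: "real \<Rightarrow> real \<Rightarrow> (real \<Rightarrow> 'a \<Rightarrow> 'b::euclidean_space) \<Rightarrow> ennreal" where
  "energy t s \<phi> = (\<integral>\<^sup>+\<omega>. (\<integral>\<^sup>+r\<in>{t..s}. ennreal ((norm (\<phi> r \<omega>))\<^sup>2) \<partial>lborel) \<partial>M)"

lemma energy_windowed: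
  assumes [measurable]: "windowed t s \<phi> \<in> borel_measurable (M \<Otimes>\<^sub>M lborel)"
  shows "energy t s \<phi> = (\<integral>\<^sup>+x. ennreal ((norm (windowed t s \<phi> x))\<^sup>2) \<partial>(M \<Otimes>\<^sub>M lborel))"
proof -
  have "energy t s \<phi> = (\<integral>\<^sup>+\<omega>. (\<integral>\<^sup>+r. ennreal ((norm (windowed t s \<phi> (\<omega>, r)))\<^sup>2) \<partial>lborel) \<partial>M)"
    unfolding energy_def by (intro nn_integral_cong) (auto simp: windowed_def indicator_def)
  also have "\<dots> = (\<integral>\<^sup>+x. ennreal ((norm (windowed t s \<phi> x))\<^sup>2) \<partial>(M \<Otimes>\<^sub>M lborel))"
    by (rule lborel.nn_integral_fst) measurable
  finally show ?thesis .
qed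

lemma windowed_lincomb:
  "windowed t s (\<lambda>r \<omega>. a *\<^sub>R \<phi> r \<omega> + c *\<^sub>R \<psi> r \<omega>) = (\<lambda>x. a *\<^sub>R windowed t s \<phi> x + c *\<^sub>R windowed t s \<psi> x)"
  by (auto simp: windowed_def fun_eq_iff scaleR_add_right mult.commute)

lemma energy_lincomb_le:
  assumes [measurable]: "windowed t s \<phi> \<in> borel_measurable (M \<Otimes>\<^sub>M lborel)"
    "windowed t s \<psi> \<in> borel_measurable (M \<Otimes>\<^sub>M lborel)"
  shows "energy t s (\<lambda>r \<omega>. a *\<^sub>R \<phi> r \<omega> + c *\<^sub>R \<psi> r \<omega>) \<le>
    ennreal (2 * a\<^sup>2) * energy t s \<phi> + ennreal (2 * c\<^sup>2) * energy t s \<psi>"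
proof -
  have "windowed t s (\<lambda>r \<omega>. a *\<^sub>R \<phi> r \<omega> + c *\<^sub>R \<psi> r \<omega>) \<in> borel_measurable (M \<Otimes>\<^sub>M lborel)"
    unfolding windowed_lincomb by measurable
  then show ?thesis
    using nn_integral_norm_square_lincomb_le[OF assms, of a c]
    by (simp add: energy_windowed assms windowed_lincomb)
qed

lemma L2_prog_iff: "\<phi> \<in> L2_prog M F t s \<longleftrightarrow> prog_measurable F t s \<phi> \<and> energy t s \<phi> < \<infinity>"
  by (simp add: L2_prog_def energy_def)

lemma L2_prog_lincomb:
  assumes "\<phi> \<in> L2_prog M F t s" "\<psi> \<in> L2_prog M F t s"
  shows "(\<lambda>r \<omega>. a *\<^sub>R \<phi> r \<omega> + c *\<^sub>R \<psi> r \<omega>) \<in> L2_prog M F t s"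
proof -
  have "energy t s (\<lambda>r \<omega>. a *\<^sub>R \<phi> r \<omega> + c *\<^sub>R \<psi> r \<omega>) \<le>
      ennreal (2 * a\<^sup>2) * energy t s \<phi> + ennreal (2 * c\<^sup>2) * energy t s \<psi>"
    using assms by (intro energy_lincomb_le prog_measurable_windowed) (auto simp: L2_prog_iff)
  also have "\<dots> < \<infinity>"
    using assms by (simp add: L2_prog_iff ennreal_mult_less_top)
  finally show ?thesis
    using assms prog_measurable_lincomb by (auto simp: L2_prog_iff)
qed

section \<open>Linearity and continuity of the Ito integral\<close>

lemma windowed_simple_process_measurable:
  assumes "is_simple_integrand M F t s P"
  shows "windowed t s (simple_process P) \<in> borel_measurable (M \<Otimes>\<^sub>M lborel)"
proof -
  have [measurable]: "snd (snd p) \<in> borel_measurable M" if "p \<in> set P" for p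
    using assms that measurable_F_imp[of "snd (snd p)" "fst p"] by (auto simp: is_simple_integrand_def split_beta)
  have "simple_process P r \<omega> = (\<Sum>i<length P. indicator {fst (P!i)<..fst (snd (P!i))} r *\<^sub>R snd (snd (P!i)) \<omega>)" for r \<omega>
    by (simp add: simple_process_def sum_list_sum_nth split_beta lessThan_atLeast0)
  moreover have "(\<lambda>x. indicator {t..s} (snd x) *\<^sub>R (\<Sum>i<length P.
      indicator {fst (P!i)<..fst (snd (P!i))} (snd x) *\<^sub>R snd (snd (P!i)) (fst x)))
      \<in> borel_measurable (M \<Otimes>\<^sub>M lborel)"
    by (intro borel_measurable_scaleR borel_measurable_sum measurable_compose[OF measurable_fst])
       auto
  ultimately show ?thesis by (simp add: windowed_def case_prod_beta')
qed

lemma simple_integral_measurable: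
  assumes "0 \<le> t" "is_simple_integrand M F t s P"
  shows "simple_integral W P \<in> borel_measurable M"
proof -
  have *: "(\<lambda>\<omega>. (W (fst (snd p)) \<omega> - W (fst p) \<omega>) *\<^sub>R snd (snd p) \<omega>) \<in> borel_measurable M" if "p \<in> set P" for p
  proof -
    have "t \<le> fst p" "fst p \<le> fst (snd p)" "snd (snd p) \<in> borel_measurable (F (fst p))"
      using assms(2) that by (auto simp: is_simple_integrand_def split_beta)
    then show ?thesis
      using assms(1) measurable_F_imp
      by (intro borel_measurable_scaleR borel_measurable_diff W_measurable) auto
  qed
  have "simple_integral W P = (\<lambda>\<omega>. \<Sum>i<length P. (W (fst (snd (P!i))) \<omega> - W (fst (P!i)) \<omega>) *\<^sub>R snd (snd (P!i)) \<omega>)"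
    by (simp add: fun_eq_iff simple_integral_def sum_list_sum_nth split_beta lessThan_atLeast0)
  then show ?thesis using * by (auto intro!: borel_measurable_sum)
qed

text \<open>
  Approximating integrands are combined by scaling and concatenating their lists, which is possible
  because intervals are allowed to overlap.
\<close>

lemma has_ito_integral_lincomb:
  assumes "0 \<le> t" "has_ito_integral M W t s \<phi> I" "has_ito_integral M W t s \<psi> K"
  shows "has_ito_integral M W t s (\<lambda>r \<omega>. a *\<^sub>R \<phi> r \<omega> + c *\<^sub>R \<psi> r \<omega>) (\<lambda>\<omega>. a *\<^sub>R I \<omega> + c *\<^sub>R K \<omega>)"
proof -
  from assms(2) obtain P where
    \<phi>: "\<phi> \<in> L2_prog M F t s" "I \<in> borel_measurable M" "\<And>k. is_simple_integrand M F t s (P k)"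
      "(\<lambda>k. energy t s (\<lambda>r \<omega>. \<phi> r \<omega> - simple_process (P k) r \<omega>)) \<longlonglongrightarrow> 0"
      "(\<lambda>k. \<integral>\<^sup>+\<omega>. ennreal ((norm (I \<omega> - simple_integral W (P k) \<omega>))\<^sup>2) \<partial>M) \<longlonglongrightarrow> 0"
    by (auto simp: has_ito_integral_def energy_def)
  from assms(3) obtain P' where
    \<psi>: "\<psi> \<in> L2_prog M F t s" "K \<in> borel_measurable M" "\<And>k. is_simple_integrand M F t s (P' k)"
      "(\<lambda>k. energy t s (\<lambda>r \<omega>. \<psi> r \<omega> - simple_process (P' k) r \<omega>)) \<longlonglongrightarrow> 0"
      "(\<lambda>k. \<integral>\<^sup>+\<omega>. ennreal ((norm (K \<omega> - simple_integral W (P' k) \<omega>))\<^sup>2) \<partial>M) \<longlonglongrightarrow> 0"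
    by (auto simp: has_ito_integral_def energy_def)
  define scale where "scale d Q = map (\<lambda>(u, v, \<xi>). (u, v, \<lambda>\<omega>. d *\<^sub>R \<xi> \<omega>)) Q"
    for d and Q :: "('a, 'b) simple_integrand"
  define R where "R k = scale a (P k) @ scale c (P' k)" for k
  have sc: "is_simple_integrand M F t s (scale d Q)" if "is_simple_integrand M F t s Q" for d Q
  proof -
    have "\<exists>K. \<forall>\<omega>\<in>space M. norm (d *\<^sub>R \<xi> \<omega>) \<le> K" if "\<exists>K. \<forall>\<omega>\<in>space M. norm (\<xi> \<omega> :: 'b) \<le> K" for \<xi>
    proof -
      from that obtain K where "\<forall>\<omega>\<in>space M. norm (\<xi> \<omega>) \<le> K" by blast
      then have "\<forall>\<omega>\<in>space M. norm (d *\<^sub>R \<xi> \<omega>) \<le> \<bar>d\<bar> * K" by (auto intro: mult_left_mono)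
      then show ?thesis by blast
    qed
    then show ?thesis
      using that unfolding is_simple_integrand_def scale_def by force
  qed
  have R: "is_simple_integrand M F t s (R k)" for k
    using sc[OF \<phi>(3)[of k], of a] sc[OF \<psi>(3)[of k], of c]
    by (simp only: R_def is_simple_integrand_def set_append ball_Un)
  have scp: "simple_process (scale d Q) r \<omega> = d *\<^sub>R simple_process Q r \<omega>" for d Q r \<omega>
    unfolding simple_process_def scale_def by (induction Q) (auto simp: scaleR_add_right)
  have sci: "simple_integral W (scale d Q) \<omega> = d *\<^sub>R simple_integral W Q \<omega>" for d Q \<omega>
    unfolding simple_integral_def scale_def by (induction Q) (auto simp: scaleR_add_right)
  have Rp: "a *\<^sub>R \<phi> r \<omega> + c *\<^sub>R \<psi> r \<omega> - simple_process (R k) r \<omega> =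
      a *\<^sub>R (\<phi> r \<omega> - simple_process (P k) r \<omega>) + c *\<^sub>R (\<psi> r \<omega> - simple_process (P' k) r \<omega>)" for k r \<omega>
    using scp[of a "P k"] scp[of c "P' k"]
    by (simp add: R_def simple_process_def algebra_simps)
  have Ri: "a *\<^sub>R I \<omega> + c *\<^sub>R K \<omega> - simple_integral W (R k) \<omega> =
      a *\<^sub>R (I \<omega> - simple_integral W (P k) \<omega>) + c *\<^sub>R (K \<omega> - simple_integral W (P' k) \<omega>)" for k \<omega>
    using sci[of a "P k"] sci[of c "P' k"]
    by (simp add: R_def simple_integral_def algebra_simps)
  have wd: "windowed t s (\<lambda>r \<omega>. \<phi> r \<omega> - simple_process Q r \<omega>) \<in> borel_measurable (M \<Otimes>\<^sub>M lborel)"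
    if "\<phi> \<in> L2_prog M F t s" "is_simple_integrand M F t s Q" for \<phi> :: "real \<Rightarrow> 'a \<Rightarrow> 'b" and Q
  proof -
    have [measurable]: "windowed t s \<phi> \<in> borel_measurable (M \<Otimes>\<^sub>M lborel)"
        "windowed t s (simple_process Q) \<in> borel_measurable (M \<Otimes>\<^sub>M lborel)"
      using that by (auto simp: L2_prog_iff intro!: prog_measurable_windowed windowed_simple_process_measurable)
    have "(\<lambda>x. windowed t s \<phi> x - windowed t s (simple_process Q) x) \<in> borel_measurable (M \<Otimes>\<^sub>M lborel)"
      by measurable
    then show ?thesis
      by (simp add: windowed_def case_prod_beta' scaleR_diff_right)
  qed
  show ?thesis
    unfolding has_ito_integral_def
  proof (intro conjI exI[of _ R] allI R)
    show "(\<lambda>r \<omega>. a *\<^sub>R \<phi> r \<omega> + c *\<^sub>R \<psi> r \<omega>) \<in> L2_prog M F t s"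
      by (rule L2_prog_lincomb) fact+
    show "(\<lambda>\<omega>. a *\<^sub>R I \<omega> + c *\<^sub>R K \<omega>) \<in> borel_measurable M"
      using \<phi>(2) \<psi>(2) by measurable
    have "(\<lambda>k. energy t s (\<lambda>r \<omega>. a *\<^sub>R \<phi> r \<omega> + c *\<^sub>R \<psi> r \<omega> - simple_process (R k) r \<omega>)) \<longlonglongrightarrow> 0"
      unfolding Rp
      by (rule tendsto_zero_ennreal_lincomb[OF \<phi>(4) \<psi>(4) energy_lincomb_le])
         (use wd \<phi> \<psi> in blast)+
    then show "(\<lambda>k. \<integral>\<^sup>+\<omega>. (\<integral>\<^sup>+r\<in>{t..s}.
          ennreal ((norm (a *\<^sub>R \<phi> r \<omega> + c *\<^sub>R \<psi> r \<omega> - simple_process (R k) r \<omega>))\<^sup>2) \<partial>lborel) \<partial>M) \<longlonglongrightarrow> 0"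
      by (simp add: energy_def)
    have "(\<lambda>\<omega>. I \<omega> - simple_integral W (P k) \<omega>) \<in> borel_measurable M"
      "(\<lambda>\<omega>. K \<omega> - simple_integral W (P' k) \<omega>) \<in> borel_measurable M" for k
      using simple_integral_measurable[OF assms(1)] \<phi> \<psi> by (auto intro!: borel_measurable_diff)
    then show "(\<lambda>k. \<integral>\<^sup>+\<omega>. ennreal ((norm (a *\<^sub>R I \<omega> + c *\<^sub>R K \<omega> - simple_integral W (R k) \<omega>))\<^sup>2) \<partial>M) \<longlonglongrightarrow> 0"
      unfolding Ri
      by (intro tendsto_zero_ennreal_lincomb[OF \<phi>(5) \<psi>(5) nn_integral_norm_square_lincomb_le])
  qed
qed

text \<open>
  The isometry passes to the limit from simple integrands; a bound with some constant is enough
  for Gronwall's argument, and the constant 4 comes from using the parallelogram bound twice.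
\<close>

lemma ito_integral_bound:
  assumes "0 \<le> t" "has_ito_integral M W t s \<phi> I"
  shows "(\<integral>\<^sup>+\<omega>. ennreal ((norm (I \<omega>))\<^sup>2) \<partial>M) \<le> 4 * energy t s \<phi>"
proof -
  from assms(2) obtain P where
    \<phi>: "\<phi> \<in> L2_prog M F t s" and [measurable]: "I \<in> borel_measurable M"
    and P: "\<And>k. is_simple_integrand M F t s (P k)"
    and lim: "(\<lambda>k. energy t s (\<lambda>r \<omega>. \<phi> r \<omega> - simple_process (P k) r \<omega>)) \<longlonglongrightarrow> 0"
      "(\<lambda>k. \<integral>\<^sup>+\<omega>. ennreal ((norm (I \<omega> - simple_integral W (P k) \<omega>))\<^sup>2) \<partial>M) \<longlonglongrightarrow> 0"
    by (auto simp: has_ito_integral_def energy_def)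
  let ?d = "\<lambda>k. \<integral>\<^sup>+\<omega>. ennreal ((norm (I \<omega> - simple_integral W (P k) \<omega>))\<^sup>2) \<partial>M"
  let ?e = "\<lambda>k. energy t s (\<lambda>r \<omega>. \<phi> r \<omega> - simple_process (P k) r \<omega>)"
  have le: "(\<integral>\<^sup>+\<omega>. ennreal ((norm (I \<omega>))\<^sup>2) \<partial>M) \<le> 2 * ?d k + (4 * energy t s \<phi> + 4 * ?e k)" for k
  proof -
    have [measurable]: "simple_integral W (P k) \<in> borel_measurable M"
      by (rule simple_integral_measurable[OF assms(1) P])
    have wm [measurable]: "windowed t s \<phi> \<in> borel_measurable (M \<Otimes>\<^sub>M lborel)"
        "windowed t s (simple_process (P k)) \<in> borel_measurable (M \<Otimes>\<^sub>M lborel)"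
      using \<phi> P by (auto simp: L2_prog_iff intro!: prog_measurable_windowed windowed_simple_process_measurable)
    have wm2: "windowed t s (\<lambda>r \<omega>. \<phi> r \<omega> - simple_process (P k) r \<omega>) \<in> borel_measurable (M \<Otimes>\<^sub>M lborel)"
      using windowed_lincomb[of t s 1 \<phi> "-1" "simple_process (P k)"] by simp
    have "(\<integral>\<^sup>+\<omega>. ennreal ((norm (I \<omega>))\<^sup>2) \<partial>M) \<le>
        2 * ?d k + 2 * (\<integral>\<^sup>+\<omega>. ennreal ((norm (simple_integral W (P k) \<omega>))\<^sup>2) \<partial>M)"
      using nn_integral_norm_square_lincomb_le[of "\<lambda>\<omega>. I \<omega> - simple_integral W (P k) \<omega>" M "simple_integral W (P k)" 1 1]
      by simp
    also have "(\<integral>\<^sup>+\<omega>. ennreal ((norm (simple_integral W (P k) \<omega>))\<^sup>2) \<partial>M) = energy t s (simple_process (P k))"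
      using simple_isometry[OF assms(1) P] by (simp add: energy_def)
    also have "energy t s (simple_process (P k)) \<le> 2 * energy t s \<phi> + 2 * ?e k"
      using energy_lincomb_le[OF wm(1) wm2, of 1 "-1"] by simp
    finally show ?thesis
      by (simp add: distrib_left mult_left_mono flip: mult.assoc)
  qed
  have "(\<lambda>k. 2 * ?d k + (4 * energy t s \<phi> + 4 * ?e k)) \<longlonglongrightarrow> 2 * 0 + (4 * energy t s \<phi> + 4 * 0)"
    by (intro tendsto_add tendsto_mult_ennreal tendsto_const lim) auto
  then have "(\<lambda>k. 2 * ?d k + (4 * energy t s \<phi> + 4 * ?e k)) \<longlonglongrightarrow> 4 * energy t s \<phi>" by simp
  from LIMSEQ_le_const[OF this] le show ?thesis by blast
qed

section \<open>Square integrable continuous processes\<close>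

text \<open>
  The supremum over the uncountable interval is replaced by one over rational times, which is measurable;
  by continuity the two agree almost surely. A measurable majorant is needed because the
  integral of a non-measurable function is not subadditive.
\<close>

lemma L2C_prog_dominated:
  assumes X: "X \<in> L2C_prog M F t T" and "t < T"
  shows "\<exists>Y. Y \<in> borel_measurable M \<and> (\<forall>\<omega>. 0 \<le> Y \<omega>) \<and> integrable M (\<lambda>\<omega>. (Y \<omega>)\<^sup>2) \<and>
    (AE \<omega> in M. \<forall>s\<in>{t..T}. norm (X s \<omega>) \<le> Y \<omega>)"
proof -
  let ?D = "{t<..<T} \<inter> \<rat>"
  define Z where "Z \<omega> = (SUP s\<in>?D. ennreal ((norm (X s \<omega>))\<^sup>2))" for \<omega>
  have "X s \<in> borel_measurable M" if "s \<in> {t..T}" for s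
    using X that by (intro measurable_F_imp[OF prog_measurable_section]) (auto simp: L2C_prog_def)
  then have Z[measurable]: "Z \<in> borel_measurable M"
    unfolding Z_def by (intro borel_measurable_SUP countable_Int2 countable_rat) auto
  have "(\<integral>\<^sup>+\<omega>. Z \<omega> \<partial>M) \<le> (\<integral>\<^sup>+\<omega>. (SUP s\<in>{t..T}. ennreal ((norm (X s \<omega>))\<^sup>2)) \<partial>M)"
    unfolding Z_def by (intro nn_integral_mono SUP_subset_mono) auto
  also have "\<dots> < \<infinity>" using X by (simp add: L2C_prog_def)
  finally have fin: "(\<integral>\<^sup>+\<omega>. Z \<omega> \<partial>M) < \<infinity>" .
  then have AE_fin: "AE \<omega> in M. Z \<omega> \<noteq> \<infinity>"
    by (intro nn_integral_noteq_infinite) auto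
  have "AE \<omega> in M. continuous_on {t..T} (\<lambda>s. X s \<omega>)" using X by (simp add: L2C_prog_def)
  then have dom: "AE \<omega> in M. \<forall>s\<in>{t..T}. norm (X s \<omega>) \<le> sqrt (enn2real (Z \<omega>))"
    using AE_fin
  proof eventually_elim
    case (elim \<omega>)
    have "norm (X s \<omega>) \<le> sqrt (enn2real (Z \<omega>))" if "s \<in> ?D" for s
    proof -
      have "ennreal ((norm (X s \<omega>))\<^sup>2) \<le> Z \<omega>" unfolding Z_def by (rule SUP_upper[OF that])
      also have "Z \<omega> = ennreal (enn2real (Z \<omega>))" using elim(2) by (simp add: less_top)
      finally show ?thesis by (simp add: real_le_rsqrt)
    qed
    then show ?case
      using continuous_on_closure_norm_le[of ?D "\<lambda>s. X s \<omega>"] elim(1) closure_rationals_Ioo[OF \<open>t < T\<close>] by metis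
  qed
  have "integrable M (\<lambda>\<omega>. enn2real (Z \<omega>))"
  proof (rule integrableI_bounded)
    have "(\<integral>\<^sup>+\<omega>. ennreal (norm (enn2real (Z \<omega>))) \<partial>M) = (\<integral>\<^sup>+\<omega>. Z \<omega> \<partial>M)"
      by (rule nn_integral_cong_AE) (use AE_fin in eventually_elim, simp add: less_top)
    then show "(\<integral>\<^sup>+\<omega>. ennreal (norm (enn2real (Z \<omega>))) \<partial>M) < \<infinity>" using fin by simp
  qed measurable
  then show ?thesis
    using dom by (intro exI[of _ "\<lambda>\<omega>. sqrt (enn2real (Z \<omega>))"]) simp
qed

lemma L2C_progI:
  assumes "prog_measurable F t T X" "AE \<omega> in M. continuous_on {t..T} (\<lambda>s. X s \<omega>)"
    and "AE \<omega> in M. \<forall>s\<in>{t..T}. norm (X s \<omega>) \<le> Y \<omega>" "integrable M (\<lambda>\<omega>. (Y \<omega>)\<^sup>2)"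
  shows "X \<in> L2C_prog M F t T"
proof -
  have "(\<integral>\<^sup>+\<omega>. (SUP s\<in>{t..T}. ennreal ((norm (X s \<omega>))\<^sup>2)) \<partial>M) \<le> (\<integral>\<^sup>+\<omega>. ennreal ((Y \<omega>)\<^sup>2) \<partial>M)"
    by (rule nn_integral_mono_AE, use assms(3) in eventually_elim)
       (auto intro!: SUP_least ennreal_leI power_mono)
  also have "\<dots> < \<infinity>"
    using assms(4) by (simp add: nn_integral_eq_integral)
  finally show ?thesis using assms(1,2) by (simp add: L2C_prog_def)
qed

lemma L2C_prog_lincomb:
  assumes "X \<in> L2C_prog M F t T" "X' \<in> L2C_prog M F t T" "t < T"
  shows "(\<lambda>s \<omega>. a *\<^sub>R X s \<omega> + c *\<^sub>R X' s \<omega>) \<in> L2C_prog M F t T"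
proof -
  from L2C_prog_dominated[OF assms(1,3)] obtain Y where
    Y: "Y \<in> borel_measurable M" "\<forall>\<omega>. 0 \<le> Y \<omega>" "integrable M (\<lambda>\<omega>. (Y \<omega>)\<^sup>2)"
      "AE \<omega> in M. \<forall>s\<in>{t..T}. norm (X s \<omega>) \<le> Y \<omega>" by blast
  from L2C_prog_dominated[OF assms(2,3)] obtain Y' where
    Y': "Y' \<in> borel_measurable M" "\<forall>\<omega>. 0 \<le> Y' \<omega>" "integrable M (\<lambda>\<omega>. (Y' \<omega>)\<^sup>2)"
      "AE \<omega> in M. \<forall>s\<in>{t..T}. norm (X' s \<omega>) \<le> Y' \<omega>" by blast
  show ?thesis
  proof (rule L2C_progI)
    show "prog_measurable F t T (\<lambda>s \<omega>. a *\<^sub>R X s \<omega> + c *\<^sub>R X' s \<omega>)"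
      using assms by (intro prog_measurable_lincomb) (auto simp: L2C_prog_def)
    have "AE \<omega> in M. continuous_on {t..T} (\<lambda>s. X s \<omega>)" "AE \<omega> in M. continuous_on {t..T} (\<lambda>s. X' s \<omega>)"
      using assms by (auto simp: L2C_prog_def)
    then show "AE \<omega> in M. continuous_on {t..T} (\<lambda>s. a *\<^sub>R X s \<omega> + c *\<^sub>R X' s \<omega>)"
      by eventually_elim (intro continuous_intros)
    show "AE \<omega> in M. \<forall>s\<in>{t..T}. norm (a *\<^sub>R X s \<omega> + c *\<^sub>R X' s \<omega>) \<le> \<bar>a\<bar> * Y \<omega> + \<bar>c\<bar> * Y' \<omega>"
      using Y(4) Y'(4)
      by eventually_elim (auto intro!: norm_triangle_le add_mono mult_left_mono)
    show "integrable M (\<lambda>\<omega>. (\<bar>a\<bar> * Y \<omega> + \<bar>c\<bar> * Y' \<omega>)\<^sup>2)"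
    proof (rule Bochner_Integration.integrable_bound)
      show "integrable M (\<lambda>\<omega>. 2 * a\<^sup>2 * (Y \<omega>)\<^sup>2 + 2 * c\<^sup>2 * (Y' \<omega>)\<^sup>2)"
        using Y(3) Y'(3) by auto
      show "(\<lambda>\<omega>. (\<bar>a\<bar> * Y \<omega> + \<bar>c\<bar> * Y' \<omega>)\<^sup>2) \<in> borel_measurable M"
        using Y(1) Y'(1) by measurable
      show "AE \<omega> in M. norm ((\<bar>a\<bar> * Y \<omega> + \<bar>c\<bar> * Y' \<omega>)\<^sup>2) \<le> norm (2 * a\<^sup>2 * (Y \<omega>)\<^sup>2 + 2 * c\<^sup>2 * (Y' \<omega>)\<^sup>2)"
      proof (rule AE_I2)
        fix \<omega>
        have "(\<bar>a\<bar> * Y \<omega> + \<bar>c\<bar> * Y' \<omega>)\<^sup>2 \<le> 2 * a\<^sup>2 * (Y \<omega>)\<^sup>2 + 2 * c\<^sup>2 * (Y' \<omega>)\<^sup>2"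
          using sum_squares_bound[of "\<bar>a\<bar> * Y \<omega>" "\<bar>c\<bar> * Y' \<omega>"]
          by (simp add: power2_sum power_mult_distrib)
        then show "norm ((\<bar>a\<bar> * Y \<omega> + \<bar>c\<bar> * Y' \<omega>)\<^sup>2) \<le> norm (2 * a\<^sup>2 * (Y \<omega>)\<^sup>2 + 2 * c\<^sup>2 * (Y' \<omega>)\<^sup>2)"
          by (simp only: real_norm_def abs_of_nonneg[OF zero_le_power2] order_trans[OF _ abs_ge_self])
      qed
    qed
  qed
qed

lemma sde_solution_lincomb:
  fixes X X' :: "real \<Rightarrow> 'a \<Rightarrow> 'b::euclidean_space"
  assumes "0 \<le> t" "t < T"
    and X: "sde_solution M W t T x \<beta> \<gamma> X" "AE \<omega> in M. set_integrable lborel {t..T} (\<lambda>s. \<beta> s \<omega>)"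
    and X': "sde_solution M W t T x' \<beta>' \<gamma>' X'" "AE \<omega> in M. set_integrable lborel {t..T} (\<lambda>s. \<beta>' s \<omega>)"
  shows "sde_solution M W t T (a *\<^sub>R x + c *\<^sub>R x') (\<lambda>s \<omega>. a *\<^sub>R \<beta> s \<omega> + c *\<^sub>R \<beta>' s \<omega>)
    (\<lambda>s \<omega>. a *\<^sub>R \<gamma> s \<omega> + c *\<^sub>R \<gamma>' s \<omega>) (\<lambda>s \<omega>. a *\<^sub>R X s \<omega> + c *\<^sub>R X' s \<omega>)"
  unfolding sde_solution_def
proof (intro conjI ballI)
  show "(\<lambda>s \<omega>. a *\<^sub>R X s \<omega> + c *\<^sub>R X' s \<omega>) \<in> L2C_prog M F t T"
    using X X' assms(2) by (intro L2C_prog_lincomb) (auto simp: sde_solution_def)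
  fix s assume s: "s \<in> {t..T}"
  from X(1) s obtain I where
    I: "has_ito_integral M W t s \<gamma> I" "AE \<omega> in M. X s \<omega> = x + (LINT r:{t..s}|lborel. \<beta> r \<omega>) + I \<omega>"
    unfolding sde_solution_def by blast
  from X'(1) s obtain I' where
    I': "has_ito_integral M W t s \<gamma>' I'" "AE \<omega> in M. X' s \<omega> = x' + (LINT r:{t..s}|lborel. \<beta>' r \<omega>) + I' \<omega>"
    unfolding sde_solution_def by blast
  have "AE \<omega> in M. a *\<^sub>R X s \<omega> + c *\<^sub>R X' s \<omega> =
      a *\<^sub>R x + c *\<^sub>R x' + (LINT r:{t..s}|lborel. a *\<^sub>R \<beta> r \<omega> + c *\<^sub>R \<beta>' r \<omega>) + (a *\<^sub>R I \<omega> + c *\<^sub>R I' \<omega>)"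
    using I(2) I'(2) X(2) X'(2)
  proof eventually_elim
    case (elim \<omega>)
    have "set_integrable lborel {t..s} (\<lambda>r. \<beta> r \<omega>)" "set_integrable lborel {t..s} (\<lambda>r. \<beta>' r \<omega>)"
      using elim(3,4) s by (auto elim!: set_integrable_subset)
    then have "(LINT r:{t..s}|lborel. a *\<^sub>R \<beta> r \<omega> + c *\<^sub>R \<beta>' r \<omega>) =
        a *\<^sub>R (LINT r:{t..s}|lborel. \<beta> r \<omega>) + c *\<^sub>R (LINT r:{t..s}|lborel. \<beta>' r \<omega>)"
      by (subst set_integral_add(2)) (auto simp: set_integral_scaleR_right)
    then show ?case using elim(1,2) by (simp add: algebra_simps)
  qed
  then show "\<exists>I. has_ito_integral M W t s (\<lambda>s \<omega>. a *\<^sub>R \<gamma> s \<omega> + c *\<^sub>R \<gamma>' s \<omega>) I \<and>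
      (AE \<omega> in M. a *\<^sub>R X s \<omega> + c *\<^sub>R X' s \<omega> = a *\<^sub>R x + c *\<^sub>R x' +
        (LINT r:{t..s}|lborel. a *\<^sub>R \<beta> r \<omega> + c *\<^sub>R \<beta>' r \<omega>) + I \<omega>)"
    using has_ito_integral_lincomb[OF assms(1) I(1) I'(1)] by blast
qed

text \<open>
  Let \<open>f r\<close> be the mean square of \<open>Z r\<close>. The drift is estimated by the Cauchy-Schwarz inequality
  with respect to the measure with density \<open>|A|\<close>, since \<open>A\<close> itself need not be square integrable; the
  stochastic integral is estimated by its energy. Together, \<open>f s\<close> is at most the integral of
  \<open>k r * f r\<close> over \<open>[t, s]\<close> with the integrable kernel \<open>k = 2 a |A| + 8 |C|\<^sup>2\<close>, where \<open>a\<close>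
  is the integral of \<open>|A|\<close>.
\<close>

lemma linear_sde_zero:
  fixes A C :: "real \<Rightarrow> real^'n^'n" and Z :: "real \<Rightarrow> 'a \<Rightarrow> real^'n"
  assumes t: "0 \<le> t" "t < T"
    and A: "A \<in> L_fun 1 t T" and C: "C \<in> L_fun 2 t T"
    and Z: "sde_solution M W t T 0 (\<lambda>s \<omega>. A s *v Z s \<omega>) (\<lambda>s \<omega>. C s *v Z s \<omega>) Z"
    and s: "s \<in> {t..T}"
  shows "AE \<omega> in M. Z s \<omega> = 0"
proof -
  have ZL: "Z \<in> L2C_prog M F t T" using Z by (simp add: sde_solution_def)
  define z where "z = windowed t T Z"
  have z [measurable]: "z \<in> borel_measurable (M \<Otimes>\<^sub>M lborel)"
    unfolding z_def using ZL by (intro prog_measurable_windowed) (simp add: L2C_prog_def)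
  have z_eq: "z (\<omega>, r) = Z r \<omega>" if "r \<in> {t..T}" for \<omega> r
    using that by (simp add: z_def windowed_def)
  have Zm [measurable]: "Z r \<in> borel_measurable M" if "r \<in> {t..T}" for r
    using ZL that by (intro measurable_F_imp[OF prog_measurable_section]) (auto simp: L2C_prog_def)
  define \<alpha> where "\<alpha> r = indicator {t..T} r * norm (A r)" for r
  define \<kappa> where "\<kappa> r = indicator {t..T} r * (norm (C r))\<^sup>2" for r
  have \<alpha>_int: "integrable lborel \<alpha>" and \<kappa>_int: "integrable lborel \<kappa>"
    using A C by (simp_all add: L_fun_def set_integrable_def \<alpha>_def[abs_def] \<kappa>_def[abs_def])
  then have [measurable]: "\<alpha> \<in> borel_measurable borel" "\<kappa> \<in> borel_measurable borel" by auto
  have nonneg [simp]: "0 \<le> \<alpha> r" "0 \<le> \<kappa> r" for r by (auto simp: \<alpha>_def \<kappa>_def)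
  define a where "a = (LINT r|lborel. \<alpha> r)"
  have a: "(\<integral>\<^sup>+r. ennreal (\<alpha> r) \<partial>lborel) = ennreal a" and a0 [simp]: "0 \<le> a"
    unfolding a_def by (auto intro!: nn_integral_eq_integral \<alpha>_int)
  define f where "f r = (\<integral>\<^sup>+\<omega>. ennreal ((norm (Z r \<omega>))\<^sup>2) \<partial>M)" for r
  define k where "k r = 2 * a * \<alpha> r + 8 * \<kappa> r" for r
  have [measurable]: "k \<in> borel_measurable borel" unfolding k_def by measurable
  have drift: "(\<integral>\<^sup>+r\<in>{t..s}. ennreal (norm (A r *v Z r \<omega>)) \<partial>lborel)\<^sup>2 \<le>
      ennreal a * (\<integral>\<^sup>+r\<in>{t..s}. ennreal (\<alpha> r) * ennreal ((norm (z (\<omega>, r)))\<^sup>2) \<partial>lborel)"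
    if s: "s \<in> {t..T}" and [measurable]: "\<omega> \<in> space M" for s \<omega>
  proof -
    let ?g = "\<lambda>r. ennreal (sqrt (\<alpha> r) * norm (z (\<omega>, r))) * indicator {t..s} r"
    have "(\<integral>\<^sup>+r\<in>{t..s}. ennreal (norm (A r *v Z r \<omega>)) \<partial>lborel) \<le>
        (\<integral>\<^sup>+r. ennreal (sqrt (\<alpha> r)) * ?g r \<partial>lborel)"
    proof (rule nn_integral_mono)
      fix r
      show "ennreal (norm (A r *v Z r \<omega>)) * indicator {t..s} r \<le> ennreal (sqrt (\<alpha> r)) * ?g r"
      proof (cases "r \<in> {t..s}")
        case True
        then have r: "r \<in> {t..T}" using s by auto
        have "norm (A r *v Z r \<omega>) \<le> sqrt (\<alpha> r) * (sqrt (\<alpha> r) * norm (z (\<omega>, r)))"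
          using norm_matrix_vector_mult_le[of "A r" "Z r \<omega>"] r z_eq[OF r]
          by (simp add: \<alpha>_def flip: mult.assoc)
        then show ?thesis using True by (simp add: ennreal_leI flip: ennreal_mult)
      qed auto
    qed
    then have "(\<integral>\<^sup>+r\<in>{t..s}. ennreal (norm (A r *v Z r \<omega>)) \<partial>lborel)\<^sup>2 \<le>
        (\<integral>\<^sup>+r. ennreal (sqrt (\<alpha> r)) * ?g r \<partial>lborel)\<^sup>2" by (rule power_mono) simp
    also have "\<dots> \<le> (\<integral>\<^sup>+r. ennreal (sqrt (\<alpha> r)) ^ 2 \<partial>lborel) * (\<integral>\<^sup>+r. ?g r ^ 2 \<partial>lborel)"
      by (rule Cauchy_Schwarz_nn_integral) measurable
    also have "(\<integral>\<^sup>+r. ennreal (sqrt (\<alpha> r)) ^ 2 \<partial>lborel) = ennreal a"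
      unfolding a[symmetric] by (simp add: ennreal_power)
    also have "(\<integral>\<^sup>+r. ?g r ^ 2 \<partial>lborel) =
        (\<integral>\<^sup>+r\<in>{t..s}. ennreal (\<alpha> r) * ennreal ((norm (z (\<omega>, r)))\<^sup>2) \<partial>lborel)"
      by (intro nn_integral_cong)
         (auto simp: indicator_def ennreal_power power_mult_distrib simp flip: ennreal_mult)
    finally show ?thesis .
  qed
  have le: "f s \<le> (\<integral>\<^sup>+r\<in>{t..s}. ennreal (k r) * f r \<partial>lborel)" if s: "s \<in> {t..T}" for s
  proof -
    from Z s obtain I where I: "has_ito_integral M W t s (\<lambda>r \<omega>. C r *v Z r \<omega>) I"
      "AE \<omega> in M. Z s \<omega> = 0 + (LINT r:{t..s}|lborel. A r *v Z r \<omega>) + I \<omega>"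
      unfolding sde_solution_def by blast
    have [measurable]: "I \<in> borel_measurable M" using I(1) by (simp add: has_ito_integral_def)
    let ?V = "\<lambda>\<omega>. \<integral>\<^sup>+r\<in>{t..s}. ennreal (\<alpha> r) * ennreal ((norm (z (\<omega>, r)))\<^sup>2) \<partial>lborel"
    let ?E = "\<lambda>\<omega>. \<integral>\<^sup>+r\<in>{t..s}. ennreal (\<kappa> r) * ennreal ((norm (z (\<omega>, r)))\<^sup>2) \<partial>lborel"
    have "AE \<omega> in M. ennreal ((norm (Z s \<omega>))\<^sup>2) \<le> ennreal (2 * a) * ?V \<omega> + 2 * ennreal ((norm (I \<omega>))\<^sup>2)"
      using I(2) AE_space
    proof eventually_elim
      case (elim \<omega>)
      let ?L = "LINT r:{t..s}|lborel. A r *v Z r \<omega>"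
      have "ennreal (norm ?L) \<le> (\<integral>\<^sup>+r\<in>{t..s}. ennreal (norm (A r *v Z r \<omega>)) \<partial>lborel)"
      proof (cases "set_integrable lborel {t..s} (\<lambda>r. A r *v Z r \<omega>)")
        case True
        have "ennreal (norm ?L) \<le> (\<integral>\<^sup>+r. ennreal (norm (indicator {t..s} r *\<^sub>R (A r *v Z r \<omega>))) \<partial>lborel)"
          unfolding set_lebesgue_integral_def
          by (rule integral_norm_bound_ennreal) (use True in \<open>simp add: set_integrable_def\<close>)
        also have "\<dots> = (\<integral>\<^sup>+r\<in>{t..s}. ennreal (norm (A r *v Z r \<omega>)) \<partial>lborel)"
          by (intro nn_integral_cong) (auto simp: indicator_def)
        finally show ?thesis .
      next
        case False
        then have "?L = 0" by (simp add: set_lebesgue_integral_def set_integrable_def not_integrable_integral_eq)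
        then show ?thesis by simp
      qed
      then have "ennreal ((norm ?L)\<^sup>2) \<le> (\<integral>\<^sup>+r\<in>{t..s}. ennreal (norm (A r *v Z r \<omega>)) \<partial>lborel)\<^sup>2"
        using power_mono[of "ennreal (norm ?L)" _ 2] by (simp add: ennreal_power)
      also note drift[OF s elim(2)]
      finally have L: "ennreal ((norm ?L)\<^sup>2) \<le> ennreal a * ?V \<omega>" .
      have "(norm (Z s \<omega>))\<^sup>2 \<le> (norm ?L + norm (I \<omega>))\<^sup>2"
        unfolding elim(1) by (intro power_mono) (auto intro: norm_triangle_ineq)
      also have "\<dots> \<le> 2 * (norm ?L)\<^sup>2 + 2 * (norm (I \<omega>))\<^sup>2"
        using sum_squares_bound[of "norm ?L" "norm (I \<omega>)"] by (simp add: power2_sum)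
      finally have "ennreal ((norm (Z s \<omega>))\<^sup>2) \<le> ennreal (2 * (norm ?L)\<^sup>2 + 2 * (norm (I \<omega>))\<^sup>2)"
        by (rule ennreal_leI)
      also have "\<dots> = 2 * ennreal ((norm ?L)\<^sup>2) + 2 * ennreal ((norm (I \<omega>))\<^sup>2)"
        by (simp add: ennreal_mult)
      also have "\<dots> \<le> 2 * (ennreal a * ?V \<omega>) + 2 * ennreal ((norm (I \<omega>))\<^sup>2)"
        using L by (intro add_mono mult_left_mono) auto
      finally show ?case by (simp add: ennreal_mult mult.assoc)
    qed
    then have "f s \<le> (\<integral>\<^sup>+\<omega>. ennreal (2 * a) * ?V \<omega> + 2 * ennreal ((norm (I \<omega>))\<^sup>2) \<partial>M)"
      unfolding f_def by (rule nn_integral_mono_AE)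
    also have "\<dots> = ennreal (2 * a) * (\<integral>\<^sup>+\<omega>. ?V \<omega> \<partial>M) + 2 * (\<integral>\<^sup>+\<omega>. ennreal ((norm (I \<omega>))\<^sup>2) \<partial>M)"
      by (subst nn_integral_add) (auto simp: nn_integral_cmult)
    also have "(\<integral>\<^sup>+\<omega>. ennreal ((norm (I \<omega>))\<^sup>2) \<partial>M) \<le> 4 * (\<integral>\<^sup>+\<omega>. ?E \<omega> \<partial>M)"
    proof -
      have "energy t s (\<lambda>r \<omega>. C r *v Z r \<omega>) \<le> (\<integral>\<^sup>+\<omega>. ?E \<omega> \<partial>M)"
        unfolding energy_def
      proof (intro nn_integral_mono)
        fix \<omega> r
        show "ennreal ((norm (C r *v Z r \<omega>))\<^sup>2) * indicator {t..s} r \<le>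
          ennreal (\<kappa> r) * ennreal ((norm (z (\<omega>, r)))\<^sup>2) * indicator {t..s} r"
        proof (cases "r \<in> {t..s}")
          case True
          then have r: "r \<in> {t..T}" using s by auto
          have "(norm (C r *v Z r \<omega>))\<^sup>2 \<le> \<kappa> r * (norm (z (\<omega>, r)))\<^sup>2"
            using power_mono[OF norm_matrix_vector_mult_le[of "C r" "Z r \<omega>"], of 2] r z_eq[OF r]
            by (simp add: \<kappa>_def power_mult_distrib)
          then show ?thesis using True by (simp add: ennreal_leI flip: ennreal_mult)
        qed auto
      qed
      then show ?thesis
        using ito_integral_bound[OF t(1) I(1)] by (meson mult_left_mono order_trans zero_le)
    qed
    also have "ennreal (2 * a) * (\<integral>\<^sup>+\<omega>. ?V \<omega> \<partial>M) + 2 * (4 * (\<integral>\<^sup>+\<omega>. ?E \<omega> \<partial>M)) =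
        (\<integral>\<^sup>+\<omega>. (\<integral>\<^sup>+r\<in>{t..s}. ennreal (k r) * ennreal ((norm (z (\<omega>, r)))\<^sup>2) \<partial>lborel) \<partial>M)"
    proof -
      have k: "ennreal (k r) = ennreal (2 * a) * ennreal (\<alpha> r) + 8 * ennreal (\<kappa> r)" for r
        unfolding k_def by (simp add: ennreal_mult)
      have "(\<integral>\<^sup>+\<omega>. (\<integral>\<^sup>+r\<in>{t..s}. ennreal (k r) * ennreal ((norm (z (\<omega>, r)))\<^sup>2) \<partial>lborel) \<partial>M) =
          (\<integral>\<^sup>+\<omega>. ennreal (2 * a) * ?V \<omega> + 8 * ?E \<omega> \<partial>M)"
        unfolding k by (intro nn_integral_cong)
          (simp add: distrib_right nn_integral_add nn_integral_cmult mult.assoc)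
      also have "\<dots> = ennreal (2 * a) * (\<integral>\<^sup>+\<omega>. ?V \<omega> \<partial>M) + 8 * (\<integral>\<^sup>+\<omega>. ?E \<omega> \<partial>M)"
        by (subst nn_integral_add) (auto simp: nn_integral_cmult)
      finally show ?thesis by (simp flip: mult.assoc)
    qed
    also have "\<dots> = (\<integral>\<^sup>+r. (\<integral>\<^sup>+\<omega>. ennreal (k r) * ennreal ((norm (z (\<omega>, r)))\<^sup>2) * indicator {t..s} r \<partial>M) \<partial>lborel)"
      by (rule product.Fubini'[symmetric]) measurable
    also have "\<dots> = (\<integral>\<^sup>+r\<in>{t..s}. ennreal (k r) * f r \<partial>lborel)"
    proof (rule nn_integral_cong)
      fix r
      show "(\<integral>\<^sup>+\<omega>. ennreal (k r) * ennreal ((norm (z (\<omega>, r)))\<^sup>2) * indicator {t..s} r \<partial>M) =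
          ennreal (k r) * f r * indicator {t..s} r"
      proof (cases "r \<in> {t..s}")
        case True
        then have r: "r \<in> {t..T}" using s by auto
        have [measurable]: "Z r \<in> borel_measurable M" by (rule Zm[OF r])
        show ?thesis using True by (simp add: z_eq[OF r] f_def nn_integral_cmult)
      qed simp
    qed
    finally show ?thesis by (simp add: mult_left_mono add_left_mono)
  qed
  obtain Y where Y: "\<forall>\<omega>. 0 \<le> Y \<omega>" "integrable M (\<lambda>\<omega>. (Y \<omega>)\<^sup>2)" "AE \<omega> in M. \<forall>s\<in>{t..T}. norm (Z s \<omega>) \<le> Y \<omega>"
    using L2C_prog_dominated[OF ZL t(2)] by blast
  have "f s = 0"
  proof (rule gronwall_zero[OF _ _ _ _ le s])
    show "set_integrable lborel {t..T} k"
      unfolding k_def set_integrable_def using \<alpha>_int \<kappa>_int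
      by (intro integrable_mult_indicator Bochner_Integration.integrable_add integrable_mult_right) auto
    show "0 \<le> k r" for r by (simp add: k_def)
    show "f s \<le> (\<integral>\<^sup>+\<omega>. ennreal ((Y \<omega>)\<^sup>2) \<partial>M)" if "s \<in> {t..T}" for s
      unfolding f_def
      by (rule nn_integral_mono_AE, use Y(3) in eventually_elim)
         (use that in \<open>auto intro!: ennreal_leI power_mono\<close>)
    show "(\<integral>\<^sup>+\<omega>. ennreal ((Y \<omega>)\<^sup>2) \<partial>M) < \<infinity>"
      using Y(2) by (simp add: nn_integral_eq_integral)
  qed
  then show ?thesis
    unfolding f_def using Zm[OF s] by (subst (asm) nn_integral_0_iff_AE) auto
qed

section \<open>Integrability on the product space\<close>

lemma windowed_measurable_compose2:
  fixes h :: "'b::euclidean_space \<Rightarrow> 'c::euclidean_space \<Rightarrow> 'd::euclidean_space"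
  assumes [measurable]: "windowed t T \<phi> \<in> borel_measurable (M \<Otimes>\<^sub>M lborel)"
    "windowed t T \<psi> \<in> borel_measurable (M \<Otimes>\<^sub>M lborel)"
    and h: "continuous_on UNIV (\<lambda>p. h (fst p) (snd p))"
  shows "windowed t T (\<lambda>s \<omega>. h (\<phi> s \<omega>) (\<psi> s \<omega>)) \<in> borel_measurable (M \<Otimes>\<^sub>M lborel)"
proof -
  have [measurable]: "(\<lambda>x. h (windowed t T \<phi> x) (windowed t T \<psi> x)) \<in> borel_measurable (M \<Otimes>\<^sub>M lborel)"
    by (rule borel_measurable_continuous_Pair[OF _ _ h]) measurable
  have "windowed t T (\<lambda>s \<omega>. h (\<phi> s \<omega>) (\<psi> s \<omega>)) =
      (\<lambda>x. indicator {t..T} (snd x) *\<^sub>R h (windowed t T \<phi> x) (windowed t T \<psi> x))"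
    by (auto simp: windowed_def fun_eq_iff indicator_def)
  also have "\<dots> \<in> borel_measurable (M \<Otimes>\<^sub>M lborel)" by measurable
  finally show ?thesis .
qed

lemma windowed_measurable_matrix_vector:
  fixes \<Theta> :: "real \<Rightarrow> 'a \<Rightarrow> real^'k^'l" and X :: "real \<Rightarrow> 'a \<Rightarrow> real^'k"
  assumes "windowed t T \<Theta> \<in> borel_measurable (M \<Otimes>\<^sub>M lborel)" "windowed t T X \<in> borel_measurable (M \<Otimes>\<^sub>M lborel)"
  shows "windowed t T (\<lambda>s \<omega>. \<Theta> s \<omega> *v X s \<omega>) \<in> borel_measurable (M \<Otimes>\<^sub>M lborel)"
  by (rule windowed_measurable_compose2[OF assms])
    (simp add: matrix_vector_mult_def, intro continuous_intros)

lemma windowed_measurable_inner: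
  assumes "windowed t T \<phi> \<in> borel_measurable (M \<Otimes>\<^sub>M lborel)" "windowed t T \<psi> \<in> borel_measurable (M \<Otimes>\<^sub>M lborel)"
  shows "windowed t T (\<lambda>s \<omega>. \<phi> s \<omega> \<bullet> \<psi> s \<omega>) \<in> borel_measurable (M \<Otimes>\<^sub>M lborel)"
  by (rule windowed_measurable_compose2[OF assms]) (intro continuous_intros)

lemma windowed_measurable_add:
  assumes "windowed t T \<phi> \<in> borel_measurable (M \<Otimes>\<^sub>M lborel)" "windowed t T \<psi> \<in> borel_measurable (M \<Otimes>\<^sub>M lborel)"
  shows "windowed t T (\<lambda>s \<omega>. \<phi> s \<omega> + \<psi> s \<omega>) \<in> borel_measurable (M \<Otimes>\<^sub>M lborel)"
  by (rule windowed_measurable_compose2[OF assms]) (intro continuous_intros)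

lemma windowed_measurable_cmult:
  fixes \<phi> :: "real \<Rightarrow> 'a \<Rightarrow> real"
  assumes "windowed t T \<phi> \<in> borel_measurable (M \<Otimes>\<^sub>M lborel)"
  shows "windowed t T (\<lambda>s \<omega>. c * \<phi> s \<omega>) \<in> borel_measurable (M \<Otimes>\<^sub>M lborel)"
  by (rule windowed_measurable_compose2[OF assms assms]) (intro continuous_intros)

lemma windowed_restrict:
  "t' \<le> t \<Longrightarrow> windowed t T \<phi> = (\<lambda>x. indicator {t..T} (snd x) *\<^sub>R windowed t' T \<phi> x)"
  by (auto simp: windowed_def fun_eq_iff indicator_def)

lemma windowed_measurable_restrict:
  assumes "windowed t' T \<phi> \<in> borel_measurable (M \<Otimes>\<^sub>M lborel)" "t' \<le> t"
  shows "windowed t T \<phi> \<in> borel_measurable (M \<Otimes>\<^sub>M lborel)"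
  unfolding windowed_restrict[OF assms(2)] using assms(1) by measurable

text \<open>
  The domination may fail on a null set of sample points and on a null set of times that depends on
  the sample point, because paths are continuous only almost surely and \<open>R\<close> is only essentially bounded.
\<close>

lemma integrable_windowedI:
  assumes f [measurable]: "windowed t T f \<in> borel_measurable (M \<Otimes>\<^sub>M lborel)"
    and h: "integrable (M \<Otimes>\<^sub>M lborel) h"
    and le: "AE \<omega> in M. AE s in lborel. s \<in> {t..T} \<longrightarrow> norm (f s \<omega>) \<le> (h (\<omega>, s) :: real)"
  shows "integrable (M \<Otimes>\<^sub>M lborel) (windowed t T f)"
proof (rule integrableI_bounded[OF f])
  have [measurable]: "h \<in> borel_measurable (M \<Otimes>\<^sub>M lborel)" using h by simp
  have "(\<integral>\<^sup>+x. ennreal (norm (windowed t T f x)) \<partial>(M \<Otimes>\<^sub>M lborel)) =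
      (\<integral>\<^sup>+\<omega>. (\<integral>\<^sup>+s. ennreal (norm (windowed t T f (\<omega>, s))) \<partial>lborel) \<partial>M)"
    by (rule lborel.nn_integral_fst[symmetric]) measurable
  also have "\<dots> \<le> (\<integral>\<^sup>+\<omega>. (\<integral>\<^sup>+s. ennreal (norm (h (\<omega>, s))) \<partial>lborel) \<partial>M)"
  proof (rule nn_integral_mono_AE, use le in eventually_elim)
    case (elim \<omega>)
    then show ?case
      by (intro nn_integral_mono_AE, eventually_elim)
         (auto simp: windowed_def indicator_def intro!: ennreal_leI)
  qed
  also have "\<dots> = (\<integral>\<^sup>+x. ennreal (norm (h x)) \<partial>(M \<Otimes>\<^sub>M lborel))"
    by (rule lborel.nn_integral_fst) measurable
  also have "\<dots> < \<infinity>" using h by (simp add: integrable_iff_bounded)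
  finally show "(\<integral>\<^sup>+x. ennreal (norm (windowed t T f x)) \<partial>(M \<Otimes>\<^sub>M lborel)) < \<infinity>" .
qed

lemma integrable_product_mult:
  fixes Y :: "'a \<Rightarrow> real" and \<alpha> :: "real \<Rightarrow> real"
  assumes Y: "integrable M Y" and \<alpha>: "integrable lborel \<alpha>"
  shows "integrable (M \<Otimes>\<^sub>M lborel) (\<lambda>(\<omega>, s). Y \<omega> * \<alpha> s)"
proof (rule integrableI_bounded)
  have [measurable]: "Y \<in> borel_measurable M" "\<alpha> \<in> borel_measurable borel" using assms by auto
  show "(\<lambda>(\<omega>, s). Y \<omega> * \<alpha> s) \<in> borel_measurable (M \<Otimes>\<^sub>M lborel)" by measurable
  have "(\<integral>\<^sup>+x. ennreal (norm (case x of (\<omega>, s) \<Rightarrow> Y \<omega> * \<alpha> s)) \<partial>(M \<Otimes>\<^sub>M lborel)) =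
      (\<integral>\<^sup>+\<omega>. (\<integral>\<^sup>+s. ennreal (norm (Y \<omega>)) * ennreal (norm (\<alpha> s)) \<partial>lborel) \<partial>M)"
    by (subst lborel.nn_integral_fst[symmetric]) (auto simp: abs_mult ennreal_mult)
  also have "\<dots> = (\<integral>\<^sup>+\<omega>. ennreal (norm (Y \<omega>)) \<partial>M) * (\<integral>\<^sup>+s. ennreal (norm (\<alpha> s)) \<partial>lborel)"
    by (simp add: nn_integral_cmult nn_integral_multc)
  also have "\<dots> < \<infinity>"
    using assms by (simp add: integrable_iff_bounded ennreal_mult_less_top)
  finally show "(\<integral>\<^sup>+x. ennreal (norm (case x of (\<omega>, s) \<Rightarrow> Y \<omega> * \<alpha> s)) \<partial>(M \<Otimes>\<^sub>M lborel)) < \<infinity>" .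
qed

lemma L2_prog_windowed_square_integrable:
  assumes \<phi>: "\<phi> \<in> L2_prog M F t' T" and le: "t' \<le> t"
  shows "integrable (M \<Otimes>\<^sub>M lborel) (\<lambda>x. (norm (windowed t T \<phi> x))\<^sup>2)"
proof -
  have [measurable]: "windowed t' T \<phi> \<in> borel_measurable (M \<Otimes>\<^sub>M lborel)"
    using \<phi> by (intro prog_measurable_windowed) (simp add: L2_prog_iff)
  have "integrable (M \<Otimes>\<^sub>M lborel) (\<lambda>x. (norm (windowed t' T \<phi> x))\<^sup>2)"
    using \<phi> by (intro integrableI_bounded) (auto simp: L2_prog_iff energy_windowed)
  then show ?thesis
    by (rule Bochner_Integration.integrable_bound)
       (auto simp: windowed_restrict[OF le] indicator_def)
qed

text \<open>
  Pairs the space \<open>L\<^sup>2(\<Omega>; L\<^sup>1)\<close> of the inhomogeneity \<open>b\<close> and the weight \<open>q\<close> with the majorant of a state in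
  \<open>L\<^sup>2(\<Omega>; C)\<close>.
\<close>

lemma L2L1_prog_mult_integrable:
  assumes \<phi>: "\<phi> \<in> L2L1_prog M F t' T" and le: "t' \<le> t"
    and Y [measurable]: "Y \<in> borel_measurable M" "integrable M (\<lambda>\<omega>. (Y \<omega>)\<^sup>2)"
  shows "integrable (M \<Otimes>\<^sub>M lborel) (\<lambda>x. Y (fst x) * norm (windowed t T \<phi> x))"
proof (rule integrableI_bounded)
  have [measurable]: "windowed t' T \<phi> \<in> borel_measurable (M \<Otimes>\<^sub>M lborel)"
    using \<phi> by (intro prog_measurable_windowed) (simp add: L2L1_prog_def)
  then have [measurable]: "windowed t T \<phi> \<in> borel_measurable (M \<Otimes>\<^sub>M lborel)"
    using le by (rule windowed_measurable_restrict)
  show "(\<lambda>x. Y (fst x) * norm (windowed t T \<phi> x)) \<in> borel_measurable (M \<Otimes>\<^sub>M lborel)" by measurable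
  let ?n = "\<lambda>\<omega>. \<integral>\<^sup>+s. ennreal (norm (windowed t' T \<phi> (\<omega>, s))) \<partial>lborel"
  have n: "?n \<omega> = (\<integral>\<^sup>+s\<in>{t'..T}. ennreal (norm (\<phi> s \<omega>)) \<partial>lborel)" for \<omega>
    by (intro nn_integral_cong) (auto simp: windowed_def indicator_def)
  have "(\<integral>\<^sup>+x. ennreal (norm (Y (fst x) * norm (windowed t T \<phi> x))) \<partial>(M \<Otimes>\<^sub>M lborel)) \<le>
      (\<integral>\<^sup>+x. ennreal \<bar>Y (fst x)\<bar> * ennreal (norm (windowed t' T \<phi> x)) \<partial>(M \<Otimes>\<^sub>M lborel))"
    by (intro nn_integral_mono)
       (auto simp: windowed_restrict[OF le] indicator_def abs_mult ennreal_mult)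
  also have "\<dots> = (\<integral>\<^sup>+\<omega>. (\<integral>\<^sup>+s. ennreal \<bar>Y \<omega>\<bar> * ennreal (norm (windowed t' T \<phi> (\<omega>, s))) \<partial>lborel) \<partial>M)"
    by (subst lborel.nn_integral_fst[symmetric]) auto
  also have "\<dots> = (\<integral>\<^sup>+\<omega>. ennreal \<bar>Y \<omega>\<bar> * ?n \<omega> \<partial>M)"
    by (intro nn_integral_cong nn_integral_cmult) measurable
  also have "\<dots> \<le> (\<integral>\<^sup>+\<omega>. (ennreal \<bar>Y \<omega>\<bar>)\<^sup>2 + (?n \<omega>)\<^sup>2 \<partial>M)"
    by (intro nn_integral_mono ennreal_mult_le_sum_squares)
  also have "\<dots> = (\<integral>\<^sup>+\<omega>. ennreal ((Y \<omega>)\<^sup>2) \<partial>M) + (\<integral>\<^sup>+\<omega>. (?n \<omega>)\<^sup>2 \<partial>M)"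
    by (subst nn_integral_add) (auto simp: ennreal_power)
  also have "\<dots> < \<infinity>"
    using \<phi> Y(2) by (simp add: n L2L1_prog_def nn_integral_eq_integral)
  finally show "(\<integral>\<^sup>+x. ennreal (norm (Y (fst x) * norm (windowed t T \<phi> x))) \<partial>(M \<Otimes>\<^sub>M lborel)) < \<infinity>" .
qed

lemma windowed_deterministic_measurable:
  "set_borel_measurable borel {t..T} f \<Longrightarrow> windowed t T (\<lambda>s \<omega>. f s) \<in> borel_measurable (M \<Otimes>\<^sub>M lborel)"
  by (intro prog_measurable_windowed prog_measurable_deterministic)

lemma windowed_integrable_sections:
  assumes "integrable (M \<Otimes>\<^sub>M lborel) (windowed t T f)"
  shows "AE \<omega> in M. set_integrable lborel {t..T} (\<lambda>s. f s \<omega>)"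
  using product.AE_integrable_fst'[OF assms] by (simp add: windowed_def set_integrable_def)

end

context slq begin

sublocale brownian_space M W
  by unfold_locales (rule brownian)

section \<open>The cost as an integral over the product space\<close>

definition running :: "(real \<Rightarrow> 'a \<Rightarrow> real^'n) \<Rightarrow> (real \<Rightarrow> 'a \<Rightarrow> real^'m) \<Rightarrow> real \<Rightarrow> 'a \<Rightarrow> real" where
  "running X u s \<omega> = (Q s *v X s \<omega>) \<bullet> X s \<omega> + 2 * ((S s *v X s \<omega>) \<bullet> u s \<omega>) + (R s *v u s \<omega>) \<bullet> u s \<omega> +
     2 * (q s \<omega> \<bullet> X s \<omega>) + 2 * (\<rho> s \<omega> \<bullet> u s \<omega>)"

definition terminal :: "(real \<Rightarrow> 'a \<Rightarrow> real^'n) \<Rightarrow> 'a \<Rightarrow> real" where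
  "terminal X \<omega> = (G *v X T \<omega>) \<bullet> X T \<omega> + 2 * (g \<omega> \<bullet> X T \<omega>)"

context
  fixes t :: real
  assumes t: "0 \<le> t" "t < T"
begin

lemma windowed_data_measurable:
  "windowed t T (\<lambda>s \<omega>. A s) \<in> borel_measurable (M \<Otimes>\<^sub>M lborel)"
  "windowed t T (\<lambda>s \<omega>. B s) \<in> borel_measurable (M \<Otimes>\<^sub>M lborel)"
  "windowed t T (\<lambda>s \<omega>. Q s) \<in> borel_measurable (M \<Otimes>\<^sub>M lborel)"
  "windowed t T (\<lambda>s \<omega>. S s) \<in> borel_measurable (M \<Otimes>\<^sub>M lborel)"
  "windowed t T (\<lambda>s \<omega>. R s) \<in> borel_measurable (M \<Otimes>\<^sub>M lborel)"
  "windowed t T b \<in> borel_measurable (M \<Otimes>\<^sub>M lborel)"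
  "windowed t T q \<in> borel_measurable (M \<Otimes>\<^sub>M lborel)"
  "windowed t T \<rho> \<in> borel_measurable (M \<Otimes>\<^sub>M lborel)"
proof -
  show "windowed t T (\<lambda>s \<omega>. A s) \<in> borel_measurable (M \<Otimes>\<^sub>M lborel)"
    "windowed t T (\<lambda>s \<omega>. B s) \<in> borel_measurable (M \<Otimes>\<^sub>M lborel)"
    "windowed t T (\<lambda>s \<omega>. Q s) \<in> borel_measurable (M \<Otimes>\<^sub>M lborel)"
    "windowed t T (\<lambda>s \<omega>. S s) \<in> borel_measurable (M \<Otimes>\<^sub>M lborel)"
    "windowed t T (\<lambda>s \<omega>. R s) \<in> borel_measurable (M \<Otimes>\<^sub>M lborel)"
    using A B Q(1) S R(1) t(1)
    by (auto simp: L_fun_def Linf_fun_def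
        intro!: windowed_measurable_restrict[of 0, OF windowed_deterministic_measurable])
  show "windowed t T b \<in> borel_measurable (M \<Otimes>\<^sub>M lborel)"
    "windowed t T q \<in> borel_measurable (M \<Otimes>\<^sub>M lborel)"
    "windowed t T \<rho> \<in> borel_measurable (M \<Otimes>\<^sub>M lborel)"
    using b q \<rho> t(1)
    by (auto simp: L2L1_prog_def L2_prog_def
        intro!: windowed_measurable_restrict[of 0, OF prog_measurable_windowed])
qed

lemma pair_dominated:
  assumes "X \<in> L2C_prog M F t T" "u \<in> controls t"
  obtains Y where "Y \<in> borel_measurable M" "\<And>\<omega>. 0 \<le> Y \<omega>" "integrable M (\<lambda>\<omega>. (Y \<omega>)\<^sup>2)" "integrable M Y"
    "AE \<omega> in M. \<forall>s\<in>{t..T}. norm (X s \<omega>) \<le> Y \<omega>"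
    "windowed t T X \<in> borel_measurable (M \<Otimes>\<^sub>M lborel)"
    "windowed t T u \<in> borel_measurable (M \<Otimes>\<^sub>M lborel)"
    "integrable (M \<Otimes>\<^sub>M lborel) (\<lambda>x. (norm (windowed t T u x))\<^sup>2)"
proof -
  obtain Y where Y: "Y \<in> borel_measurable M" "\<forall>\<omega>. 0 \<le> Y \<omega>" "integrable M (\<lambda>\<omega>. (Y \<omega>)\<^sup>2)"
    "AE \<omega> in M. \<forall>s\<in>{t..T}. norm (X s \<omega>) \<le> Y \<omega>"
    using L2C_prog_dominated[OF assms(1) t(2)] by blast
  show thesis
  proof (rule that[OF Y(1) _ Y(3) _ Y(4)])
    show "integrable M Y" by (rule square_integrable_imp_integrable[OF Y(1,3)])
    show "windowed t T X \<in> borel_measurable (M \<Otimes>\<^sub>M lborel)"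
      using assms(1) by (intro prog_measurable_windowed) (simp add: L2C_prog_def)
    show "windowed t T u \<in> borel_measurable (M \<Otimes>\<^sub>M lborel)"
      using assms(2) by (intro prog_measurable_windowed) (simp add: controls_def L2_prog_def)
    show "integrable (M \<Otimes>\<^sub>M lborel) (\<lambda>x. (norm (windowed t T u x))\<^sup>2)"
      using assms(2) by (intro L2_prog_windowed_square_integrable[of u t]) (simp_all add: controls_def)
  qed (use Y(2) in auto)
qed

lemma drift_integrable:
  assumes "X \<in> L2C_prog M F t T" "u \<in> controls t"
  shows "integrable (M \<Otimes>\<^sub>M lborel) (windowed t T (\<lambda>s \<omega>. A s *v X s \<omega> + B s *v u s \<omega> + b s \<omega>))"
proof -
  obtain Y where Y: "Y \<in> borel_measurable M" "\<And>\<omega>. 0 \<le> Y \<omega>" "integrable M (\<lambda>\<omega>. (Y \<omega>)\<^sup>2)" "integrable M Y"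
    "AE \<omega> in M. \<forall>s\<in>{t..T}. norm (X s \<omega>) \<le> Y \<omega>"
    and w: "windowed t T X \<in> borel_measurable (M \<Otimes>\<^sub>M lborel)"
    "windowed t T u \<in> borel_measurable (M \<Otimes>\<^sub>M lborel)"
    and u2: "integrable (M \<Otimes>\<^sub>M lborel) (\<lambda>x. (norm (windowed t T u x))\<^sup>2)"
    by (rule pair_dominated[OF assms]) (rule that)
  let ?\<alpha> = "\<lambda>s. indicator {t..T} s *\<^sub>R norm (A s)" and ?\<beta> = "\<lambda>s. indicator {t..T} s *\<^sub>R (norm (B s))\<^sup>2"
  have ab: "integrable lborel ?\<alpha>" "integrable lborel ?\<beta>"
    using L_fun_subset[OF A t(1)] L_fun_subset[OF B t(1)] by (simp_all add: L_fun_def set_integrable_def)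
  let ?h = "\<lambda>x. Y (fst x) * ?\<alpha> (snd x) + (1 * ?\<beta> (snd x) + (norm (windowed t T u x))\<^sup>2) + 1 * norm (windowed t T b x)"
  show ?thesis
  proof (rule integrable_windowedI[where h = ?h])
    show "windowed t T (\<lambda>s \<omega>. A s *v X s \<omega> + B s *v u s \<omega> + b s \<omega>) \<in> borel_measurable (M \<Otimes>\<^sub>M lborel)"
      by (intro windowed_measurable_add windowed_measurable_matrix_vector windowed_data_measurable w)
    show "integrable (M \<Otimes>\<^sub>M lborel) ?h"
      using integrable_product_mult[OF Y(4) ab(1)] integrable_product_mult[of "\<lambda>_. 1", OF _ ab(2)] u2
        L2L1_prog_mult_integrable[OF b t(1), of "\<lambda>_. 1"]
      by (intro Bochner_Integration.integrable_add) (simp_all add: case_prod_beta')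
    show "AE \<omega> in M. AE s in lborel. s \<in> {t..T} \<longrightarrow>
        norm (A s *v X s \<omega> + B s *v u s \<omega> + b s \<omega>) \<le> ?h (\<omega>, s)"
      using Y(5)
    proof eventually_elim
      case (elim \<omega>)
      show ?case
      proof (rule AE_I2, rule impI)
        fix s assume s: "s \<in> {t..T}"
        have "norm (A s *v X s \<omega>) \<le> norm (A s) * norm (X s \<omega>)" by (rule norm_matrix_vector_mult_le)
        also have "\<dots> \<le> norm (A s) * Y \<omega>" using elim s by (intro mult_left_mono) auto
        finally have 1: "norm (A s *v X s \<omega>) \<le> Y \<omega> * norm (A s)" by (simp add: mult.commute)
        have "norm (B s *v u s \<omega>) \<le> norm (B s) * norm (u s \<omega>)" by (rule norm_matrix_vector_mult_le)
        also have "\<dots> \<le> (norm (B s))\<^sup>2 + (norm (u s \<omega>))\<^sup>2"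
          using sum_squares_bound[of "norm (B s)" "norm (u s \<omega>)"]
            mult_nonneg_nonneg[OF norm_ge_zero[of "B s"] norm_ge_zero[of "u s \<omega>"]] by linarith
        finally have 2: "norm (B s *v u s \<omega>) \<le> (norm (B s))\<^sup>2 + (norm (u s \<omega>))\<^sup>2" .
        show "norm (A s *v X s \<omega> + B s *v u s \<omega> + b s \<omega>) \<le> ?h (\<omega>, s)"
          using 1 2 s by (auto simp: windowed_apply intro!: norm_triangle_le add_mono)
      qed
    qed
  qed
qed

text \<open>
  With \<open>Y\<close> the majorant of the state, the terms in \<open>Q\<close> and \<open>S\<close> are controlled by \<open>Y\<^sup>2\<close> times an integrable
  function of time, the term in \<open>q\<close> by the pairing of \<open>Y\<close> with \<open>q\<close>, and the others by squares of
  the control and of \<open>\<rho>\<close>.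
\<close>

lemma running_integrable:
  assumes "X \<in> L2C_prog M F t T" "u \<in> controls t"
  shows "integrable (M \<Otimes>\<^sub>M lborel) (windowed t T (running X u))"
proof -
  obtain Y where Y: "Y \<in> borel_measurable M" "\<And>\<omega>. 0 \<le> Y \<omega>" "integrable M (\<lambda>\<omega>. (Y \<omega>)\<^sup>2)" "integrable M Y"
    "AE \<omega> in M. \<forall>s\<in>{t..T}. norm (X s \<omega>) \<le> Y \<omega>"
    and w: "windowed t T X \<in> borel_measurable (M \<Otimes>\<^sub>M lborel)"
    "windowed t T u \<in> borel_measurable (M \<Otimes>\<^sub>M lborel)"
    and u2: "integrable (M \<Otimes>\<^sub>M lborel) (\<lambda>x. (norm (windowed t T u x))\<^sup>2)"
    by (rule pair_dominated[OF assms]) (rule that)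
  obtain K where K: "AE s in lborel. s \<in> {0..T} \<longrightarrow> norm (R s) \<le> K"
    using R(1) by (auto simp: Linf_fun_def)
  let ?\<alpha> = "\<lambda>s. indicator {t..T} s *\<^sub>R norm (Q s)" and ?\<beta> = "\<lambda>s. indicator {t..T} s *\<^sub>R (norm (S s))\<^sup>2"
  have ab: "integrable lborel ?\<alpha>" "integrable lborel ?\<beta>"
    using L_fun_subset[OF Q(1) t(1)] L_fun_subset[OF S t(1)] by (simp_all add: L_fun_def set_integrable_def)
  let ?u = "\<lambda>x. (norm (windowed t T u x))\<^sup>2"
  let ?h = "\<lambda>x. (Y (fst x))\<^sup>2 * ?\<alpha> (snd x) + ((Y (fst x))\<^sup>2 * ?\<beta> (snd x) + ?u x) + K * ?u x +
      2 * (Y (fst x) * norm (windowed t T q x)) + ((norm (windowed t T \<rho> x))\<^sup>2 + ?u x)"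
  show ?thesis
  proof (rule integrable_windowedI[where h = ?h])
    show "windowed t T (running X u) \<in> borel_measurable (M \<Otimes>\<^sub>M lborel)"
      unfolding running_def[abs_def]
      by (intro windowed_measurable_add windowed_measurable_cmult windowed_measurable_inner
          windowed_measurable_matrix_vector windowed_data_measurable w)
    show "integrable (M \<Otimes>\<^sub>M lborel) ?h"
      using integrable_product_mult[OF Y(3) ab(1)] integrable_product_mult[OF Y(3) ab(2)] u2
        L2L1_prog_mult_integrable[OF q t(1) Y(1,3)] L2_prog_windowed_square_integrable[OF \<rho> t(1)]
      by (intro Bochner_Integration.integrable_add integrable_mult_right) (simp_all add: case_prod_beta')
    show "AE \<omega> in M. AE s in lborel. s \<in> {t..T} \<longrightarrow> norm (running X u s \<omega>) \<le> ?h (\<omega>, s)"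
      using Y(5)
    proof eventually_elim
      case (elim \<omega>)
      show ?case
        using K
      proof eventually_elim
        case e2: (elim s)
        show ?case
        proof
          assume s: "s \<in> {t..T}"
          have XY: "norm (X s \<omega>) \<le> Y \<omega>" using elim s by auto
          have RK: "norm (R s) \<le> K" using e2 s t(1) by auto
          have xy: "2 * (x * y) \<le> x\<^sup>2 + y\<^sup>2" for x y :: real
            using sum_squares_bound[of x y] by simp
          have "\<bar>(Q s *v X s \<omega>) \<bullet> X s \<omega>\<bar> \<le> norm (Q s *v X s \<omega>) * norm (X s \<omega>)" by (rule Cauchy_Schwarz_ineq2)
          also have "\<dots> \<le> (norm (Q s) * norm (X s \<omega>)) * norm (X s \<omega>)"
            by (intro mult_right_mono norm_matrix_vector_mult_le) auto
          also have "\<dots> \<le> (norm (Q s) * Y \<omega>) * Y \<omega>" using XY Y(2)[of \<omega>] by (intro mult_mono) auto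
          finally have 1: "\<bar>(Q s *v X s \<omega>) \<bullet> X s \<omega>\<bar> \<le> (Y \<omega>)\<^sup>2 * norm (Q s)" by (simp add: power2_eq_square ac_simps)
          have "\<bar>(S s *v X s \<omega>) \<bullet> u s \<omega>\<bar> \<le> norm (S s *v X s \<omega>) * norm (u s \<omega>)" by (rule Cauchy_Schwarz_ineq2)
          also have "\<dots> \<le> (norm (S s) * norm (X s \<omega>)) * norm (u s \<omega>)"
            by (intro mult_right_mono norm_matrix_vector_mult_le) auto
          also have "\<dots> \<le> (norm (S s) * Y \<omega>) * norm (u s \<omega>)" using XY Y(2)[of \<omega>] by (intro mult_mono) auto
          finally have 2: "2 * \<bar>(S s *v X s \<omega>) \<bullet> u s \<omega>\<bar> \<le> (Y \<omega>)\<^sup>2 * (norm (S s))\<^sup>2 + (norm (u s \<omega>))\<^sup>2"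
            using xy[of "norm (S s) * Y \<omega>" "norm (u s \<omega>)"] by (simp add: power_mult_distrib mult.commute)
          have "\<bar>(R s *v u s \<omega>) \<bullet> u s \<omega>\<bar> \<le> norm (R s *v u s \<omega>) * norm (u s \<omega>)" by (rule Cauchy_Schwarz_ineq2)
          also have "\<dots> \<le> (norm (R s) * norm (u s \<omega>)) * norm (u s \<omega>)"
            by (intro mult_right_mono norm_matrix_vector_mult_le) auto
          also have "\<dots> \<le> (K * norm (u s \<omega>)) * norm (u s \<omega>)" using RK by (intro mult_right_mono) auto
          finally have 3: "\<bar>(R s *v u s \<omega>) \<bullet> u s \<omega>\<bar> \<le> K * (norm (u s \<omega>))\<^sup>2" by (simp add: power2_eq_square ac_simps)
          have "\<bar>q s \<omega> \<bullet> X s \<omega>\<bar> \<le> norm (q s \<omega>) * norm (X s \<omega>)" by (rule Cauchy_Schwarz_ineq2)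
          also have "\<dots> \<le> norm (q s \<omega>) * Y \<omega>" using XY by (intro mult_left_mono) auto
          finally have 4: "\<bar>q s \<omega> \<bullet> X s \<omega>\<bar> \<le> Y \<omega> * norm (q s \<omega>)" by (simp add: mult.commute)
          have 5: "2 * \<bar>\<rho> s \<omega> \<bullet> u s \<omega>\<bar> \<le> (norm (\<rho> s \<omega>))\<^sup>2 + (norm (u s \<omega>))\<^sup>2"
            using Cauchy_Schwarz_ineq2[of "\<rho> s \<omega>" "u s \<omega>"] xy[of "norm (\<rho> s \<omega>)" "norm (u s \<omega>)"] by linarith
          show "norm (running X u s \<omega>) \<le> ?h (\<omega>, s)"
            using 1 2 3 4 5 s unfolding running_def by (simp add: windowed_apply)
        qed
      qed
    qed
  qed
qed

lemma terminal_integrable: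
  assumes "X \<in> L2C_prog M F t T"
  shows "integrable M (terminal X)"
proof -
  obtain Y where Y: "integrable M (\<lambda>\<omega>. (Y \<omega>)\<^sup>2)" "AE \<omega> in M. \<forall>s\<in>{t..T}. norm (X s \<omega>) \<le> Y \<omega>"
    using L2C_prog_dominated[OF assms t(2)] by blast
  have X: "X T \<in> borel_measurable M"
    using assms t by (intro measurable_F_imp[OF prog_measurable_section]) (auto simp: L2C_prog_def)
  have g_meas: "g \<in> borel_measurable M" by (rule measurable_F_imp[OF g(1)])
  have "(\<lambda>\<omega>. G *v X T \<omega>) \<in> borel_measurable M"
    by (rule borel_measurable_continuous_on[OF _ X]) (simp add: matrix_vector_mult_def, intro continuous_intros)
  then have m: "terminal X \<in> borel_measurable M"
    unfolding terminal_def[abs_def] using X g_meas by measurable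
  show ?thesis
  proof (rule Bochner_Integration.integrable_bound[OF _ m])
    show "integrable M (\<lambda>\<omega>. norm G * (Y \<omega>)\<^sup>2 + ((norm (g \<omega>))\<^sup>2 + (Y \<omega>)\<^sup>2))"
      using Y(1) g(2) by auto
    show "AE \<omega> in M. norm (terminal X \<omega>) \<le> norm (norm G * (Y \<omega>)\<^sup>2 + ((norm (g \<omega>))\<^sup>2 + (Y \<omega>)\<^sup>2))"
      using Y(2)
    proof eventually_elim
      case (elim \<omega>)
      then have XY: "norm (X T \<omega>) \<le> Y \<omega>" using t by auto
      then have XY2: "(norm (X T \<omega>))\<^sup>2 \<le> (Y \<omega>)\<^sup>2" by (rule power_mono) simp
      have "\<bar>(G *v X T \<omega>) \<bullet> X T \<omega>\<bar> \<le> norm (G *v X T \<omega>) * norm (X T \<omega>)" by (rule Cauchy_Schwarz_ineq2)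
      also have "\<dots> \<le> (norm G * norm (X T \<omega>)) * norm (X T \<omega>)"
        by (intro mult_right_mono norm_matrix_vector_mult_le) auto
      also have "\<dots> = norm G * (norm (X T \<omega>))\<^sup>2" by (simp add: power2_eq_square)
      also have "\<dots> \<le> norm G * (Y \<omega>)\<^sup>2" using XY2 by (rule mult_left_mono) simp
      finally have 1: "\<bar>(G *v X T \<omega>) \<bullet> X T \<omega>\<bar> \<le> norm G * (Y \<omega>)\<^sup>2" .
      have 2: "2 * \<bar>g \<omega> \<bullet> X T \<omega>\<bar> \<le> (norm (g \<omega>))\<^sup>2 + (Y \<omega>)\<^sup>2"
        using Cauchy_Schwarz_ineq2[of "g \<omega>" "X T \<omega>"] sum_squares_bound[of "norm (g \<omega>)" "norm (X T \<omega>)"] XY2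
        by linarith
      show ?case using 1 2 unfolding terminal_def by simp
    qed
  qed
qed

text \<open>
  In this form the cost is visibly a sum of two integrals of expressions of degree at most two in state
  and control.
\<close>

lemma cost_eq_integrals:
  assumes "X \<in> L2C_prog M F t T" "u \<in> controls t"
  shows "cost t X u = expectation (terminal X) + integral\<^sup>L (M \<Otimes>\<^sub>M lborel) (windowed t T (running X u))"
proof -
  let ?w = "windowed t T (running X u)"
  have "cost t X u = expectation (\<lambda>\<omega>. terminal X \<omega> + (LINT s|lborel. ?w (\<omega>, s)))"
    by (simp add: cost_def terminal_def running_def windowed_def set_lebesgue_integral_def)
  also have "\<dots> = expectation (terminal X) + expectation (\<lambda>\<omega>. LINT s|lborel. ?w (\<omega>, s))"
    by (intro Bochner_Integration.integral_add terminal_integrable[OF assms(1)]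
        product.integrable_fst'[OF running_integrable[OF assms]])
  also have "expectation (\<lambda>\<omega>. LINT s|lborel. ?w (\<omega>, s)) = integral\<^sup>L (M \<Otimes>\<^sub>M lborel) ?w"
    by (rule product.integral_fst'[OF running_integrable[OF assms]])
  finally show ?thesis .
qed

lemma cost_cong:
  assumes X: "X \<in> L2C_prog M F t T" "X' \<in> L2C_prog M F t T" and u: "u \<in> controls t"
    and eq: "AE \<omega> in M. \<forall>s\<in>{t..T}. X s \<omega> = X' s \<omega>"
  shows "cost t X u = cost t X' u"
proof -
  have m: "(\<lambda>\<omega>. terminal X \<omega> + (LINT s|lborel. windowed t T (running X u) (\<omega>, s))) \<in> borel_measurable M"
    if "X \<in> L2C_prog M F t T" for X
    using terminal_integrable[OF that] product.integrable_fst'[OF running_integrable[OF that u]]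
    by (intro borel_measurable_add borel_measurable_integrable)
  have c: "cost t X u = expectation (\<lambda>\<omega>. terminal X \<omega> + (LINT s|lborel. windowed t T (running X u) (\<omega>, s)))" for X
    by (simp add: cost_def terminal_def running_def windowed_def set_lebesgue_integral_def)
  show ?thesis
    unfolding c
  proof (rule integral_cong_AE[OF m[OF X(1)] m[OF X(2)]], use eq in eventually_elim)
    case (elim \<omega>)
    have "windowed t T (running X u) (\<omega>, s) = windowed t T (running X' u) (\<omega>, s)" for s
      using elim by (auto simp: windowed_def running_def indicator_def)
    moreover have "X T \<omega> = X' T \<omega>" using elim t by auto
    ultimately show ?case by (simp add: terminal_def)
  qed
qed

section \<open>Superposition and uniqueness of states\<close>

lemma state_L2C: "state t x u X \<Longrightarrow> X \<in> L2C_prog M F t T"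
  by (simp add: state_def sde_solution_def)

lemma controls_lincomb:
  "u \<in> controls t \<Longrightarrow> u' \<in> controls t \<Longrightarrow> (\<lambda>s \<omega>. a *\<^sub>R u s \<omega> + c *\<^sub>R u' s \<omega>) \<in> controls t"
  unfolding controls_def by (rule L2_prog_lincomb)

text \<open>
  The control and the inhomogeneities cancel in the difference of two states, which therefore solves
  the homogeneous linear equation with initial value zero. Vanishing at each rational time almost surely
  extends to all times by continuity.
\<close>

lemma state_unique:
  assumes "state t x u X" "state t x u X'" and u: "u \<in> controls t"
  shows "AE \<omega> in M. \<forall>s\<in>{t..T}. X s \<omega> = X' s \<omega>"
proof -
  let ?Z = "\<lambda>s \<omega>. 1 *\<^sub>R X s \<omega> + (-1) *\<^sub>R X' s \<omega>"
  note XL = state_L2C[OF assms(1)] state_L2C[OF assms(2)]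
  have "sde_solution M W t T (1 *\<^sub>R x + (-1) *\<^sub>R x)
      (\<lambda>s \<omega>. 1 *\<^sub>R (A s *v X s \<omega> + B s *v u s \<omega> + b s \<omega>) + (-1) *\<^sub>R (A s *v X' s \<omega> + B s *v u s \<omega> + b s \<omega>))
      (\<lambda>s \<omega>. 1 *\<^sub>R (C s *v X s \<omega> + D s *v u s \<omega> + \<sigma> s \<omega>) + (-1) *\<^sub>R (C s *v X' s \<omega> + D s *v u s \<omega> + \<sigma> s \<omega>)) ?Z"
    using assms(1,2) unfolding state_def
    by (intro sde_solution_lincomb t windowed_integrable_sections drift_integrable XL u)
  moreover have "(\<lambda>s \<omega>. 1 *\<^sub>R (A s *v X s \<omega> + B s *v u s \<omega> + b s \<omega>) + (-1) *\<^sub>R (A s *v X' s \<omega> + B s *v u s \<omega> + b s \<omega>))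
      = (\<lambda>s \<omega>. A s *v ?Z s \<omega>)"
    "(\<lambda>s \<omega>. 1 *\<^sub>R (C s *v X s \<omega> + D s *v u s \<omega> + \<sigma> s \<omega>) + (-1) *\<^sub>R (C s *v X' s \<omega> + D s *v u s \<omega> + \<sigma> s \<omega>))
      = (\<lambda>s \<omega>. C s *v ?Z s \<omega>)"
    by (simp_all add: fun_eq_iff matrix_vector_mult_diff_distrib)
  ultimately have Z: "sde_solution M W t T 0 (\<lambda>s \<omega>. A s *v ?Z s \<omega>) (\<lambda>s \<omega>. C s *v ?Z s \<omega>) ?Z"
    by simp
  have "AE \<omega> in M. ?Z s \<omega> = 0" if "s \<in> {t..T}" for s
    by (rule linear_sde_zero[OF t L_fun_subset[OF A t(1)] L_fun_subset[OF C t(1)] Z that])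
  then have "AE \<omega> in M. \<forall>s\<in>{t<..<T} \<inter> \<rat>. ?Z s \<omega> = 0"
    by (subst AE_ball_countable) (auto intro: countable_Int2 countable_rat)
  moreover have "AE \<omega> in M. continuous_on {t..T} (\<lambda>s. ?Z s \<omega>)"
    using L2C_prog_lincomb[OF XL t(2), of 1 "-1"] by (simp add: L2C_prog_def)
  ultimately show ?thesis
  proof eventually_elim
    case (elim \<omega>)
    show ?case
    proof
      fix s assume s: "s \<in> {t..T}"
      have "norm (?Z s \<omega>) \<le> 0"
        by (rule continuous_on_closure_norm_le[of "{t<..<T} \<inter> \<rat>"])
           (use elim s closure_rationals_Ioo[OF t(2)] in auto)
      then show "X s \<omega> = X' s \<omega>" by simp
    qed
  qed
qed

lemma J_eq_cost:
  assumes "state t x u X" "u \<in> controls t"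
  shows "J t x u = ereal (cost t X u)"
proof -
  have s: "state t x u (SOME X. state t x u X)" by (rule someI[of "state t x u", OF assms(1)])
  have "cost t (SOME X. state t x u X) u = cost t X u"
    by (rule cost_cong[OF state_L2C[OF s] state_L2C[OF assms(1)] assms(2) state_unique[OF s assms]])
  then show ?thesis using assms(1) by (auto simp: J_def)
qed

text \<open>
  Linear combinations solve the equation with the inhomogeneities \<open>b\<close> and \<open>\<sigma>\<close> multiplied by
  \<open>a + c\<close>, whence the condition on the coefficients.
\<close>

lemma state_affine:
  assumes "state t x u X" "u \<in> controls t" "state t x' u' X'" "u' \<in> controls t" and ac: "a + c = 1"
  shows "state t (a *\<^sub>R x + c *\<^sub>R x') (\<lambda>s \<omega>. a *\<^sub>R u s \<omega> + c *\<^sub>R u' s \<omega>) (\<lambda>s \<omega>. a *\<^sub>R X s \<omega> + c *\<^sub>R X' s \<omega>)"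
proof -
  have aff: "a *\<^sub>R z + c *\<^sub>R z = z" for z :: "real^'n"
    using ac by (simp flip: scaleR_left_distrib)
  have comb: "a *\<^sub>R (N1 *v x1 + N2 *v v1 + z) + c *\<^sub>R (N1 *v x2 + N2 *v v2 + z) =
      N1 *v (a *\<^sub>R x1 + c *\<^sub>R x2) + N2 *v (a *\<^sub>R v1 + c *\<^sub>R v2) + z"
    for N1 :: "real^'n^'n" and N2 :: "real^'m^'n" and x1 x2 v1 v2 z
  proof -
    have "a *\<^sub>R (N1 *v x1 + N2 *v v1 + z) + c *\<^sub>R (N1 *v x2 + N2 *v v2 + z) =
       N1 *v (a *\<^sub>R x1 + c *\<^sub>R x2) + N2 *v (a *\<^sub>R v1 + c *\<^sub>R v2) + (a *\<^sub>R z + c *\<^sub>R z)"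
      by (simp add: matrix_vector_right_distrib matrix_vector_mult_scaleR scaleR_add_right)
    then show ?thesis by (simp add: aff)
  qed
  have "sde_solution M W t T (a *\<^sub>R x + c *\<^sub>R x')
      (\<lambda>s \<omega>. a *\<^sub>R (A s *v X s \<omega> + B s *v u s \<omega> + b s \<omega>) + c *\<^sub>R (A s *v X' s \<omega> + B s *v u' s \<omega> + b s \<omega>))
      (\<lambda>s \<omega>. a *\<^sub>R (C s *v X s \<omega> + D s *v u s \<omega> + \<sigma> s \<omega>) + c *\<^sub>R (C s *v X' s \<omega> + D s *v u' s \<omega> + \<sigma> s \<omega>))
      (\<lambda>s \<omega>. a *\<^sub>R X s \<omega> + c *\<^sub>R X' s \<omega>)"
    using assms(1,3) state_L2C[OF assms(1)] state_L2C[OF assms(3)] assms(2,4) unfolding state_def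
    by (intro sde_solution_lincomb t windowed_integrable_sections drift_integrable)
  then show ?thesis unfolding state_def comb .
qed

lemma controls_translate:
  assumes "u0 \<in> controls t" "u1 \<in> controls t" "up \<in> controls t"
  shows "(\<lambda>s \<omega>. up s \<omega> + u1 s \<omega> - u0 s \<omega>) \<in> controls t"
  using controls_lincomb[OF controls_lincomb[OF assms(3,2), of "1/2" "1/2"] assms(1), of 2 "-1"]
  by (simp add: scaleR_add_right)

text \<open>
  A translate is the affine combination \<open>2 m - z\<^sub>0\<close>, where \<open>m\<close> is the midpoint of \<open>z\<^sub>p\<close> and \<open>z\<^sub>1\<close>.
\<close>

lemma state_translate:
  assumes "state t x u0 X0" "u0 \<in> controls t" "state t x u1 X1" "u1 \<in> controls t"
    "state t y up Xp" "up \<in> controls t"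
  shows "state t y (\<lambda>s \<omega>. up s \<omega> + u1 s \<omega> - u0 s \<omega>) (\<lambda>s \<omega>. Xp s \<omega> + X1 s \<omega> - X0 s \<omega>)"
  using state_affine[OF state_affine[OF assms(5,6,3,4), of "1/2" "1/2"]
      controls_lincomb[OF assms(6,4)] assms(1,2), of 2 "-1"]
  by (simp add: scaleR_add_right)

text \<open>
  On the left is the second difference of the cost at the midpoint of the segment from \<open>(X0, u0)\<close> to \<open>(X1, u1)\<close>,
  on the right the one at \<open>(Xp, up)\<close> with the full step. Terminal and running cost are sums of linear forms
  and of bilinear forms, for which the identity holds pointwise; integration preserves it.
\<close>

lemma cost_second_difference:
  assumes X: "X0 \<in> L2C_prog M F t T" "X1 \<in> L2C_prog M F t T" "Xp \<in> L2C_prog M F t T"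
    and u: "u0 \<in> controls t" "u1 \<in> controls t" "up \<in> controls t"
  shows "4 * (cost t X1 u1 + cost t X0 u0 - 2 * cost t (\<lambda>s \<omega>. (1/2) *\<^sub>R X0 s \<omega> + (1/2) *\<^sub>R X1 s \<omega>)
      (\<lambda>s \<omega>. (1/2) *\<^sub>R u0 s \<omega> + (1/2) *\<^sub>R u1 s \<omega>)) =
    cost t (\<lambda>s \<omega>. Xp s \<omega> + X1 s \<omega> - X0 s \<omega>) (\<lambda>s \<omega>. up s \<omega> + u1 s \<omega> - u0 s \<omega>) +
    cost t (\<lambda>s \<omega>. Xp s \<omega> + X0 s \<omega> - X1 s \<omega>) (\<lambda>s \<omega>. up s \<omega> + u0 s \<omega> - u1 s \<omega>) - 2 * cost t Xp up"
proof -
  let ?Xm = "\<lambda>s \<omega>. (1/2) *\<^sub>R X0 s \<omega> + (1/2) *\<^sub>R X1 s \<omega>" and ?um = "\<lambda>s \<omega>. (1/2) *\<^sub>R u0 s \<omega> + (1/2) *\<^sub>R u1 s \<omega>"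
  let ?Xa = "\<lambda>s \<omega>. Xp s \<omega> + X1 s \<omega> - X0 s \<omega>" and ?ua = "\<lambda>s \<omega>. up s \<omega> + u1 s \<omega> - u0 s \<omega>"
  let ?Xb = "\<lambda>s \<omega>. Xp s \<omega> + X0 s \<omega> - X1 s \<omega>" and ?ub = "\<lambda>s \<omega>. up s \<omega> + u0 s \<omega> - u1 s \<omega>"
  have XL: "?Xm \<in> L2C_prog M F t T" "?Xa \<in> L2C_prog M F t T" "?Xb \<in> L2C_prog M F t T"
    using L2C_prog_lincomb[OF X(1,2) t(2), of "1/2" "1/2"]
      L2C_prog_lincomb[OF L2C_prog_lincomb[OF X(3,2) t(2), of 1 1] X(1) t(2), of 1 "-1"]
      L2C_prog_lincomb[OF L2C_prog_lincomb[OF X(3,1) t(2), of 1 1] X(2) t(2), of 1 "-1"] by simp_all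
  have uL: "?um \<in> controls t" "?ua \<in> controls t" "?ub \<in> controls t"
    using controls_lincomb[OF u(1,2)] controls_translate[OF u] controls_translate[OF u(2,1,3)] by auto
  have bil: "bounded_bilinear (\<lambda>x y. (N *v x) \<bullet> y)" for N :: "real^'k^'l"
    by (rule bounded_bilinear.comp1[OF bounded_bilinear_inner matrix_vector_mul_bounded_linear])
  have quad: "4 * ((N *v x1) \<bullet> y1 + (N *v x0) \<bullet> y0 - 2 * ((N *v ((1/2) *\<^sub>R x0 + (1/2) *\<^sub>R x1)) \<bullet> ((1/2) *\<^sub>R y0 + (1/2) *\<^sub>R y1))) =
    (N *v (p + x1 - x0)) \<bullet> (r + y1 - y0) + (N *v (p + x0 - x1)) \<bullet> (r + y0 - y1) - 2 * ((N *v p) \<bullet> r)"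
    for N :: "real^'k^'l" and x0 x1 p y0 y1 r
    using bounded_bilinear.second_difference_invariant[OF bil, of N x1 y1 x0 y0 p r] by simp
  have lin: "4 * (z \<bullet> x1 + z \<bullet> x0 - 2 * (z \<bullet> ((1/2) *\<^sub>R x0 + (1/2) *\<^sub>R x1))) =
      z \<bullet> (p + x1 - x0) + z \<bullet> (p + x0 - x1) - 2 * (z \<bullet> p)" for z x1 x0 p :: "real^'k"
    by (simp add: inner_add_right inner_diff_right)
  have term_eq: "4 * (terminal X1 \<omega> + terminal X0 \<omega> - 2 * terminal ?Xm \<omega>) =
      terminal ?Xa \<omega> + terminal ?Xb \<omega> - 2 * terminal Xp \<omega>" for \<omega>
    using quad[of G "X1 T \<omega>" "X1 T \<omega>" "X0 T \<omega>" "X0 T \<omega>" "Xp T \<omega>" "Xp T \<omega>"] lin[of "g \<omega>" "X1 T \<omega>" "X0 T \<omega>" "Xp T \<omega>"]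
    unfolding terminal_def by argo
  have run: "4 * (running X1 u1 s \<omega> + running X0 u0 s \<omega> - 2 * running ?Xm ?um s \<omega>) =
      running ?Xa ?ua s \<omega> + running ?Xb ?ub s \<omega> - 2 * running Xp up s \<omega>" for s \<omega>
    using quad[of "Q s" "X1 s \<omega>" "X1 s \<omega>" "X0 s \<omega>" "X0 s \<omega>" "Xp s \<omega>" "Xp s \<omega>"]
      quad[of "S s" "X1 s \<omega>" "u1 s \<omega>" "X0 s \<omega>" "u0 s \<omega>" "Xp s \<omega>" "up s \<omega>"]
      quad[of "R s" "u1 s \<omega>" "u1 s \<omega>" "u0 s \<omega>" "u0 s \<omega>" "up s \<omega>" "up s \<omega>"]
      lin[of "q s \<omega>" "X1 s \<omega>" "X0 s \<omega>" "Xp s \<omega>"] lin[of "\<rho> s \<omega>" "u1 s \<omega>" "u0 s \<omega>" "up s \<omega>"]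
    unfolding running_def by argo
  let ?w = "\<lambda>X u. windowed t T (running X u)"
  have wrun: "4 * (?w X1 u1 x + ?w X0 u0 x - 2 * ?w ?Xm ?um x) = ?w ?Xa ?ua x + ?w ?Xb ?ub x - 2 * ?w Xp up x" for x
    using run[of "snd x" "fst x"] by (cases "snd x \<in> {t..T}") (simp_all add: windowed_def case_prod_beta')
  note ti = terminal_integrable[OF X(1)] terminal_integrable[OF X(2)] terminal_integrable[OF X(3)]
    terminal_integrable[OF XL(1)] terminal_integrable[OF XL(2)] terminal_integrable[OF XL(3)]
  note ri = running_integrable[OF X(1) u(1)] running_integrable[OF X(2) u(2)] running_integrable[OF X(3) u(3)]
    running_integrable[OF XL(1) uL(1)] running_integrable[OF XL(2) uL(2)] running_integrable[OF XL(3) uL(3)]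
  have et: "4 * (expectation (terminal X1) + expectation (terminal X0) - 2 * expectation (terminal ?Xm)) =
      expectation (terminal ?Xa) + expectation (terminal ?Xb) - 2 * expectation (terminal Xp)"
  proof -
    have "expectation (\<lambda>\<omega>. 4 * (terminal X1 \<omega> + terminal X0 \<omega> - 2 * terminal ?Xm \<omega>)) =
        expectation (\<lambda>\<omega>. terminal ?Xa \<omega> + terminal ?Xb \<omega> - 2 * terminal Xp \<omega>)"
      by (simp only: term_eq)
    then show ?thesis using ti by simp
  qed
  have er: "4 * (integral\<^sup>L (M \<Otimes>\<^sub>M lborel) (?w X1 u1) + integral\<^sup>L (M \<Otimes>\<^sub>M lborel) (?w X0 u0) -
        2 * integral\<^sup>L (M \<Otimes>\<^sub>M lborel) (?w ?Xm ?um)) =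
      integral\<^sup>L (M \<Otimes>\<^sub>M lborel) (?w ?Xa ?ua) + integral\<^sup>L (M \<Otimes>\<^sub>M lborel) (?w ?Xb ?ub) -
        2 * integral\<^sup>L (M \<Otimes>\<^sub>M lborel) (?w Xp up)"
  proof -
    have "integral\<^sup>L (M \<Otimes>\<^sub>M lborel) (\<lambda>x. 4 * (?w X1 u1 x + ?w X0 u0 x - 2 * ?w ?Xm ?um x)) =
        integral\<^sup>L (M \<Otimes>\<^sub>M lborel) (\<lambda>x. ?w ?Xa ?ua x + ?w ?Xb ?ub x - 2 * ?w Xp up x)"
      by (simp only: wrun)
    then show ?thesis using ri by simp
  qed
  show ?thesis
    using et er
    unfolding cost_eq_integrals[OF X(1) u(1)] cost_eq_integrals[OF X(2) u(2)] cost_eq_integrals[OF X(3) u(3)]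
      cost_eq_integrals[OF XL(1) uL(1)] cost_eq_integrals[OF XL(2) uL(2)] cost_eq_integrals[OF XL(3) uL(3)]
    by argo
qed

section \<open>Optimal controls\<close>

lemma open_loop_optimal_iff:
  "open_loop_optimal t x u \<longleftrightarrow> u \<in> controls t \<and> (\<forall>u'\<in>controls t. J t x u \<le> J t x u')"
proof
  assume "open_loop_optimal t x u"
  then show "u \<in> controls t \<and> (\<forall>u'\<in>controls t. J t x u \<le> J t x u')"
    by (auto simp: open_loop_optimal_def intro: INF_lower)
next
  assume "u \<in> controls t \<and> (\<forall>u'\<in>controls t. J t x u \<le> J t x u')"
  then show "open_loop_optimal t x u"
    by (auto simp: open_loop_optimal_def intro!: antisym INF_greatest INF_lower)
qed

text \<open>
  Since \<open>u0\<close> and \<open>u1\<close> are both minimal at \<open>x\<close>, their midpoint is no better, so the second difference of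
  the cost along \<open>u1 - u0\<close> is at most zero. At \<open>y\<close>, minimality of \<open>up\<close> against the backward step
  \<open>up - (u1 - u0)\<close> then leaves for the forward step a cost of at most that of \<open>up\<close>.
\<close>

lemma open_loop_optimal_translate:
  assumes 0: "open_loop_optimal t x u0" "state t x u0 X0"
    and 1: "open_loop_optimal t x u1" "state t x u1 X1"
    and p: "open_loop_optimal t y up" "state t y up Xp"
  shows "open_loop_optimal t y (\<lambda>s \<omega>. up s \<omega> + u1 s \<omega> - u0 s \<omega>)"
proof -
  note u = 0(1)[unfolded open_loop_optimal_iff, THEN conjunct1] 1(1)[unfolded open_loop_optimal_iff, THEN conjunct1]
    p(1)[unfolded open_loop_optimal_iff, THEN conjunct1]
  have min: "cost t X u \<le> cost t X' u'"
    if "open_loop_optimal t x u" "state t x u X" "state t x u' X'" "u' \<in> controls t" for x u X u' X'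
    using that J_eq_cost[of x u X] J_eq_cost[of x u' X'] by (auto simp: open_loop_optimal_iff)
  let ?ua = "\<lambda>s \<omega>. up s \<omega> + u1 s \<omega> - u0 s \<omega>" and ?Xa = "\<lambda>s \<omega>. Xp s \<omega> + X1 s \<omega> - X0 s \<omega>"
  let ?ub = "\<lambda>s \<omega>. up s \<omega> + u0 s \<omega> - u1 s \<omega>" and ?Xb = "\<lambda>s \<omega>. Xp s \<omega> + X0 s \<omega> - X1 s \<omega>"
  let ?um = "\<lambda>s \<omega>. (1/2) *\<^sub>R u0 s \<omega> + (1/2) *\<^sub>R u1 s \<omega>" and ?Xm = "\<lambda>s \<omega>. (1/2) *\<^sub>R X0 s \<omega> + (1/2) *\<^sub>R X1 s \<omega>"
  have ua: "?ua \<in> controls t" and ub: "?ub \<in> controls t" and um: "?um \<in> controls t"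
    using controls_translate[OF u] controls_translate[OF u(2,1,3)] controls_lincomb[OF u(1,2)] by auto
  have Xa: "state t y ?ua ?Xa" by (rule state_translate[OF 0(2) u(1) 1(2) u(2) p(2) u(3)])
  have Xb: "state t y ?ub ?Xb" by (rule state_translate[OF 1(2) u(2) 0(2) u(1) p(2) u(3)])
  have Xm: "state t x ?um ?Xm"
    using state_affine[OF 0(2) u(1) 1(2) u(2), of "1/2" "1/2"] by (simp flip: scaleR_left_distrib)
  have "cost t ?Xa ?ua \<le> cost t Xp up"
    using cost_second_difference[OF state_L2C[OF 0(2)] state_L2C[OF 1(2)] state_L2C[OF p(2)] u]
      min[OF 0 Xm um] min[OF 1 Xm um] min[OF p Xb ub] by argo
  then have "J t y ?ua \<le> J t y up"
    by (simp add: J_eq_cost[OF Xa ua] J_eq_cost[OF p(2) u(3)])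
  with p(1) ua show ?thesis
    unfolding open_loop_optimal_iff by (blast intro: order_trans)
qed

text \<open>
  Closing the loop with \<open>\<Theta>\<close> and \<open>v\<close> is the same as running the open-loop equation with the outcome as control, by
  distributivity alone.
\<close>

lemma closed_loop_state_iff: "closed_loop_state t x \<Theta> v X \<longleftrightarrow> state t x (outcome \<Theta> v X) X"
proof -
  have "(N1 + N2 ** \<Theta> s) *v X s \<omega> + N2 *v v s \<omega> = N1 *v X s \<omega> + N2 *v (\<Theta> s *v X s \<omega> + v s \<omega>)"
    for N1 :: "real^'n^'n" and N2 :: "real^'m^'n" and s \<omega>
    by (simp add: matrix_vector_mult_add_rdistrib matrix_vector_right_distrib matrix_vector_mul_assoc)
  then show ?thesis by (simp add: closed_loop_state_def state_def outcome_def)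
qed

text \<open>
  A gain is only square integrable in time, but the majorant of the state does not depend on time, so
  the energy of the product factorises.
\<close>

lemma feedback_controls:
  assumes \<Theta>: "\<Theta> \<in> feedback_gains t" and X: "X \<in> L2C_prog M F t T"
  shows "(\<lambda>s \<omega>. \<Theta> s *v X s \<omega>) \<in> controls t"
proof -
  have p: "prog_measurable F t T (\<lambda>s \<omega>. \<Theta> s *v X s \<omega>)"
    using assms by (intro prog_measurable_matrix_vector) (auto simp: feedback_gains_def L_fun_def L2C_prog_def)
  then have wm: "windowed t T (\<lambda>s \<omega>. \<Theta> s *v X s \<omega>) \<in> borel_measurable (M \<Otimes>\<^sub>M lborel)"
    by (rule prog_measurable_windowed)
  obtain Y where Y: "\<forall>\<omega>. 0 \<le> Y \<omega>" "integrable M (\<lambda>\<omega>. (Y \<omega>)\<^sup>2)" "AE \<omega> in M. \<forall>s\<in>{t..T}. norm (X s \<omega>) \<le> Y \<omega>"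
    using L2C_prog_dominated[OF X t(2)] by blast
  let ?\<theta> = "\<lambda>s. indicator {t..T} s *\<^sub>R (norm (\<Theta> s))\<^sup>2"
  have \<theta>: "integrable lborel ?\<theta>"
    using \<Theta> by (simp add: feedback_gains_def L_fun_def set_integrable_def)
  have "energy t T (\<lambda>s \<omega>. \<Theta> s *v X s \<omega>) \<le> (\<integral>\<^sup>+\<omega>. (\<integral>\<^sup>+s. ennreal ((Y \<omega>)\<^sup>2 * ?\<theta> s) \<partial>lborel) \<partial>M)"
    unfolding energy_def
  proof (rule nn_integral_mono_AE, use Y(3) in eventually_elim, rule nn_integral_mono)
    fix \<omega> s assume dom: "\<forall>s\<in>{t..T}. norm (X s \<omega>) \<le> Y \<omega>"
    show "ennreal ((norm (\<Theta> s *v X s \<omega>))\<^sup>2) * indicator {t..T} s \<le> ennreal ((Y \<omega>)\<^sup>2 * ?\<theta> s)"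
    proof (cases "s \<in> {t..T}")
      case True
      have "norm (\<Theta> s *v X s \<omega>) \<le> norm (\<Theta> s) * norm (X s \<omega>)" by (rule norm_matrix_vector_mult_le)
      also have "\<dots> \<le> norm (\<Theta> s) * Y \<omega>" using dom True by (intro mult_left_mono) auto
      finally have "(norm (\<Theta> s *v X s \<omega>))\<^sup>2 \<le> (norm (\<Theta> s) * Y \<omega>)\<^sup>2" by (rule power_mono) simp
      then show ?thesis using True by (simp add: power_mult_distrib mult.commute ennreal_leI)
    qed simp
  qed
  also have "\<dots> = (\<integral>\<^sup>+x. ennreal (norm ((\<lambda>(\<omega>, s). (Y \<omega>)\<^sup>2 * ?\<theta> s) x)) \<partial>(M \<Otimes>\<^sub>M lborel))"
    using integrable_product_mult[OF Y(2) \<theta>]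
    by (subst lborel.nn_integral_fst[symmetric]) (auto dest: borel_measurable_integrable)
  also have "\<dots> < \<infinity>"
    using integrable_product_mult[OF Y(2) \<theta>] by (simp add: integrable_iff_bounded)
  finally show ?thesis using p by (simp add: controls_def L2_prog_iff)
qed

text \<open>
  With \<open>v = u - \<Theta> X\<close>, the outcome of \<open>(\<Theta>, v)\<close> from \<open>y\<close> is the representing outcome from \<open>y\<close> translated by
  the difference of \<open>u\<close> and the representing outcome from \<open>x\<close>.
\<close>

lemma optimal_control_is_outcome:
  assumes rep: "closed_loop_representation t" and u: "open_loop_optimal t x u"
  shows "\<exists>\<Theta> v X. closed_loop_optimal t \<Theta> v \<and> closed_loop_state t x \<Theta> v X \<and> u = outcome \<Theta> v X"
proof -
  obtain \<Theta> v0 where \<Theta>: "\<Theta> \<in> feedback_gains t" and v0: "v0 \<in> controls t"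
    and opt: "\<And>x. \<exists>X. closed_loop_state t x \<Theta> v0 X \<and> open_loop_optimal t x (outcome \<Theta> v0 X)"
    using rep by (auto simp: closed_loop_representation_def)
  from opt obtain X0 where X0: "\<And>x. state t x (outcome \<Theta> v0 (X0 x)) (X0 x)"
    "\<And>x. open_loop_optimal t x (outcome \<Theta> v0 (X0 x))"
    unfolding closed_loop_state_iff by metis
  have uc: "u \<in> controls t" using u by (simp add: open_loop_optimal_iff)
  \<comment> \<open>A control without a state has infinite cost; comparison with the representing outcome rules this out.\<close>
  have "J t x u \<le> J t x (outcome \<Theta> v0 (X0 x))"
    using u X0(2)[of x] by (auto simp: open_loop_optimal_iff)
  also have "\<dots> < \<infinity>"
    using X0(1)[of x] X0(2)[of x] by (simp add: J_eq_cost open_loop_optimal_iff)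
  finally obtain X where X: "state t x u X" by (auto simp: J_def split: if_splits)
  define v where "v = (\<lambda>s \<omega>. u s \<omega> - \<Theta> s *v X s \<omega>)"
  have u_eq: "u = outcome \<Theta> v X" by (simp add: outcome_def v_def)
  have v: "v \<in> controls t"
    using controls_lincomb[OF uc feedback_controls[OF \<Theta> state_L2C[OF X]], of 1 "-1"] by (simp add: v_def)
  have outcomes: "\<exists>X'. closed_loop_state t y \<Theta> v X' \<and> open_loop_optimal t y (outcome \<Theta> v X')" for y
  proof -
    let ?X = "\<lambda>s \<omega>. X0 y s \<omega> + X s \<omega> - X0 x s \<omega>"
    have eq: "(\<lambda>s \<omega>. outcome \<Theta> v0 (X0 y) s \<omega> + u s \<omega> - outcome \<Theta> v0 (X0 x) s \<omega>) = outcome \<Theta> v ?X"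
      by (simp add: fun_eq_iff outcome_def v_def matrix_vector_right_distrib matrix_vector_mult_diff_distrib)
    have c: "outcome \<Theta> v0 (X0 z) \<in> controls t" for z using X0(2)[of z] by (simp add: open_loop_optimal_iff)
    show ?thesis
      using state_translate[OF X0(1)[of x] c X uc X0(1)[of y] c]
        open_loop_optimal_translate[OF X0(2)[of x] X0(1)[of x] u X X0(2)[of y] X0(1)[of y]]
      unfolding eq closed_loop_state_iff by blast
  qed
  have "closed_loop_optimal t \<Theta> v"
    unfolding closed_loop_optimal_def
  proof (intro conjI allI \<Theta> v)
    fix y
    from outcomes[of y] obtain X' where X': "closed_loop_state t y \<Theta> v X'" "open_loop_optimal t y (outcome \<Theta> v X')"
      by blast
    have "J t y (outcome \<Theta> v X') \<le> J t y (outcome \<Theta>2 v2 X2)"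
      if "\<Theta>2 \<in> feedback_gains t" "v2 \<in> controls t" "closed_loop_state t y \<Theta>2 v2 X2" for \<Theta>2 v2 X2
    proof -
      have X2: "X2 \<in> L2C_prog M F t T"
        using that(3) unfolding closed_loop_state_iff by (rule state_L2C)
      have "outcome \<Theta>2 v2 X2 \<in> controls t"
        using controls_lincomb[OF feedback_controls[OF that(1) X2] that(2), of 1 1] by (simp add: outcome_def)
      then show ?thesis using X'(2) by (simp add: open_loop_optimal_iff)
    qed
    with X'(1) show "\<exists>X'. closed_loop_state t y \<Theta> v X' \<and>
        (\<forall>\<Theta>2\<in>feedback_gains t. \<forall>v2\<in>controls t. \<forall>X2. closed_loop_state t y \<Theta>2 v2 X2 \<longrightarrow>
           J t y (outcome \<Theta> v X') \<le> J t y (outcome \<Theta>2 v2 X2))"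
      by blast
  qed
  moreover have "closed_loop_state t x \<Theta> v X"
    using X unfolding closed_loop_state_iff u_eq[symmetric] .
  ultimately show ?thesis using u_eq by blast
qed

end

end

theorem corollary8p4:
  fixes M :: "'a measure"
    and W :: "real \<Rightarrow> 'a \<Rightarrow> real"
    and T t :: real
    and A C Q :: "real \<Rightarrow> real^'n^'n"
    and B D :: "real \<Rightarrow> real^'m^'n"
    and S :: "real \<Rightarrow> real^'n^'m"
    and R :: "real \<Rightarrow> real^'m^'m"
    and G :: "real^'n^'n"
    and b \<sigma> q :: "real \<Rightarrow> 'a \<Rightarrow> real^'n"
    and \<rho> :: "real \<Rightarrow> 'a \<Rightarrow> real^'m"
    and g :: "'a \<Rightarrow> real^'n"
  assumes "slq M W T A B b C D \<sigma> Q S R q \<rho> g G"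
    and "0 \<le> t" and "t < T"
    and "slq.closed_loop_representation M W T A B b C D \<sigma> Q S R q \<rho> g G t"
  shows "\<forall>x u. slq.open_loop_optimal M W T A B b C D \<sigma> Q S R q \<rho> g G t x u \<longrightarrow>
    (\<exists>\<Theta> v X. slq.closed_loop_optimal M W T A B b C D \<sigma> Q S R q \<rho> g G t \<Theta> v \<and>
       slq.closed_loop_state M W T A B b C D \<sigma> t x \<Theta> v X \<and>
       (AE s in lborel. s \<in> {t..T} \<longrightarrow>
          (AE \<omega> in M. u s \<omega> = slq.outcome \<Theta> v X s \<omega>)))"
proof -
  interpret slq M W T A B b C D \<sigma> Q S R q \<rho> g G by fact
  show ?thesis
    using optimal_control_is_outcome[OF assms(2-4)] by fastforce
qed

end
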